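(* Let the smoothness assumptions stated in the context hold (with constants $C_2$ bounding $|A|$ and $C_5$ bounding $|B|$). Let $\alpha>0$, $\beta\ge0$, $\zeta\ge0$, and let $\Theta\in C([0,\tau];C([0,1]))$ be the solution of $\partial_s\Theta(s,x)=-\alpha\int_0^1A(x,y)\Theta(s,y)\,dy$. Let $\xi_2,\xi_3$ be two independent centered Gaussian random field processes on $[0,\tau]\times[0,1]$ with $$\mathbb{E}[\xi_2(s_1,x)\xi_2(s_2,y)]=(s_1\wedge s_2)A(x,y),$$ $$\mathbb{E}[\xi_3(s_1,x)\xi_3(s_2,y)]=\int_0^{s_1\wedge s_2}\int_0^1\int_0^1\Theta(s,z_1)\Theta(s,z_2)\tilde B(x,z_1,y,z_2)\,dz_1dz_2ds,$$ where $\tilde B(x_1,x_2,x_3,x_4)=B(x_1,x_2,x_3,x_4)-A(x_1,x_2)A(x_3,x_4)$. Consider the SDE $$dU(s,x)=-\alpha\int_0^1A(x,y)U(s,y)\,dy\,ds+\alpha\beta\,d\xi_2(s,x)+\alpha\zeta\,d\xi_3(s,x),\quad s\in[0,\tau],\ x\in[0,1].\qquad( * )$$ 1. If the initial condition satisfies $U(0,\cdot)\in C([0,1])$, then there exists a unique solution $\{U(s,x)\}_{s\in[0,\tau],x\in[0,1]}\in C([0,\tau];C([0,1]))$ to $( * )$. 2. If the initial condition satisfies $U(0,\cdot)\in L^2([0,1])$, then there exists a unique solution $\{U(s,x)\}_{s\in[0,\tau],x\in[0,1]}\in C([0,\tau];L^2([0,1]))$ to $( * )$. Furthermore, it satisfies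 $$\mathbb{E}\Big[\sup_{s\in[0,\tau]}\|U(s,\cdot)\|_{L^2([0,1])}^2\Big]\le4\Big(\mathbb{E}\big[\|U(0,\cdot)\|_{L^2([0,1])}^2\big]+C_2\alpha^2\beta^2\tau+(C_5+C_2^2)\alpha^2\zeta^2\int_0^\tau\|\Theta(s,\cdot)\|_{L^2([0,1])}^2ds\Big)\exp(4C_2^2\alpha^2\tau^2).$$
   Context: $\tau\in(0,\infty)$. $A$, $B$, $E$ are real symmetric functions on $[0,1]^2$, $[0,1]^4$, $[0,1]^8$ which are the second, fourth and eighth moment functions of a centered process $\{W(s,x)\}_{s\ge0,x\in[0,1]}$ that is white in time: $\mathbb{E}[W(s,x_1)W(s,x_2)]=A(x_1,x_2)$, $\mathbb{E}[\prod_{i=1}^4W(s,x_i)]=B(x_1,\dots,x_4)$, $\mathbb{E}[\prod_{i=1}^8W(s,x_i)]=E(x_1,\dots,x_8)$. **Smoothness assumptions.** There are constants $C_2,\dots,C_9$ such that for all arguments in $[0,1]$: (1) $A(x,\cdot)\in C^1([0,1])$ for every $x$; $|A(x,y)|\le C_2$; $|A(x,z)-A(y,z)|\le C_3|x-y|$; $|A(x,x)+A(y,y)-2A(x,y)|\le C_4^2|x-y|^2$. (2) $|B(x_1,x_2,x_3,x_4)|\le C_5$; $|B(x_1,x_3,x_1,x_3)+B(x_2,x_3,x_2,x_3)-2B(x_1,x_3,x_2,x_3)|\le C_6^2|x_1-x_2|^2$; $|B(x_1,x_1,x_1,x_1)+B(x_2,x_2,x_2,x_2)+6B(x_1,x_1,x_2,x_2)-4B(x_1,x_1,x_1,x_2)-4B(x_1,x_2,x_2,x_2)|\le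 C_7^4|x_1-x_2|^4$. (3) $E(x_1,\dots,x_8)\le C_8$; with $\tilde x=(x_3,x_4,x_5,x_6)$, $|E(x_1,x_1,x_1,x_1,\tilde x)+E(x_2,x_2,x_2,x_2,\tilde x)+6E(x_1,x_1,x_2,x_2,\tilde x)-4E(x_1,x_1,x_1,x_2,\tilde x)-4E(x_1,x_2,x_2,x_2,\tilde x)|\le C_9^4|x_1-x_2|^4$. **Gaussian random field process.** A time-indexed random field $g$ on $[0,\tau]\times[0,1]$ such that $\{(g(t,x_1),\dots,g(t,x_K))\}_t$ is a multivariate Gaussian process for every finite $K$ and $x_1,\dots,x_K\in[0,1]$. $d\xi(s,x)$ is the increment in $s$. The SDE $( * )$ is understood in integral form: $U(s,x)=U(0,x)-\alpha\int_0^s\int_0^1A(x,y)U(u,y)\,dy\,du+\alpha\beta\int_0^sd\xi_2(u,x)+\alpha\zeta\int_0^sd\xi_3(u,x)$. Uniqueness is pathwise, for given $\xi_2,\xi_3$ and initial condition. $C([0,\tau];\mathcal H)$ is the space of $\mathcal H$-valued functions with continuous trajectories. *)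

theory Defs
  imports "HOL-Probability.Probability"
begin

(* Conventions: random fields are written W \<omega> s x, so that W \<omega> is the trajectory of \<omega>.
   Integrals over an interval J are Lebesgue integrals with respect to lebesgue_on J. *)

section \<open>The moment functions and their smoothness\<close>

definition symmetric2 :: "(real \<Rightarrow> real \<Rightarrow> real) \<Rightarrow> bool" where
  "symmetric2 A \<longleftrightarrow> (\<forall>x\<in>{0..1}. \<forall>y\<in>{0..1}. A x y = A y x)"

definition symmetric4 :: "(real \<Rightarrow> real \<Rightarrow> real \<Rightarrow> real \<Rightarrow> real) \<Rightarrow> bool" where
  "symmetric4 B \<longleftrightarrow>
    (\<forall>x p. (\<forall>i<4. x i \<in> {0..1}) \<and> p permutes {..<4::nat} \<longrightarrow>
      B (x (p 0)) (x (p 1)) (x (p 2)) (x (p 3)) = B (x 0) (x 1) (x 2) (x 3))"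

definition symmetric8 ::
  "(real \<Rightarrow> real \<Rightarrow> real \<Rightarrow> real \<Rightarrow> real \<Rightarrow> real \<Rightarrow> real \<Rightarrow> real \<Rightarrow> real) \<Rightarrow> bool" where
  "symmetric8 E \<longleftrightarrow>
    (\<forall>x p. (\<forall>i<8. x i \<in> {0..1}) \<and> p permutes {..<8::nat} \<longrightarrow>
      E (x (p 0)) (x (p 1)) (x (p 2)) (x (p 3)) (x (p 4)) (x (p 5)) (x (p 6)) (x (p 7))
      = E (x 0) (x 1) (x 2) (x 3) (x 4) (x 5) (x 6) (x 7))"

(* A, B, E are the second, fourth and eighth moments of the centered process W on the
   probability space N.  Integrability of W^8 makes all the expectations genuine integrals.
   White in time is taken in the weak sense: values at different times are uncorrelated. *)
definition moment_functions ::
  "'b measure \<Rightarrow> ('b \<Rightarrow> real \<Rightarrow> real \<Rightarrow> real) \<Rightarrow> (real \<Rightarrow> real \<Rightarrow> real) \<Rightarrow>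
   (real \<Rightarrow> real \<Rightarrow> real \<Rightarrow> real \<Rightarrow> real) \<Rightarrow>
   (real \<Rightarrow> real \<Rightarrow> real \<Rightarrow> real \<Rightarrow> real \<Rightarrow> real \<Rightarrow> real \<Rightarrow> real \<Rightarrow> real) \<Rightarrow> bool" where
  "moment_functions N W A B E \<longleftrightarrow>
    prob_space N \<and>
    (\<forall>s\<ge>0. \<forall>x\<in>{0..1}. (\<lambda>\<omega>. W \<omega> s x) \<in> borel_measurable N \<and>
        integrable N (\<lambda>\<omega>. W \<omega> s x ^ 8) \<and> (LINT \<omega>|N. W \<omega> s x) = 0) \<and>
    (\<forall>s\<ge>0. \<forall>t\<ge>0. s \<noteq> t \<longrightarrow>
        (\<forall>x\<in>{0..1}. \<forall>y\<in>{0..1}. (LINT \<omega>|N. W \<omega> s x * W \<omega> t y) = 0)) \<and>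
    (\<forall>s\<ge>0. \<forall>x1\<in>{0..1}. \<forall>x2\<in>{0..1}.
        (LINT \<omega>|N. W \<omega> s x1 * W \<omega> s x2) = A x1 x2) \<and>
    (\<forall>s\<ge>0. \<forall>x1\<in>{0..1}. \<forall>x2\<in>{0..1}. \<forall>x3\<in>{0..1}. \<forall>x4\<in>{0..1}.
        (LINT \<omega>|N. W \<omega> s x1 * W \<omega> s x2 * W \<omega> s x3 * W \<omega> s x4) = B x1 x2 x3 x4) \<and>
    (\<forall>s\<ge>0. \<forall>x1\<in>{0..1}. \<forall>x2\<in>{0..1}. \<forall>x3\<in>{0..1}. \<forall>x4\<in>{0..1}.
       \<forall>x5\<in>{0..1}. \<forall>x6\<in>{0..1}. \<forall>x7\<in>{0..1}. \<forall>x8\<in>{0..1}.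
        (LINT \<omega>|N. W \<omega> s x1 * W \<omega> s x2 * W \<omega> s x3 * W \<omega> s x4 *
                   W \<omega> s x5 * W \<omega> s x6 * W \<omega> s x7 * W \<omega> s x8)
        = E x1 x2 x3 x4 x5 x6 x7 x8)"

definition C1_on_unit :: "(real \<Rightarrow> real) \<Rightarrow> bool" where
  "C1_on_unit f \<longleftrightarrow>
    (\<exists>f'. continuous_on {0..1} f' \<and>
      (\<forall>y\<in>{0..1}. (f has_real_derivative f' y) (at y within {0..1})))"

definition smooth_A ::
  "(real \<Rightarrow> real \<Rightarrow> real) \<Rightarrow> real \<Rightarrow> real \<Rightarrow> real \<Rightarrow> bool" where
  "smooth_A A C2 C3 C4 \<longleftrightarrow>
    (\<forall>x\<in>{0..1}. C1_on_unit (A x)) \<and>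
    (\<forall>x\<in>{0..1}. \<forall>y\<in>{0..1}. \<bar>A x y\<bar> \<le> C2) \<and>
    (\<forall>x\<in>{0..1}. \<forall>y\<in>{0..1}. \<forall>z\<in>{0..1}. \<bar>A x z - A y z\<bar> \<le> C3 * \<bar>x - y\<bar>) \<and>
    (\<forall>x\<in>{0..1}. \<forall>y\<in>{0..1}. \<bar>A x x + A y y - 2 * A x y\<bar> \<le> C4^2 * \<bar>x - y\<bar>^2)"

definition smooth_B ::
  "(real \<Rightarrow> real \<Rightarrow> real \<Rightarrow> real \<Rightarrow> real) \<Rightarrow> real \<Rightarrow> real \<Rightarrow> real \<Rightarrow> bool" where
  "smooth_B B C5 C6 C7 \<longleftrightarrow>
    (\<forall>x1\<in>{0..1}. \<forall>x2\<in>{0..1}. \<forall>x3\<in>{0..1}. \<forall>x4\<in>{0..1}. \<bar>B x1 x2 x3 x4\<bar> \<le> C5) \<and>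
    (\<forall>x1\<in>{0..1}. \<forall>x2\<in>{0..1}. \<forall>x3\<in>{0..1}.
      \<bar>B x1 x3 x1 x3 + B x2 x3 x2 x3 - 2 * B x1 x3 x2 x3\<bar> \<le> C6^2 * \<bar>x1 - x2\<bar>^2) \<and>
    (\<forall>x1\<in>{0..1}. \<forall>x2\<in>{0..1}.
      \<bar>B x1 x1 x1 x1 + B x2 x2 x2 x2 + 6 * B x1 x1 x2 x2
        - 4 * B x1 x1 x1 x2 - 4 * B x1 x2 x2 x2\<bar> \<le> C7^4 * \<bar>x1 - x2\<bar>^4)"

definition smooth_E ::
  "(real \<Rightarrow> real \<Rightarrow> real \<Rightarrow> real \<Rightarrow> real \<Rightarrow> real \<Rightarrow> real \<Rightarrow> real \<Rightarrow> real) \<Rightarrow>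
   real \<Rightarrow> real \<Rightarrow> bool" where
  "smooth_E E C8 C9 \<longleftrightarrow>
    (\<forall>x1\<in>{0..1}. \<forall>x2\<in>{0..1}. \<forall>x3\<in>{0..1}. \<forall>x4\<in>{0..1}.
     \<forall>x5\<in>{0..1}. \<forall>x6\<in>{0..1}. \<forall>x7\<in>{0..1}. \<forall>x8\<in>{0..1}. E x1 x2 x3 x4 x5 x6 x7 x8 \<le> C8) \<and>
    (\<forall>x1\<in>{0..1}. \<forall>x2\<in>{0..1}. \<forall>x3\<in>{0..1}. \<forall>x4\<in>{0..1}. \<forall>x5\<in>{0..1}. \<forall>x6\<in>{0..1}.
      \<bar>E x1 x1 x1 x1 x3 x4 x5 x6 + E x2 x2 x2 x2 x3 x4 x5 x6 + 6 * E x1 x1 x2 x2 x3 x4 x5 x6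
        - 4 * E x1 x1 x1 x2 x3 x4 x5 x6 - 4 * E x1 x2 x2 x2 x3 x4 x5 x6\<bar>
      \<le> C9^4 * \<bar>x1 - x2\<bar>^4)"

definition Btilde ::
  "(real \<Rightarrow> real \<Rightarrow> real) \<Rightarrow> (real \<Rightarrow> real \<Rightarrow> real \<Rightarrow> real \<Rightarrow> real) \<Rightarrow>
   real \<Rightarrow> real \<Rightarrow> real \<Rightarrow> real \<Rightarrow> real" where
  "Btilde A B x1 x2 x3 x4 = B x1 x2 x3 x4 - A x1 x2 * A x3 x4"

section \<open>Function spaces\<close>

(* The trajectory space C([0,\<tau>]; C([0,1])), with the sup norm on C([0,1]). *)
definition C_C :: "real \<Rightarrow> (real \<Rightarrow> real \<Rightarrow> real) set" where
  "C_C \<tau> = {u. (\<forall>s\<in>{0..\<tau>}. continuous_on {0..1} (u s)) \<and>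
                (\<forall>s\<in>{0..\<tau>}. uniform_limit {0..1} u (u s) (at s within {0..\<tau>}))}"

(* Elements of L2([0,1]) are represented by functions, equality in L2([0,1]) being
   equality almost everywhere with respect to lebesgue_on {0..1}. *)
definition L2 :: "(real \<Rightarrow> real) set" where
  "L2 = {f. f \<in> borel_measurable (lebesgue_on {0..1}) \<and>
            integrable (lebesgue_on {0..1}) (\<lambda>x. (f x)^2)}"

definition L2_norm :: "(real \<Rightarrow> real) \<Rightarrow> real" where
  "L2_norm f = sqrt (LINT x|lebesgue_on {0..1}. (f x)^2)"

(* The trajectory space C([0,\<tau>]; L2([0,1])). *)
definition C_L2 :: "real \<Rightarrow> (real \<Rightarrow> real \<Rightarrow> real) set" where
  "C_L2 \<tau> = {u. (\<forall>s\<in>{0..\<tau>}. u s \<in> L2) \<and>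
                 (\<forall>s\<in>{0..\<tau>}. ((\<lambda>r. L2_norm (\<lambda>x. u r x - u s x)) \<longlongrightarrow> 0) (at s within {0..\<tau>}))}"

(* Random elements of C([0,1]): the Borel sigma-algebra is generated by the point evaluations. *)
definition random_C :: "'a measure \<Rightarrow> ('a \<Rightarrow> real \<Rightarrow> real) \<Rightarrow> bool" where
  "random_C M X \<longleftrightarrow>
    (\<forall>\<omega>\<in>space M. continuous_on {0..1} (X \<omega>)) \<and>
    (\<forall>x\<in>{0..1}. (\<lambda>\<omega>. X \<omega> x) \<in> borel_measurable M)"

(* Random elements of L2([0,1]): the space is separable, so its Borel sigma-algebra is
   generated by the balls, and the distances to all points of L2 determine measurability. *)
definition random_L2 :: "'a measure \<Rightarrow> ('a \<Rightarrow> real \<Rightarrow> real) \<Rightarrow> bool" where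
  "random_L2 M X \<longleftrightarrow>
    (\<forall>\<omega>\<in>space M. X \<omega> \<in> L2) \<and>
    (\<forall>h\<in>L2. (\<lambda>\<omega>. L2_norm (\<lambda>x. X \<omega> x - h x)) \<in> borel_measurable M)"

section \<open>Gaussian random field processes\<close>

(* Real Gaussian random variables, including the degenerate (constant) ones. *)
definition gaussian_rv :: "'a measure \<Rightarrow> ('a \<Rightarrow> real) \<Rightarrow> bool" where
  "gaussian_rv M X \<longleftrightarrow>
    X \<in> borel_measurable M \<and>
    ((\<exists>\<mu>. AE \<omega> in M. X \<omega> = \<mu>) \<or>
     (\<exists>\<mu> \<sigma>. \<sigma> > 0 \<and> distributed M lborel X (normal_density \<mu> \<sigma>)))"

(* The process t \<mapsto> (X t 0, ..., X t (K - 1)), t \<in> T, has jointly Gaussian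
   finite-dimensional distributions: every linear combination of finitely many of the
   coordinates is Gaussian. *)
definition multivariate_gaussian_process ::
  "'a measure \<Rightarrow> real set \<Rightarrow> nat \<Rightarrow> ('a \<Rightarrow> real \<Rightarrow> nat \<Rightarrow> real) \<Rightarrow> bool" where
  "multivariate_gaussian_process M T K X \<longleftrightarrow>
    (\<forall>F c. finite F \<and> F \<subseteq> T \<longrightarrow> gaussian_rv M (\<lambda>\<omega>. \<Sum>t\<in>F. \<Sum>k<K. c t k * X \<omega> t k))"

definition gaussian_random_field_process ::
  "'a measure \<Rightarrow> real \<Rightarrow> ('a \<Rightarrow> real \<Rightarrow> real \<Rightarrow> real) \<Rightarrow> bool" where
  "gaussian_random_field_process M \<tau> g \<longleftrightarrow>
    (\<forall>K x. (\<forall>k<K. x k \<in> {0..1}) \<longrightarrow>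
      multivariate_gaussian_process M {0..\<tau>} K (\<lambda>\<omega> t k. g \<omega> t (x k)))"

definition centered_field ::
  "'a measure \<Rightarrow> real \<Rightarrow> ('a \<Rightarrow> real \<Rightarrow> real \<Rightarrow> real) \<Rightarrow> bool" where
  "centered_field M \<tau> g \<longleftrightarrow>
    (\<forall>s\<in>{0..\<tau>}. \<forall>x\<in>{0..1}. integrable M (\<lambda>\<omega>. g \<omega> s x) \<and> (LINT \<omega>|M. g \<omega> s x) = 0)"

definition has_covariance ::
  "'a measure \<Rightarrow> real \<Rightarrow> ('a \<Rightarrow> real \<Rightarrow> real \<Rightarrow> real) \<Rightarrow>
   (real \<Rightarrow> real \<Rightarrow> real \<Rightarrow> real \<Rightarrow> real) \<Rightarrow> bool" where
  "has_covariance M \<tau> g \<Gamma> \<longleftrightarrow>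
    (\<forall>s1\<in>{0..\<tau>}. \<forall>s2\<in>{0..\<tau>}. \<forall>x\<in>{0..1}. \<forall>y\<in>{0..1}.
      integrable M (\<lambda>\<omega>. g \<omega> s1 x * g \<omega> s2 y) \<and>
      (LINT \<omega>|M. g \<omega> s1 x * g \<omega> s2 y) = \<Gamma> s1 x s2 y)"

definition independent_fields ::
  "'a measure \<Rightarrow> real \<Rightarrow> ('a \<Rightarrow> real \<Rightarrow> real \<Rightarrow> real) \<Rightarrow> ('a \<Rightarrow> real \<Rightarrow> real \<Rightarrow> real) \<Rightarrow> bool" where
  "independent_fields M \<tau> g h \<longleftrightarrow>
    prob_space.indep_var M
      (PiM ({0..\<tau>} \<times> {0..1}) (\<lambda>_. borel)) (\<lambda>\<omega>. \<lambda>p\<in>{0..\<tau>} \<times> {0..1}. g \<omega> (fst p) (snd p))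
      (PiM ({0..\<tau>} \<times> {0..1}) (\<lambda>_. borel)) (\<lambda>\<omega>. \<lambda>p\<in>{0..\<tau>} \<times> {0..1}. h \<omega> (fst p) (snd p))"

definition continuous_version ::
  "'a measure \<Rightarrow> real \<Rightarrow> ('a \<Rightarrow> real \<Rightarrow> real \<Rightarrow> real) \<Rightarrow> ('a \<Rightarrow> real \<Rightarrow> real \<Rightarrow> real) \<Rightarrow> bool" where
  "continuous_version M \<tau> \<xi> g \<longleftrightarrow>
    (\<forall>\<omega>\<in>space M. g \<omega> \<in> C_C \<tau>) \<and>
    (\<forall>s\<in>{0..\<tau>}. \<forall>x\<in>{0..1}. (\<lambda>\<omega>. g \<omega> s x) \<in> borel_measurable M \<and>
                              (AE \<omega> in M. g \<omega> s x = \<xi> \<omega> s x))"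

section \<open>The limiting equations\<close>

definition solves_theta ::
  "real \<Rightarrow> real \<Rightarrow> (real \<Rightarrow> real \<Rightarrow> real) \<Rightarrow> (real \<Rightarrow> real \<Rightarrow> real) \<Rightarrow> bool" where
  "solves_theta \<tau> \<alpha> A \<Theta> \<longleftrightarrow>
    \<Theta> \<in> C_C \<tau> \<and>
    (\<forall>s\<in>{0..\<tau>}. \<forall>x\<in>{0..1}.
      ((\<lambda>r. \<Theta> r x) has_real_derivative - \<alpha> * (LINT y|lebesgue_on {0..1}. A x y * \<Theta> s y))
        (at s within {0..\<tau>}))"

(* Right-hand side of the integral form of the equation, for one trajectory u and one
   trajectory of each of the noises g2, g3; the integral of d g(r,x) over [0,s] is
   g(s,x) - g(0,x). *)
definition sde_rhs ::
  "real \<Rightarrow> real \<Rightarrow> real \<Rightarrow> (real \<Rightarrow> real \<Rightarrow> real) \<Rightarrow> (real \<Rightarrow> real) \<Rightarrow>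
   (real \<Rightarrow> real \<Rightarrow> real) \<Rightarrow> (real \<Rightarrow> real \<Rightarrow> real) \<Rightarrow> (real \<Rightarrow> real \<Rightarrow> real) \<Rightarrow>
   real \<Rightarrow> real \<Rightarrow> real" where
  "sde_rhs \<alpha> \<beta> \<zeta> A u0 u g2 g3 s x =
     u0 x - \<alpha> * (LINT r|lebesgue_on {0..s}. (LINT y|lebesgue_on {0..1}. A x y * u r y))
     + \<alpha> * \<beta> * (g2 s x - g2 0 x) + \<alpha> * \<zeta> * (g3 s x - g3 0 x)"

(* A Gaussian random field process is given by its finite-dimensional distributions only, so
   d xi2, d xi3 refer to versions of the noises with trajectories in C([0,\<tau>]; C([0,1])).
   Any two such versions are indistinguishable, so the choice is immaterial; if xi2, xi3
   themselves have continuous trajectories, they can be used. *)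
definition solution_C ::
  "'a measure \<Rightarrow> real \<Rightarrow> real \<Rightarrow> real \<Rightarrow> real \<Rightarrow> (real \<Rightarrow> real \<Rightarrow> real) \<Rightarrow>
   ('a \<Rightarrow> real \<Rightarrow> real \<Rightarrow> real) \<Rightarrow> ('a \<Rightarrow> real \<Rightarrow> real \<Rightarrow> real) \<Rightarrow> ('a \<Rightarrow> real \<Rightarrow> real) \<Rightarrow>
   ('a \<Rightarrow> real \<Rightarrow> real \<Rightarrow> real) \<Rightarrow> bool" where
  "solution_C M \<tau> \<alpha> \<beta> \<zeta> A \<xi>2 \<xi>3 U0 U \<longleftrightarrow>
    (\<forall>\<omega>\<in>space M. U \<omega> \<in> C_C \<tau>) \<and>
    (\<forall>s\<in>{0..\<tau>}. random_C M (\<lambda>\<omega>. U \<omega> s)) \<and>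
    (\<exists>g2 g3. continuous_version M \<tau> \<xi>2 g2 \<and> continuous_version M \<tau> \<xi>3 g3 \<and>
      (AE \<omega> in M. \<forall>s\<in>{0..\<tau>}. \<forall>x\<in>{0..1}.
        U \<omega> s x = sde_rhs \<alpha> \<beta> \<zeta> A (U0 \<omega>) (U \<omega>) (g2 \<omega>) (g3 \<omega>) s x))"

(* In L2([0,1]) the equation is, for each s, an equality of elements of L2([0,1]). *)
definition solution_L2 ::
  "'a measure \<Rightarrow> real \<Rightarrow> real \<Rightarrow> real \<Rightarrow> real \<Rightarrow> (real \<Rightarrow> real \<Rightarrow> real) \<Rightarrow>
   ('a \<Rightarrow> real \<Rightarrow> real \<Rightarrow> real) \<Rightarrow> ('a \<Rightarrow> real \<Rightarrow> real \<Rightarrow> real) \<Rightarrow> ('a \<Rightarrow> real \<Rightarrow> real) \<Rightarrow>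
   ('a \<Rightarrow> real \<Rightarrow> real \<Rightarrow> real) \<Rightarrow> bool" where
  "solution_L2 M \<tau> \<alpha> \<beta> \<zeta> A \<xi>2 \<xi>3 U0 U \<longleftrightarrow>
    (\<forall>\<omega>\<in>space M. U \<omega> \<in> C_L2 \<tau>) \<and>
    (\<forall>s\<in>{0..\<tau>}. random_L2 M (\<lambda>\<omega>. U \<omega> s)) \<and>
    (\<exists>g2 g3. continuous_version M \<tau> \<xi>2 g2 \<and> continuous_version M \<tau> \<xi>3 g3 \<and>
      (AE \<omega> in M. \<forall>s\<in>{0..\<tau>}. AE x in lebesgue_on {0..1}.
        U \<omega> s x = sde_rhs \<alpha> \<beta> \<zeta> A (U0 \<omega>) (U \<omega>) (g2 \<omega>) (g3 \<omega>) s x))"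

end

theory Submission
  imports Defs
begin

text \<open>Subtracting the initial value and the noise from a solution leaves a path that is continuous in
  time and space, given by the Picard series of a linear Volterra equation; hence one construction serves
  continuous and square-integrable initial values alike. Uniqueness is Gronwall's lemma in L2.

  Continuous versions of the noises come from Kolmogorov's criterion with twelfth moments.
  For the second noise this rests on the Lipschitz continuity of \<open>B\<close>, which follows from the bound on the
  fourth moments of the increments of \<open>W\<close>.

  In the estimate, Doob's inequality for the supremum of the noise would lose too much. The combined noise is
  Gaussian with independent increments, so Levy's reflection argument gives the factor 2 in place of Doob's 4.
  Then \<open>(p + q)\<^sup>2 \<le> 3 (p\<^sup>2 + q\<^sup>2 / 2)\<close>, and \<open>3 exp (2 k) \<le> 4 exp (4 k\<^sup>2)\<close> for \<open>k = \<alpha> C2 \<tau>\<close>.\<close>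

section \<open>The Cramer-Wold device and the Levy maximal inequality\<close>

text \<open>The constants of the estimate decide the method. For \<open>0 < t < 1\<close> the best
  general bound of this kind is \<open>(p + q)^2 <= p^2 / t + q^2 / (1 - t)\<close>. The factor 4
  before the initial value forces \<open>t >= 1/4\<close>, so \<open>q^2\<close> gets at least 4/3;
  Doob's 4 would turn this into 16/3 > 4, even before Gronwall's exponential is paid for. With the
  factor 2, \<open>t = 1/3\<close> gives 3 for both terms and leaves 4/3 for the exponential.

  Reflection needs equality of joint laws, while the Gaussian hypotheses speak of linear
  combinations. Characteristic functions and a Cramer-Wold argument close this gap. The maximal
  inequality is applied at one point of space at a time, and the L2 norm is reached by averaging
  over space.

  The second obstacle is measurability: the fields are measurable only point by point, and the
  representatives of a random element of L2 have no measurable values at points. Hence every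
  measurability proof goes through finite sums and inner products.\<close>

context prob_space
begin

text \<open>The case \<open>t = 0\<close> shows that the two weights have the same integral
  \<open>m\<close>. If \<open>m > 0\<close>, division by it gives two probability laws with the same
  characteristic function, and Levy's uniqueness theorem applies; if \<open>m = 0\<close>, both
  weights vanish almost everywhere.\<close>

lemma weighted_char_unique:
  fixes u u' Y Y' :: "'a \<Rightarrow> real"
  assumes [measurable]: "u \<in> borel_measurable M" "u' \<in> borel_measurable M"
    "Y \<in> borel_measurable M" "Y' \<in> borel_measurable M"
    and u: "\<And>\<omega>. 0 \<le> u \<omega>" "\<And>\<omega>. u \<omega> \<le> c" and u': "\<And>\<omega>. 0 \<le> u' \<omega>" "\<And>\<omega>. u' \<omega> \<le> c"
    and eq: "\<And>t. (CLINT \<omega>|M. u \<omega> *\<^sub>R iexp (t * Y \<omega>)) = (CLINT \<omega>|M. u' \<omega> *\<^sub>R iexp (t * Y' \<omega>))"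
    and [measurable]: "A \<in> sets borel"
  shows "(LINT \<omega>|M. u \<omega> * indicator A (Y \<omega>)) = (LINT \<omega>|M. u' \<omega> * indicator A (Y' \<omega>))"
proof -
  define m where "m = (LINT \<omega>|M. u \<omega>)"
  have iu: "integrable M u" by (rule integrable_const_bound[of _ c]) (use u in auto)
  have iu': "integrable M u'" by (rule integrable_const_bound[of _ c]) (use u' in auto)
  have m': "(LINT \<omega>|M. u' \<omega>) = m"
  proof -
    have "complex_of_real (LINT \<omega>|M. u \<omega>) = complex_of_real (LINT \<omega>|M. u' \<omega>)"
      using eq[of 0] iu iu' by (simp add: scaleR_conv_of_real)
    then show ?thesis unfolding m_def by simp
  qed
  have m0: "m \<ge> 0" unfolding m_def using u by (intro integral_nonneg_AE) auto
  show ?thesis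
  proof (cases "m = 0")
    case True
    have "AE \<omega> in M. u \<omega> = 0" using integral_nonneg_eq_0_iff_AE[OF iu] u True m_def by auto
    moreover have "AE \<omega> in M. u' \<omega> = 0" using integral_nonneg_eq_0_iff_AE[OF iu'] u' True m' by auto
    ultimately have "(LINT \<omega>|M. u \<omega> * indicator A (Y \<omega>)) = (LINT \<omega>|M. 0)"
       "(LINT \<omega>|M. u' \<omega> * indicator A (Y' \<omega>)) = (LINT \<omega>|M. 0)"
      by (auto intro!: integral_eq_zero_AE elim: eventually_mono)
    then show ?thesis by simp
  next
    case False
    then have mp: "m > 0" using m0 by simp
    define \<mu> where "\<mu> v Z = distr (density M (\<lambda>\<omega>. ennreal (v \<omega> / m))) borel Z" for v Z :: "'a \<Rightarrow> real"
    have rd: "real_distribution (\<mu> v Z)"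
      if [measurable]: "v \<in> borel_measurable M" "Z \<in> borel_measurable M" and v: "\<And>\<omega>. 0 \<le> v \<omega>"
        and vi: "integrable M v" "(LINT \<omega>|M. v \<omega>) = m" for v Z
    proof -
      have "prob_space (density M (\<lambda>\<omega>. ennreal (v \<omega> / m)))"
      proof (rule prob_spaceI)
        have "(\<integral>\<^sup>+ \<omega>. ennreal (v \<omega> / m) \<partial>M) = ennreal (LINT \<omega>|M. v \<omega> / m)"
          by (rule nn_integral_eq_integral) (use v vi mp in auto)
        also have "\<dots> = 1" using vi mp by simp
        finally show "emeasure (density M (\<lambda>\<omega>. ennreal (v \<omega> / m))) (space (density M (\<lambda>\<omega>. ennreal (v \<omega> / m)))) = 1"
          by (subst emeasure_density) (auto cong: nn_integral_cong_simp)
      qed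
      then show ?thesis unfolding \<mu>_def
        by (intro real_distribution.intro prob_space.prob_space_distr) (auto simp: real_distribution_axioms_def)
    qed
    have ch: "char (\<mu> v Z) t = (CLINT \<omega>|M. v \<omega> *\<^sub>R iexp (t * Z \<omega>)) / m"
      if [measurable]: "v \<in> borel_measurable M" "Z \<in> borel_measurable M" and v: "\<And>\<omega>. 0 \<le> v \<omega>" for v Z t
    proof -
      have "char (\<mu> v Z) t = (CLINT \<omega>|M. (v \<omega> / m) *\<^sub>R iexp (t * Z \<omega>))"
        unfolding char_def \<mu>_def using v mp
        by (subst integral_distr) (auto simp: integral_density)
      also have "\<dots> = (CLINT \<omega>|M. (1/m) *\<^sub>R (v \<omega> *\<^sub>R iexp (t * Z \<omega>)))" by simp
      also have "\<dots> = (CLINT \<omega>|M. v \<omega> *\<^sub>R iexp (t * Z \<omega>)) / m"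
        by (subst integral_scaleR_right) (simp add: scaleR_conv_of_real field_simps)
      finally show ?thesis .
    qed
    have "\<mu> u Y = \<mu> u' Y'"
    proof (rule Levy_uniqueness)
      show "real_distribution (\<mu> u Y)" by (rule rd) (use u iu m_def in auto)
      show "real_distribution (\<mu> u' Y')" by (rule rd) (use u' iu' m' in auto)
      show "char (\<mu> u Y) = char (\<mu> u' Y')"
        by (rule ext, subst (1 2) ch) (use u u' eq in auto)
    qed
    then have E: "(LINT x|\<mu> u Y. indicator A x :: real) = (LINT x|\<mu> u' Y'. indicator A x)" by simp
    have ind: "(LINT x|\<mu> v Z. indicator A x :: real) = (LINT \<omega>|M. v \<omega> * indicator A (Z \<omega>)) / m"
      if [measurable]: "v \<in> borel_measurable M" "Z \<in> borel_measurable M" and v: "\<And>\<omega>. 0 \<le> v \<omega>" for v Z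
      unfolding \<mu>_def using v mp
      by (subst integral_distr) (auto simp: integral_density)
    show ?thesis using E ind[of u Y] ind[of u' Y'] u u' mp by simp
  qed
qed

text \<open>In the induction the remaining coordinates enter through the nonnegative weights
  \<open>1 + cos (S + \<theta>)\<close>, so that only the uniqueness theorem for positive measures on the line is needed.\<close>

lemma weighted_Cramer_Wold:
  fixes w w' :: "'a \<Rightarrow> real" and V V' :: "nat \<Rightarrow> 'a \<Rightarrow> real"
  assumes "w \<in> borel_measurable M" "w' \<in> borel_measurable M"
    and "\<And>i. V i \<in> borel_measurable M" "\<And>i. V' i \<in> borel_measurable M"
    and "\<And>\<omega>. 0 \<le> w \<omega>" "\<And>\<omega>. w \<omega> \<le> c" and "\<And>\<omega>. 0 \<le> w' \<omega>" "\<And>\<omega>. w' \<omega> \<le> c"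
    and "\<And>t. (CLINT \<omega>|M. w \<omega> *\<^sub>R iexp (\<Sum>i<m. t i * V i \<omega>)) = (CLINT \<omega>|M. w' \<omega> *\<^sub>R iexp (\<Sum>i<m. t i * V' i \<omega>))"
    and "\<And>i. A i \<in> sets borel"
  shows "(LINT \<omega>|M. w \<omega> * (\<Prod>i<m. indicator (A i) (V i \<omega>))) = (LINT \<omega>|M. w' \<omega> * (\<Prod>i<m. indicator (A i) (V' i \<omega>)))"
  using assms
proof (induction m arbitrary: w w' c)
  case 0
  note [measurable] = 0(1,2)
  have "integrable M w" by (rule integrable_const_bound[of _ c]) (use 0 in auto)
  moreover have "integrable M w'" by (rule integrable_const_bound[of _ c]) (use 0 in auto)
  ultimately have "complex_of_real (LINT \<omega>|M. w \<omega>) = complex_of_real (LINT \<omega>|M. w' \<omega>)"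
    using 0(9)[of "\<lambda>_. 0"] by (simp add: scaleR_conv_of_real)
  then show ?case by simp
next
  case (Suc m)
  note [measurable] = Suc.prems(1,2,3,4,10)
  define S where "S t \<omega> = (\<Sum>i<m. t i * V i \<omega>)" for t \<omega>
  define S' where "S' t \<omega> = (\<Sum>i<m. t i * V' i \<omega>)" for t \<omega>
  have [measurable]: "S t \<in> borel_measurable M" "S' t \<in> borel_measurable M" for t
    unfolding S_def S'_def by measurable
  have base: "(CLINT \<omega>|M. w \<omega> *\<^sub>R iexp (S t \<omega> + s * V m \<omega>)) = (CLINT \<omega>|M. w' \<omega> *\<^sub>R iexp (S' t \<omega> + s * V' m \<omega>))" for t s
  proof -
    have "(\<Sum>i<m. (t(m:=s)) i * f i) = (\<Sum>i<m. t i * f i)" for f :: "nat \<Rightarrow> real"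
      by (rule sum.cong) auto
    then show ?thesis using Suc.prems(9)[of "t(m:=s)"] by (simp add: S_def S'_def)
  qed
  have S0: "S (\<lambda>_. 0) = (\<lambda>_. 0)" "S' (\<lambda>_. 0) = (\<lambda>_. 0)" by (auto simp: S_def S'_def)
  have Sm: "S (\<lambda>i. - t i) \<omega> = - S t \<omega>" "S' (\<lambda>i. - t i) \<omega> = - S' t \<omega>" for t \<omega> by (auto simp: S_def S'_def sum_negf)
  let ?I = "\<lambda>\<omega>. indicator (A m) (V m \<omega>) :: real"
  let ?I' = "\<lambda>\<omega>. indicator (A m) (V' m \<omega>) :: real"
  have i1: "integrable M (\<lambda>\<omega>. w \<omega> *\<^sub>R g \<omega>)" if [measurable]: "g \<in> borel_measurable M" and "\<And>\<omega>. norm (g \<omega>) \<le> 2"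
    for g :: "'a \<Rightarrow> 'x::{banach,second_countable_topology}"
    by (rule integrable_const_bound[of _ "c*2"]) (use Suc.prems(5,6) that in \<open>auto intro!: AE_I2 mult_mono order_trans[OF Suc.prems(5) Suc.prems(6)]\<close>)
  have i1': "integrable M (\<lambda>\<omega>. w' \<omega> *\<^sub>R g \<omega>)" if [measurable]: "g \<in> borel_measurable M" and "\<And>\<omega>. norm (g \<omega>) \<le> 2"
    for g :: "'a \<Rightarrow> 'x::{banach,second_countable_topology}"
    by (rule integrable_const_bound[of _ "c*2"]) (use Suc.prems(7,8) that in \<open>auto intro!: AE_I2 mult_mono order_trans[OF Suc.prems(7) Suc.prems(8)]\<close>)
  have e0: "(LINT \<omega>|M. w \<omega> * ?I \<omega>) = (LINT \<omega>|M. w' \<omega> * ?I' \<omega>)"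
    by (rule weighted_char_unique[where c=c]) (use Suc.prems base[of "\<lambda>_. 0"] S0 in auto)
  have ec: "(LINT \<omega>|M. (w \<omega> * ?I \<omega>) * cos (S t \<omega> + \<theta>)) = (LINT \<omega>|M. (w' \<omega> * ?I' \<omega>) * cos (S' t \<omega> + \<theta>))" for t \<theta>
  proof -
    \<comment> \<open>Euler's formula splits the weight into three exponentials, so the hypothesis
      enters through \<open>base\<close> at the coefficient vectors 0, \<open>t\<close> and
      \<open>-t\<close>.\<close>
    have ex: "complex_of_real (1 + cos (a + \<theta>)) * iexp b = iexp b + (iexp \<theta> / 2) * iexp (a + b) + (iexp (-\<theta>) / 2) * iexp (- a + b)" for a b
      by (simp add: cos_of_real[symmetric] cos_exp_eq exp_add[symmetric] field_simps)
    have lin: "(CLINT \<omega>|M. F \<omega> + p * G \<omega> + q * H \<omega>) = (CLINT \<omega>|M. F \<omega>) + p * (CLINT \<omega>|M. G \<omega>) + q * (CLINT \<omega>|M. H \<omega>)"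
      if "complex_integrable M F" "complex_integrable M G" "complex_integrable M H" for F G H p q
      using that by simp
    have dist: "complex_of_real c * (X + p * Y + q * Z) = c *\<^sub>R X + p * (c *\<^sub>R Y) + q * (c *\<^sub>R Z)" for c X Y Z p q
      by (simp add: scaleR_conv_of_real algebra_simps)
    have exw: "(c * (1 + cos (a + \<theta>))) *\<^sub>R iexp b = c *\<^sub>R iexp b + (iexp \<theta> / 2) * (c *\<^sub>R iexp (a + b)) + (iexp (-\<theta>) / 2) * (c *\<^sub>R iexp (- a + b))" for a b c
      unfolding scaleR_conv_of_real[of "c * _"] of_real_mult[of c] mult.assoc ex dist ..
    have "(LINT \<omega>|M. (w \<omega> * (1 + cos (S t \<omega> + \<theta>))) * ?I \<omega>) = (LINT \<omega>|M. (w' \<omega> * (1 + cos (S' t \<omega> + \<theta>))) * ?I' \<omega>)"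
    proof (rule weighted_char_unique[where c="c*2"])
      fix s
      have "(CLINT \<omega>|M. (w \<omega> * (1 + cos (S t \<omega> + \<theta>))) *\<^sub>R iexp (s * V m \<omega>))
        = (CLINT \<omega>|M. w \<omega> *\<^sub>R iexp (s * V m \<omega>) + (iexp \<theta> / 2) * (w \<omega> *\<^sub>R iexp (S t \<omega> + s * V m \<omega>)) + (iexp (-\<theta>) / 2) * (w \<omega> *\<^sub>R iexp (- S t \<omega> + s * V m \<omega>)))"
        by (simp only: exw)
      also have "\<dots> = (CLINT \<omega>|M. w \<omega> *\<^sub>R iexp (s * V m \<omega>)) + (iexp \<theta> / 2) * (CLINT \<omega>|M. w \<omega> *\<^sub>R iexp (S t \<omega> + s * V m \<omega>)) + (iexp (-\<theta>) / 2) * (CLINT \<omega>|M. w \<omega> *\<^sub>R iexp (- S t \<omega> + s * V m \<omega>))"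
        by (intro lin i1) auto
      also have "\<dots> = (CLINT \<omega>|M. w' \<omega> *\<^sub>R iexp (s * V' m \<omega>)) + (iexp \<theta> / 2) * (CLINT \<omega>|M. w' \<omega> *\<^sub>R iexp (S' t \<omega> + s * V' m \<omega>)) + (iexp (-\<theta>) / 2) * (CLINT \<omega>|M. w' \<omega> *\<^sub>R iexp (- S' t \<omega> + s * V' m \<omega>))"
        using base[of "\<lambda>_. 0" s] base[of t s] base[of "\<lambda>i. - t i" s] by (simp add: S0 Sm)
      also have "\<dots> = (CLINT \<omega>|M. w' \<omega> *\<^sub>R iexp (s * V' m \<omega>) + (iexp \<theta> / 2) * (w' \<omega> *\<^sub>R iexp (S' t \<omega> + s * V' m \<omega>)) + (iexp (-\<theta>) / 2) * (w' \<omega> *\<^sub>R iexp (- S' t \<omega> + s * V' m \<omega>)))"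
        by (intro lin[symmetric] i1') auto
      also have "\<dots> = (CLINT \<omega>|M. (w' \<omega> * (1 + cos (S' t \<omega> + \<theta>))) *\<^sub>R iexp (s * V' m \<omega>))"
        by (simp only: exw)
      finally show "(CLINT \<omega>|M. (w \<omega> * (1 + cos (S t \<omega> + \<theta>))) *\<^sub>R iexp (s * V m \<omega>)) = (CLINT \<omega>|M. (w' \<omega> * (1 + cos (S' t \<omega> + \<theta>))) *\<^sub>R iexp (s * V' m \<omega>))" .
    next
      fix \<omega>
      have c1: "0 \<le> 1 + cos x" "1 + cos x \<le> 2" for x :: real using cos_ge_minus_one[of x] cos_le_one[of x] by linarith+
      have c: "0 \<le> c" using Suc.prems(5,6)[of \<omega>] by linarith
      show "0 \<le> w \<omega> * (1 + cos (S t \<omega> + \<theta>))" using Suc.prems(5) c1 by simp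
      show "0 \<le> w' \<omega> * (1 + cos (S' t \<omega> + \<theta>))" using Suc.prems(7) c1 by simp
      show "w \<omega> * (1 + cos (S t \<omega> + \<theta>)) \<le> c * 2" using Suc.prems(5,6) c1 c by (intro mult_mono) auto
      show "w' \<omega> * (1 + cos (S' t \<omega> + \<theta>)) \<le> c * 2" using Suc.prems(7,8) c1 c by (intro mult_mono) auto
    qed measurable
    then have "(LINT \<omega>|M. w \<omega> *\<^sub>R ?I \<omega> + w \<omega> *\<^sub>R (?I \<omega> * cos (S t \<omega> + \<theta>))) = (LINT \<omega>|M. w' \<omega> *\<^sub>R ?I' \<omega> + w' \<omega> *\<^sub>R (?I' \<omega> * cos (S' t \<omega> + \<theta>)))"
      by (simp add: algebra_simps)
    moreover have "(LINT \<omega>|M. w \<omega> *\<^sub>R ?I \<omega> + w \<omega> *\<^sub>R (?I \<omega> * cos (S t \<omega> + \<theta>))) = (LINT \<omega>|M. w \<omega> *\<^sub>R ?I \<omega>) + (LINT \<omega>|M. w \<omega> *\<^sub>R (?I \<omega> * cos (S t \<omega> + \<theta>)))"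
      by (intro Bochner_Integration.integral_add i1)
         (auto simp: indicator_def abs_mult intro!: order_trans[OF abs_cos_le_one])
    moreover have "(LINT \<omega>|M. w' \<omega> *\<^sub>R ?I' \<omega> + w' \<omega> *\<^sub>R (?I' \<omega> * cos (S' t \<omega> + \<theta>))) = (LINT \<omega>|M. w' \<omega> *\<^sub>R ?I' \<omega>) + (LINT \<omega>|M. w' \<omega> *\<^sub>R (?I' \<omega> * cos (S' t \<omega> + \<theta>)))"
      by (intro Bochner_Integration.integral_add i1')
         (auto simp: indicator_def abs_mult intro!: order_trans[OF abs_cos_le_one])
    ultimately show ?thesis using e0 by (simp add: algebra_simps)
  qed
  \<comment> \<open>The indicator of the last coordinate becomes part of the weight; this is why the
    induction runs over arbitrary bounded weights.\<close>
  have "(LINT \<omega>|M. (w \<omega> * ?I \<omega>) * (\<Prod>i<m. indicator (A i) (V i \<omega>))) = (LINT \<omega>|M. (w' \<omega> * ?I' \<omega>) * (\<Prod>i<m. indicator (A i) (V' i \<omega>)))"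
  proof (rule Suc.IH[of _ _ c])
    fix t
    \<comment> \<open>The phase \<open>-pi/2\<close> turns the cosine into a sine, so
      \<open>ec\<close> at two phases gives the real and the imaginary part.\<close>
    have cis: "(w \<omega> * j) *\<^sub>R iexp a = complex_of_real (w \<omega> *\<^sub>R (j * cos (a + 0))) + \<i> * complex_of_real (w \<omega> *\<^sub>R (j * cos (a + (- pi/2))))"
      "(w' \<omega> * j) *\<^sub>R iexp a = complex_of_real (w' \<omega> *\<^sub>R (j * cos (a + 0))) + \<i> * complex_of_real (w' \<omega> *\<^sub>R (j * cos (a + (- pi/2))))" for \<omega> j a
      unfolding cis_conv_exp[symmetric] by (auto simp: complex_eq_iff cos_diff)
    have "(CLINT \<omega>|M. (w \<omega> * ?I \<omega>) *\<^sub>R iexp (S t \<omega>)) =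
       complex_of_real (LINT \<omega>|M. w \<omega> *\<^sub>R (?I \<omega> * cos (S t \<omega> + 0))) + \<i> * complex_of_real (LINT \<omega>|M. w \<omega> *\<^sub>R (?I \<omega> * cos (S t \<omega> + (- pi/2))))"
      unfolding cis
      by (subst Bochner_Integration.integral_add)
         (auto simp del: scaleR_conv_of_real of_real_mult real_scaleR_def  intro!: i1 integrable_mult_right integrable_of_real simp: indicator_def abs_mult intro!: order_trans[OF abs_cos_le_one])
    moreover have "(CLINT \<omega>|M. (w' \<omega> * ?I' \<omega>) *\<^sub>R iexp (S' t \<omega>)) =
       complex_of_real (LINT \<omega>|M. w' \<omega> *\<^sub>R (?I' \<omega> * cos (S' t \<omega> + 0))) + \<i> * complex_of_real (LINT \<omega>|M. w' \<omega> *\<^sub>R (?I' \<omega> * cos (S' t \<omega> + (- pi/2))))"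
      unfolding cis
      by (subst Bochner_Integration.integral_add)
         (auto simp del: scaleR_conv_of_real of_real_mult real_scaleR_def  intro!: i1' integrable_mult_right integrable_of_real simp: indicator_def abs_mult intro!: order_trans[OF abs_cos_le_one])
    ultimately have "(CLINT \<omega>|M. (w \<omega> * ?I \<omega>) *\<^sub>R iexp (S t \<omega>)) = (CLINT \<omega>|M. (w' \<omega> * ?I' \<omega>) *\<^sub>R iexp (S' t \<omega>))"
      using ec[of t 0] ec[of t "-pi/2"] by (simp add: mult.assoc)
    then show "(CLINT \<omega>|M. (w \<omega> * ?I \<omega>) *\<^sub>R iexp (\<Sum>i<m. t i * V i \<omega>)) = (CLINT \<omega>|M. (w' \<omega> * ?I' \<omega>) *\<^sub>R iexp (\<Sum>i<m. t i * V' i \<omega>))"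
      by (simp add: S_def S'_def)
  next
    show "w \<omega> * ?I \<omega> \<le> c" for \<omega> using Suc.prems(5,6)[of \<omega>] by (auto simp: indicator_def)
    show "w' \<omega> * ?I' \<omega> \<le> c" for \<omega> using Suc.prems(7,8)[of \<omega>] by (auto simp: indicator_def)
  qed (use Suc.prems in auto)
  then show ?case by (simp add: mult_ac)
qed

text \<open>The events of the maximal inequality are rectangles, so the comparison of laws can stop
  here, short of the whole product sigma-algebra.\<close>

lemma Cramer_Wold_rectangle:
  fixes V V' :: "nat \<Rightarrow> 'a \<Rightarrow> real"
  assumes [measurable]: "\<And>i. V i \<in> borel_measurable M" "\<And>i. V' i \<in> borel_measurable M"
    and eq: "\<And>t. (CLINT \<omega>|M. iexp (\<Sum>i<m. t i * V i \<omega>)) = (CLINT \<omega>|M. iexp (\<Sum>i<m. t i * V' i \<omega>))"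
    and [measurable]: "\<And>i. A i \<in> sets borel"
  shows "prob {\<omega>\<in>space M. \<forall>i<m. V i \<omega> \<in> A i} = prob {\<omega>\<in>space M. \<forall>i<m. V' i \<omega> \<in> A i}"
proof -
  have P: "prob {\<omega>\<in>space M. \<forall>i<m. Z i \<omega> \<in> A i} = (LINT \<omega>|M. 1 * (\<Prod>i<m. indicator (A i) (Z i \<omega>)))"
    if [measurable]: "\<And>i. Z i \<in> borel_measurable M" for Z :: "nat \<Rightarrow> 'a \<Rightarrow> real"
  proof -
    have "(LINT \<omega>|M. 1 * (\<Prod>i<m. indicator (A i) (Z i \<omega>))) = (LINT \<omega>|M. indicator {\<omega>\<in>space M. \<forall>i<m. Z i \<omega> \<in> A i} \<omega> :: real)"
    proof (rule Bochner_Integration.integral_cong[OF refl])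
      fix \<omega> assume "\<omega> \<in> space M"
      then show "1 * (\<Prod>i<m. indicator (A i) (Z i \<omega>)) = (indicator {\<omega>\<in>space M. \<forall>i<m. Z i \<omega> \<in> A i} \<omega> :: real)"
        by (auto simp: indicator_def)
    qed
    then show ?thesis by simp
  qed
  show ?thesis unfolding P[OF assms(1)] P[OF assms(2)]
    by (rule weighted_Cramer_Wold[where c=1]) (use eq in auto)
qed

text \<open>The hypothesis says that reflecting the path after step \<open>k\<close> does not change the joint law.\<close>

lemma Levy_maximal_inequality:
  fixes X :: "nat \<Rightarrow> 'a \<Rightarrow> real"
  assumes [measurable]: "\<And>i. X i \<in> borel_measurable M"
    and refl: "\<And>k t b. k \<le> n \<Longrightarrow> (CLINT \<omega>|M. iexp ((\<Sum>i\<le>k. t i * X i \<omega>) + b * X n \<omega>)) =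
      (CLINT \<omega>|M. iexp ((\<Sum>i\<le>k. t i * X i \<omega>) + b * (2 * X k \<omega> - X n \<omega>)))"
  shows "prob {\<omega>\<in>space M. \<exists>j\<le>n. r < (X j \<omega>)\<^sup>2} \<le> 2 * prob {\<omega>\<in>space M. r < (X n \<omega>)\<^sup>2}"
proof -
  define F where "F k = {\<omega>\<in>space M. (\<forall>i<k. (X i \<omega>)\<^sup>2 \<le> r) \<and> r < (X k \<omega>)\<^sup>2}" for k
  have [measurable]: "F k \<in> sets M" for k unfolding F_def by measurable
  have disj: "disjoint_family_on F I" for I
    unfolding disjoint_family_on_def F_def by (auto simp: not_less[symmetric]) (metis linorder_neqE_nat)
  define G where "G k = F k \<inter> {\<omega>\<in>space M. r < (X n \<omega>)\<^sup>2}" for k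
  have [measurable]: "G k \<in> sets M" for k unfolding G_def by measurable
  have F: "prob (F k) \<le> 2 * prob (G k)" if k: "k \<le> n" for k
  proof -
    \<comment> \<open>First passage at step \<open>k\<close> concerns only the path up to
      \<open>k\<close>, which the reflection leaves alone. Hence \<open>G k\<close> and its mirror
      image \<open>G'\<close> are equally likely.\<close>
    define G' where "G' = F k \<inter> {\<omega>\<in>space M. r < (2 * X k \<omega> - X n \<omega>)\<^sup>2}"
    have [measurable]: "G' \<in> sets M" unfolding G'_def by measurable
    \<comment> \<open>Coordinates 0 to \<open>k\<close> record the path up to \<open>k\<close>.
      Coordinate \<open>Suc k\<close> records the end point, reflected in \<open>V'\<close>.\<close>
    define V where "V i = (if i \<le> k then X i else X n)" for i
    define V' where "V' i = (if i \<le> k then X i else (\<lambda>\<omega>. 2 * X k \<omega> - X n \<omega>))" for i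
    define A where "A i = (if i < k then {x::real. x\<^sup>2 \<le> r} else {x. r < x\<^sup>2})" for i
    have Am: "A i \<in> sets borel" for i
    proof -
      have "{x::real. x\<^sup>2 \<le> r} \<in> sets borel" "{x::real. r < x\<^sup>2} \<in> sets borel" by measurable
      then show ?thesis unfolding A_def by auto
    qed
    have all: "(\<forall>i<Suc (Suc k). P i) \<longleftrightarrow> (\<forall>i<k. P i) \<and> P k \<and> P (Suc k)" for P
      by (auto simp: less_Suc_eq)
    have "prob {\<omega>\<in>space M. \<forall>i<Suc (Suc k). V i \<omega> \<in> A i} = prob {\<omega>\<in>space M. \<forall>i<Suc (Suc k). V' i \<omega> \<in> A i}"
    proof (rule Cramer_Wold_rectangle)
      fix t
      have "(\<Sum>i<Suc (Suc k). t i * V i \<omega>) = (\<Sum>i\<le>k. t i * X i \<omega>) + t (Suc k) * X n \<omega>"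
           "(\<Sum>i<Suc (Suc k). t i * V' i \<omega>) = (\<Sum>i\<le>k. t i * X i \<omega>) + t (Suc k) * (2 * X k \<omega> - X n \<omega>)" for \<omega>
        by (simp_all add: V_def V'_def lessThan_Suc_atMost[symmetric])
      then show "(CLINT \<omega>|M. iexp (\<Sum>i<Suc (Suc k). t i * V i \<omega>)) = (CLINT \<omega>|M. iexp (\<Sum>i<Suc (Suc k). t i * V' i \<omega>))"
        using refl[OF k, of t "t (Suc k)"] by presburger
    qed (auto simp: V_def V'_def Am)
    moreover have "{\<omega>\<in>space M. \<forall>i<Suc (Suc k). V i \<omega> \<in> A i} = G k"
      unfolding all by (auto simp: V_def A_def G_def F_def)
    moreover have "{\<omega>\<in>space M. \<forall>i<Suc (Suc k). V' i \<omega> \<in> A i} = G'"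
      unfolding all by (auto simp: V'_def A_def G'_def F_def)
    ultimately have GG: "prob G' = prob (G k)" by simp
    have "F k \<subseteq> G k \<union> G'"
    proof
      fix \<omega> assume w: "\<omega> \<in> F k"
      \<comment> \<open>\<open>X k\<close> is the midpoint of \<open>X n\<close> and its reflection,
        so convexity of the square makes at least one of these two exceed the level.\<close>
      have "2 * (X k \<omega>)\<^sup>2 \<le> (X n \<omega>)\<^sup>2 + (2 * X k \<omega> - X n \<omega>)\<^sup>2"
        using zero_le_power2[of "X k \<omega> - X n \<omega>"] by (simp add: power2_eq_square algebra_simps)
      then have "r < (X n \<omega>)\<^sup>2 \<or> r < (2 * X k \<omega> - X n \<omega>)\<^sup>2" using w by (auto simp: F_def)
      then show "\<omega> \<in> G k \<union> G'" using w by (auto simp: G_def G'_def F_def)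
    qed
    then have "prob (F k) \<le> prob (G k \<union> G')" by (intro finite_measure_mono) auto
    also have "\<dots> \<le> prob (G k) + prob G'" by (intro measure_Un_le) auto
    finally show ?thesis using GG by simp
  qed
  have "{\<omega>\<in>space M. \<exists>j\<le>n. r < (X j \<omega>)\<^sup>2} = (\<Union>k\<le>n. F k)"
  proof (intro set_eqI iffI)
    fix \<omega> assume "\<omega> \<in> {\<omega>\<in>space M. \<exists>j\<le>n. r < (X j \<omega>)\<^sup>2}"
    then obtain j where w: "\<omega> \<in> space M" and j: "j \<le> n" "r < (X j \<omega>)\<^sup>2" by auto
    define k where "k = (LEAST j. r < (X j \<omega>)\<^sup>2)"
    have "r < (X k \<omega>)\<^sup>2" unfolding k_def using j(2) by (rule LeastI)
    moreover have "k \<le> n" using Least_le[of "\<lambda>j. r < (X j \<omega>)\<^sup>2", OF j(2)] j(1) k_def by simp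
    moreover have "\<forall>i<k. (X i \<omega>)\<^sup>2 \<le> r" using not_less_Least unfolding k_def by (metis not_less)
    ultimately show "\<omega> \<in> (\<Union>k\<le>n. F k)" using w by (auto simp: F_def)
  qed (auto simp: F_def)
  then have "prob {\<omega>\<in>space M. \<exists>j\<le>n. r < (X j \<omega>)\<^sup>2} = (\<Sum>k\<le>n. prob (F k))"
    by (simp add: finite_measure_finite_Union disj image_subset_iff)
  also have "\<dots> \<le> (\<Sum>k\<le>n. 2 * prob (G k))" using F by (intro sum_mono) auto
  also have "\<dots> = 2 * prob (\<Union>k\<le>n. G k)"
  proof -
    have "disjoint_family_on G {..n}" using disj[of "{..n}"] unfolding disjoint_family_on_def G_def by blast
    then show ?thesis by (simp add: finite_measure_finite_Union image_subset_iff sum_distrib_left)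
  qed
  also have "\<dots> \<le> 2 * prob {\<omega>\<in>space M. r < (X n \<omega>)\<^sup>2}"
    by (auto simp: G_def intro!: finite_measure_mono)
  finally show ?thesis .
qed

lemma layer_cake:
  assumes [measurable]: "f \<in> borel_measurable M" and f: "\<And>\<omega>. 0 \<le> f \<omega>"
  shows "(\<integral>\<^sup>+\<omega>. ennreal (f \<omega>) \<partial>M) = (\<integral>\<^sup>+r. indicator {0..} r * emeasure M {\<omega>\<in>space M. r < f \<omega>} \<partial>lborel)"
proof -
  interpret P: pair_sigma_finite M lborel ..
  have "(\<integral>\<^sup>+\<omega>. ennreal (f \<omega>) \<partial>M) = (\<integral>\<^sup>+\<omega>. (\<integral>\<^sup>+r. indicator {0..<f \<omega>} r \<partial>lborel) \<partial>M)"
    using f by simp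
  also have "\<dots> = (\<integral>\<^sup>+\<omega>. (\<integral>\<^sup>+r. indicator {0..} r * indicator {..<f \<omega>} r \<partial>lborel) \<partial>M)"
    by (intro nn_integral_cong) (auto simp: indicator_def)
  also have "\<dots> = (\<integral>\<^sup>+r. (\<integral>\<^sup>+\<omega>. indicator {0..} r * indicator {..<f \<omega>} r \<partial>M) \<partial>lborel)"
    by (rule P.Fubini'[symmetric]) (simp add: indicator_def split_beta')
  also have "\<dots> = (\<integral>\<^sup>+r. indicator {0..} r * emeasure M {\<omega>\<in>space M. r < f \<omega>} \<partial>lborel)"
  proof (rule nn_integral_cong)
    fix r
    have "(\<integral>\<^sup>+\<omega>. indicator {0..} r * indicator {..<f \<omega>} r \<partial>M) = indicator {0..} r * (\<integral>\<^sup>+\<omega>. indicator {\<omega>\<in>space M. r < f \<omega>} \<omega> \<partial>M)"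
      by (subst nn_integral_cmult[symmetric]) (auto intro!: nn_integral_cong simp: indicator_def)
    then show "(\<integral>\<^sup>+\<omega>. indicator {0..} r * indicator {..<f \<omega>} r \<partial>M) = indicator {0..} r * emeasure M {\<omega>\<in>space M. r < f \<omega>}"
      by simp
  qed
  finally show ?thesis .
qed

text \<open>Integration of the tail inequality over all levels preserves the factor 2.\<close>

lemma Levy_maximal_square:
  fixes X :: "nat \<Rightarrow> 'a \<Rightarrow> real"
  assumes [measurable]: "\<And>i. X i \<in> borel_measurable M"
    and refl: "\<And>k t b. k \<le> n \<Longrightarrow> (CLINT \<omega>|M. iexp ((\<Sum>i\<le>k. t i * X i \<omega>) + b * X n \<omega>)) =
      (CLINT \<omega>|M. iexp ((\<Sum>i\<le>k. t i * X i \<omega>) + b * (2 * X k \<omega> - X n \<omega>)))"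
  shows "(\<integral>\<^sup>+\<omega>. ennreal (MAX j\<in>{..n}. (X j \<omega>)\<^sup>2) \<partial>M) \<le> 2 * (\<integral>\<^sup>+\<omega>. ennreal ((X n \<omega>)\<^sup>2) \<partial>M)"
proof -
  have "(\<integral>\<^sup>+\<omega>. ennreal (MAX j\<in>{..n}. (X j \<omega>)\<^sup>2) \<partial>M)
    = (\<integral>\<^sup>+r. indicator {0..} r * emeasure M {\<omega>\<in>space M. r < (MAX j\<in>{..n}. (X j \<omega>)\<^sup>2)} \<partial>lborel)"
    by (rule layer_cake) (auto simp: Max_ge_iff)
  also have "\<dots> \<le> (\<integral>\<^sup>+r. 2 * (indicator {0..} r * emeasure M {\<omega>\<in>space M. r < (X n \<omega>)\<^sup>2}) \<partial>lborel)"
  proof (rule nn_integral_mono)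
    fix r :: real
    have "{\<omega>\<in>space M. r < (MAX j\<in>{..n}. (X j \<omega>)\<^sup>2)} = {\<omega>\<in>space M. \<exists>j\<le>n. r < (X j \<omega>)\<^sup>2}"
      by (auto simp: Max_gr_iff)
    moreover have "emeasure M {\<omega>\<in>space M. \<exists>j\<le>n. r < (X j \<omega>)\<^sup>2} \<le> 2 * emeasure M {\<omega>\<in>space M. r < (X n \<omega>)\<^sup>2}"
      using Levy_maximal_inequality[OF assms, of r]
      by (simp add: emeasure_eq_measure ennreal_mult'[symmetric] flip: ennreal_numeral)
    ultimately show "indicator {0..} r * emeasure M {\<omega>\<in>space M. r < (MAX j\<in>{..n}. (X j \<omega>)\<^sup>2)} \<le> 2 * (indicator {0..} r * emeasure M {\<omega>\<in>space M. r < (X n \<omega>)\<^sup>2})"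
      by (auto simp: indicator_def)
  qed
  also have "\<dots> = 2 * (\<integral>\<^sup>+r. indicator {0..} r * emeasure M {\<omega>\<in>space M. r < (X n \<omega>)\<^sup>2} \<partial>lborel)"
    by (subst nn_integral_cmult) (auto)
  also have "(\<integral>\<^sup>+r. indicator {0..} r * emeasure M {\<omega>\<in>space M. r < (X n \<omega>)\<^sup>2} \<partial>lborel) = (\<integral>\<^sup>+\<omega>. ennreal ((X n \<omega>)\<^sup>2) \<partial>M)"
    by (rule layer_cake[symmetric]) auto
  finally show ?thesis .
qed

end

section \<open>Kolmogorov continuity on the square\<close>

definition hat :: "real \<Rightarrow> real" where
  "hat u = max 0 (1 - \<bar>u\<bar>)"

definition dyadic_pt :: "nat \<Rightarrow> nat \<times> nat \<Rightarrow> real \<times> real" where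
  "dyadic_pt n p = (real (fst p) / 2^n, real (snd p) / 2^n)"

definition dyadic_grid :: "nat \<Rightarrow> (nat \<times> nat) set" where
  "dyadic_grid n = {..2^n} \<times> {..2^n}"

text \<open>The weights of bilinear interpolation on the dyadic grid, so that the approximating
  fields are continuous by construction.\<close>

definition hat_weight :: "nat \<Rightarrow> nat \<times> nat \<Rightarrow> real \<times> real \<Rightarrow> real" where
  "hat_weight n p z = hat (2^n * fst z - fst p) * hat (2^n * snd z - snd p)"

definition sup_dist :: "real \<times> real \<Rightarrow> real \<times> real \<Rightarrow> real" where
  "sup_dist z z' = max \<bar>fst z - fst z'\<bar> \<bar>snd z - snd z'\<bar>"

lemma hat_nonneg: "0 \<le> hat u" by (simp add: hat_def)

text \<open>For \<open>u\<close> at most \<open>N\<close> the new tent contributes nothing; for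
  \<open>u\<close> between \<open>N\<close> and \<open>Suc N\<close> only the last two tents meet
  \<open>u\<close>.\<close>

lemma hat_partition:
  fixes u :: real
  assumes "0 \<le> u" "u \<le> real N"
  shows "(\<Sum>i\<le>N. hat (u - real i)) = 1"
  using assms
proof (induction N)
  case 0 then show ?case by (simp add: hat_def)
next
  case (Suc N)
  show ?case
  proof (cases "u \<le> real N")
    case True
    then show ?thesis using Suc by (simp add: hat_def)
  next
    case False
    have "(\<Sum>i<N. hat (u - real i)) = 0" using False by (intro sum.neutral) (auto simp: hat_def)
    then have "(\<Sum>i\<le>N. hat (u - real i)) = hat (u - N)" by (simp add: lessThan_Suc_atMost[symmetric])
    then show ?thesis using False Suc.prems by (simp add: hat_def)
  qed
qed

lemma hat_weight_nonneg: "0 \<le> hat_weight n p z" by (simp add: hat_weight_def hat_nonneg)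

lemma hat_weight_sum:
  assumes "z \<in> {0..1} \<times> {0..1}"
  shows "(\<Sum>p\<in>dyadic_grid n. hat_weight n p z) = 1"
proof -
  have "(\<Sum>p\<in>dyadic_grid n. hat_weight n p z)
    = (\<Sum>i\<le>2^n. hat (2^n * fst z - real i)) * (\<Sum>j\<le>2^n. hat (2^n * snd z - real j))"
    by (simp add: dyadic_grid_def hat_weight_def sum_product sum.cartesian_product split_beta)
  also have "\<dots> = 1" using assms by (subst (1 2) hat_partition) auto
  finally show ?thesis .
qed

lemma hat_weight_near:
  assumes "hat_weight n p z \<noteq> 0"
  shows "sup_dist (dyadic_pt n p) z \<le> 1 / 2^n"
proof -
  have *: "\<bar>real i / 2^n - s\<bar> \<le> 1 / 2^n" if "hat (2^n * s - real i) \<noteq> 0" for i s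
  proof -
    have "\<bar>2^n * s - real i\<bar> \<le> 1" using that by (auto simp: hat_def split: if_splits)
    moreover have "\<bar>2^n * s - real i\<bar> = 2^n * \<bar>real i / 2^n - s\<bar>"
      by (simp add: abs_mult_pos' right_diff_distrib abs_minus_commute)
    ultimately show ?thesis by (simp add: field_simps)
  qed
  show ?thesis using assms *[of "fst z" "fst p"] *[of "snd z" "snd p"]
    by (auto simp: hat_weight_def sup_dist_def dyadic_pt_def)
qed

lemma dyadic_pt_in: "p \<in> dyadic_grid n \<Longrightarrow> dyadic_pt n p \<in> {0..1} \<times> {0..1}"
proof -
  assume "p \<in> dyadic_grid n"
  then have "fst p \<le> 2^n" "snd p \<le> 2^n" by (auto simp: dyadic_grid_def)
  then have "real (fst p) \<le> 2^n" "real (snd p) \<le> 2^n" by (simp_all flip: of_nat_le_iff)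
  then show ?thesis by (simp add: dyadic_pt_def mem_Times_iff)
qed

lemma finite_dyadic_grid: "finite (dyadic_grid n)" by (simp add: dyadic_grid_def)

lemma card_dyadic_grid: "real (card (dyadic_grid n)) \<le> 4 * 4^n"
proof -
  have "real (card (dyadic_grid n)) = (2^n + 1) * (2^n + 1)"
    by (simp add: dyadic_grid_def card_cartesian_product algebra_simps)
  also have "\<dots> \<le> (2 * 2^n) * (2 * 2^n)" by (intro mult_mono) auto
  also have "\<dots> = 4 * 4^n" by (simp add: power_mult_distrib[symmetric])
  finally show ?thesis .
qed

lemma sup_dist_triangle: "sup_dist a c \<le> sup_dist a b + sup_dist b c"
  unfolding sup_dist_def by (auto simp: max_def)

lemma sup_dist_commute: "sup_dist a b = sup_dist b a"
  unfolding sup_dist_def by (simp add: abs_minus_commute)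

text \<open>Both sums are averages with respect to the product weights \<open>a p * b q\<close>, so
  their difference averages the differences \<open>f p - f' q\<close>.\<close>

lemma convex_combination_diff:
  fixes a f :: "'i \<Rightarrow> real" and b f' :: "'j \<Rightarrow> real"
  assumes "finite P" "finite Q" "\<And>p. 0 \<le> a p" "\<And>q. 0 \<le> b q" "sum a P = 1" "sum b Q = 1"
    and D: "\<And>p q. p \<in> P \<Longrightarrow> q \<in> Q \<Longrightarrow> a p \<noteq> 0 \<Longrightarrow> b q \<noteq> 0 \<Longrightarrow> \<bar>f p - f' q\<bar> \<le> D"
  shows "\<bar>(\<Sum>p\<in>P. a p * f p) - (\<Sum>q\<in>Q. b q * f' q)\<bar> \<le> D"
proof -
  have 1: "(\<Sum>p\<in>P. a p * f p) = (\<Sum>p\<in>P. \<Sum>q\<in>Q. a p * b q * f p)"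
    by (simp add: sum_distrib_right[symmetric] sum_distrib_left[symmetric] assms)
  have 2: "(\<Sum>q\<in>Q. b q * f' q) = (\<Sum>p\<in>P. \<Sum>q\<in>Q. a p * b q * f' q)"
    by (simp add: mult.assoc sum_distrib_right[symmetric] sum_distrib_left[symmetric] assms)
  have "\<bar>(\<Sum>p\<in>P. a p * f p) - (\<Sum>q\<in>Q. b q * f' q)\<bar> = \<bar>\<Sum>p\<in>P. \<Sum>q\<in>Q. a p * b q * (f p - f' q)\<bar>"
    unfolding 1 2 by (simp add: sum_subtractf[symmetric] right_diff_distrib)
  also have "\<dots> \<le> (\<Sum>p\<in>P. \<Sum>q\<in>Q. \<bar>a p * b q * (f p - f' q)\<bar>)"
    by (rule order_trans[OF sum_abs]) (intro sum_mono sum_abs)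
  also have "\<dots> \<le> (\<Sum>p\<in>P. \<Sum>q\<in>Q. a p * b q * D)"
  proof (intro sum_mono)
    fix p q assume pq: "p \<in> P" "q \<in> Q"
    show "\<bar>a p * b q * (f p - f' q)\<bar> \<le> a p * b q * D"
    proof (cases "a p = 0 \<or> b q = 0")
      case False
      then show ?thesis using D[OF pq] assms(3)[of p] assms(4)[of q] by (simp add: abs_mult mult_left_mono)
    qed auto
  qed
  also have "\<dots> = D" by (simp add: sum_distrib_right[symmetric] sum_distrib_left[symmetric] assms)
  finally show ?thesis .
qed

text \<open>An additive form of Chebyshev's inequality: beyond \<open>r\<close>, the number
  \<open>y\<close> is at most \<open>y^12 / r^11\<close>. It makes increments summable directly from
  their moments, in place of a Borel-Cantelli argument.\<close>

lemma le_add_power_ratio: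
  fixes y r :: real
  assumes "0 \<le> y" "0 < r"
  shows "y \<le> r + y^12 / r^11"
proof (cases "y \<le> r")
  case True then show ?thesis using assms by (simp add: add_increasing2)
next
  case False
  then have "r^11 \<le> y^11" using assms by (intro power_mono) auto
  then have "y * r^11 \<le> y^12" using assms mult_left_mono[of "r^11" "y^11" y] by (simp add: power_eq_if)
  then have "y \<le> y^12 / r^11" using assms by (simp add: pos_le_divide_eq)
  then show ?thesis using assms by linarith
qed

lemma AE_summable_of_geometric:
  fixes Z :: "nat \<Rightarrow> 'a \<Rightarrow> real"
  assumes [measurable]: "\<And>n. Z n \<in> borel_measurable M" and nn: "\<And>n \<omega>. 0 \<le> Z n \<omega>"
    and b: "\<And>n. (\<integral>\<^sup>+\<omega>. ennreal (Z n \<omega>) \<partial>M) \<le> ennreal (c * q^n)" and q: "0 \<le> q" "q < 1" and c: "0 \<le> c"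
  shows "AE \<omega> in M. summable (\<lambda>n. Z n \<omega>)"
proof -
  have "(\<integral>\<^sup>+\<omega>. (\<Sum>n. ennreal (Z n \<omega>)) \<partial>M) = (\<Sum>n. \<integral>\<^sup>+\<omega>. ennreal (Z n \<omega>) \<partial>M)"
    by (rule nn_integral_suminf) auto
  also have "\<dots> \<le> (\<Sum>n. ennreal (c * q^n))" by (intro suminf_le b) auto
  also have "\<dots> < \<infinity>"
    using q c by (subst suminf_ennreal2) (auto intro!: summable_mult summable_geometric)
  finally have "AE \<omega> in M. (\<Sum>n. ennreal (Z n \<omega>)) \<noteq> \<infinity>"
    by (intro nn_integral_PInf_AE) auto
  then show ?thesis
    by eventually_elim (auto intro!: summable_suminf_not_top simp: nn)
qed

definition dyadic_interp :: "(real \<times> real \<Rightarrow> 'a \<Rightarrow> real) \<Rightarrow> nat \<Rightarrow> 'a \<Rightarrow> real \<times> real \<Rightarrow> real" where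
  "dyadic_interp X n \<omega> z = (\<Sum>p\<in>dyadic_grid n. hat_weight n p z * X (dyadic_pt n p) \<omega>)"

lemma continuous_dyadic_interp: "continuous_on S (dyadic_interp X n \<omega>)"
  unfolding dyadic_interp_def hat_weight_def hat_def by (intro continuous_intros)

text \<open>The number of these pairs is bounded crudely, by that of all pairs, because the twelfth moments
  \<open>(2 / 2^n)^6\<close> outweigh even \<open>64 * 16^n\<close>.\<close>

definition near_pairs :: "nat \<Rightarrow> ((nat \<times> nat) \<times> (nat \<times> nat)) set" where
  "near_pairs n = {(p, q). p \<in> dyadic_grid (Suc n) \<and> q \<in> dyadic_grid n \<and>
     sup_dist (dyadic_pt (Suc n) p) (dyadic_pt n q) \<le> 2 / 2^n}"

lemma finite_near_pairs: "finite (near_pairs n)"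
  by (rule finite_subset[of _ "dyadic_grid (Suc n) \<times> dyadic_grid n"])
     (auto simp: near_pairs_def finite_dyadic_grid)

lemma card_near_pairs: "real (card (near_pairs n)) \<le> 64 * 16^n"
proof -
  have "card (near_pairs n) \<le> card (dyadic_grid (Suc n) \<times> dyadic_grid n)"
    by (intro card_mono) (auto simp: near_pairs_def finite_dyadic_grid)
  then have "real (card (near_pairs n)) \<le> real (card (dyadic_grid (Suc n))) * real (card (dyadic_grid n))"
    by (simp add: card_cartesian_product flip: of_nat_mult)
  also have "\<dots> \<le> (4 * 4^(Suc n)) * (4 * 4^n)" by (intro mult_mono card_dyadic_grid) auto
  also have "\<dots> = 64 * 16^n" by (simp add: power_mult_distrib[symmetric])
  finally show ?thesis .
qed

text \<open>Grid points of consecutive levels that carry weight at the same \<open>z\<close> form a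
  pair of \<open>near_pairs\<close>. The sum over all such pairs does not depend on
  \<open>z\<close>, so the bound is uniform in \<open>z\<close>.\<close>

lemma dyadic_interp_increment:
  assumes "z \<in> {0..1} \<times> {0..1}" "r > 0"
  shows "\<bar>dyadic_interp X (Suc n) \<omega> z - dyadic_interp X n \<omega> z\<bar>
    \<le> r + (\<Sum>(p,q)\<in>near_pairs n. \<bar>X (dyadic_pt (Suc n) p) \<omega> - X (dyadic_pt n q) \<omega>\<bar>^12) / r^11"
  unfolding dyadic_interp_def
proof (rule convex_combination_diff)
  fix p q assume pq: "p \<in> dyadic_grid (Suc n)" "q \<in> dyadic_grid n" and nz: "hat_weight (Suc n) p z \<noteq> 0" "hat_weight n q z \<noteq> 0"
  have "sup_dist (dyadic_pt (Suc n) p) (dyadic_pt n q) \<le> 1 / 2^Suc n + 1 / 2^n"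
    using sup_dist_triangle[of "dyadic_pt (Suc n) p" "dyadic_pt n q" z] hat_weight_near[OF nz(1)] hat_weight_near[OF nz(2)] sup_dist_commute[of z]
    by fastforce
  also have "\<dots> \<le> 2 / 2^n" by (simp add: field_simps)
  finally have "(p, q) \<in> near_pairs n" using pq by (simp add: near_pairs_def)
  then have "\<bar>X (dyadic_pt (Suc n) p) \<omega> - X (dyadic_pt n q) \<omega>\<bar>^12 \<le> (\<Sum>(p,q)\<in>near_pairs n. \<bar>X (dyadic_pt (Suc n) p) \<omega> - X (dyadic_pt n q) \<omega>\<bar>^12)"
    using member_le_sum[of "(p,q)" "near_pairs n" "\<lambda>(p,q). \<bar>X (dyadic_pt (Suc n) p) \<omega> - X (dyadic_pt n q) \<omega>\<bar>^12"]
    by (auto simp: finite_near_pairs)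
  then show "\<bar>X (dyadic_pt (Suc n) p) \<omega> - X (dyadic_pt n q) \<omega>\<bar> \<le> r + (\<Sum>(p,q)\<in>near_pairs n. \<bar>X (dyadic_pt (Suc n) p) \<omega> - X (dyadic_pt n q) \<omega>\<bar>^12) / r^11"
    using le_add_power_ratio[of "\<bar>X (dyadic_pt (Suc n) p) \<omega> - X (dyadic_pt n q) \<omega>\<bar>" r] assms(2)
    by (smt (verit, best) abs_ge_zero divide_right_mono zero_le_power)
qed (use assms in \<open>auto simp: finite_dyadic_grid hat_weight_nonneg hat_weight_sum\<close>)

text \<open>Here the sum depends on \<open>z\<close>. This is harmless, since the limit is compared
  with the field at one point at a time.\<close>

lemma dyadic_interp_error:
  assumes "z \<in> {0..1} \<times> {0..1}" "r > 0"
  shows "\<bar>dyadic_interp X n \<omega> z - X z \<omega>\<bar>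
    \<le> r + (\<Sum>p\<in>{p\<in>dyadic_grid n. sup_dist (dyadic_pt n p) z \<le> 1 / 2^n}. \<bar>X (dyadic_pt n p) \<omega> - X z \<omega>\<bar>^12) / r^11"
proof -
  \<comment> \<open>The value at \<open>z\<close> is written as an average over one point, to fit
    \<open>convex_combination_diff\<close>.\<close>
  have "\<bar>(\<Sum>p\<in>dyadic_grid n. hat_weight n p z * X (dyadic_pt n p) \<omega>) - (\<Sum>q\<in>{()}. 1 * X z \<omega>)\<bar>
    \<le> r + (\<Sum>p\<in>{p\<in>dyadic_grid n. sup_dist (dyadic_pt n p) z \<le> 1 / 2^n}. \<bar>X (dyadic_pt n p) \<omega> - X z \<omega>\<bar>^12) / r^11"
  proof (rule convex_combination_diff)
    fix p assume p: "p \<in> dyadic_grid n" and nz: "hat_weight n p z \<noteq> 0"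
    have "\<bar>X (dyadic_pt n p) \<omega> - X z \<omega>\<bar>^12 \<le> (\<Sum>p\<in>{p\<in>dyadic_grid n. sup_dist (dyadic_pt n p) z \<le> 1 / 2^n}. \<bar>X (dyadic_pt n p) \<omega> - X z \<omega>\<bar>^12)"
      using p hat_weight_near[OF nz] by (intro member_le_sum) (auto simp: finite_dyadic_grid)
    then show "\<bar>X (dyadic_pt n p) \<omega> - X z \<omega>\<bar> \<le> r + (\<Sum>p\<in>{p\<in>dyadic_grid n. sup_dist (dyadic_pt n p) z \<le> 1 / 2^n}. \<bar>X (dyadic_pt n p) \<omega> - X z \<omega>\<bar>^12) / r^11"
      using le_add_power_ratio[of "\<bar>X (dyadic_pt n p) \<omega> - X z \<omega>\<bar>" r] assms(2)
      by (smt (verit, best) abs_ge_zero divide_right_mono zero_le_power)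
  qed (use assms in \<open>auto simp: finite_dyadic_grid hat_weight_nonneg hat_weight_sum\<close>)
  then show ?thesis by (simp add: dyadic_interp_def)
qed

lemma nn_integral_sum_moment_bound:
  fixes f :: "'i \<Rightarrow> 'a \<Rightarrow> real"
  assumes [measurable]: "\<And>i. i \<in> I \<Longrightarrow> f i \<in> borel_measurable M" and "finite I" "\<And>i \<omega>. 0 \<le> f i \<omega>"
    and b: "\<And>i. i \<in> I \<Longrightarrow> (\<integral>\<^sup>+\<omega>. ennreal (f i \<omega>) \<partial>M) \<le> ennreal b" and "0 \<le> b" "real (card I) \<le> k" "0 < r"
  shows "(\<integral>\<^sup>+\<omega>. ennreal ((\<Sum>i\<in>I. f i \<omega>) / r) \<partial>M) \<le> ennreal (k * b / r)"
proof -
  have "(\<integral>\<^sup>+\<omega>. ennreal ((\<Sum>i\<in>I. f i \<omega>) / r) \<partial>M) = (\<integral>\<^sup>+\<omega>. ennreal (1/r) * (\<Sum>i\<in>I. ennreal (f i \<omega>)) \<partial>M)"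
    using assms by (intro nn_integral_cong) (simp add: sum_ennreal ennreal_mult'[symmetric])
  also have "\<dots> = ennreal (1/r) * (\<Sum>i\<in>I. \<integral>\<^sup>+\<omega>. ennreal (f i \<omega>) \<partial>M)"
    by (subst nn_integral_cmult) (auto simp: nn_integral_sum)
  also have "\<dots> \<le> ennreal (1/r) * (\<Sum>i\<in>I. ennreal b)" by (intro mult_left_mono sum_mono b) auto
  also have "\<dots> = ennreal (card I * b / r)" using assms
    by (simp add: ennreal_of_nat_eq_real_of_nat ennreal_mult'[symmetric] mult.commute)
  also have "\<dots> \<le> ennreal (k * b / r)" using assms
    by (intro ennreal_leI divide_right_mono mult_right_mono) auto
  finally show ?thesis .
qed

text \<open>The factor \<open>16^n\<close> cancels against \<open>(2^n)^6 = 4^n * 16^n\<close>. What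
  remains is \<open>4^n\<close> in the denominator, which has to beat the loss
  \<open>r^(11 n)\<close> caused by \<open>le_add_power_ratio\<close>.\<close>

lemma moment_sum_ratio:
  fixes r k C c :: real
  assumes "r > 0"
  shows "(k * 16^n) * (C * (c / 2^n)^6) / (r^n)^11 = k * C * c^6 * (1 / (4 * r^11))^n"
proof -
  have 1: "((2::real)^n)^6 = 4^n * 16^n"
    by (simp add: power_mult[symmetric] mult.commute[of n] power_mult_distrib[symmetric]) (simp add: power_mult)
  have 2: "(r^n)^11 = (r^11)^n" by (simp add: power_mult[symmetric] mult.commute)
  show ?thesis unfolding 2 power_divide 1 power_mult_distrib using assms by (simp add: field_simps)
qed

context prob_space
begin

text \<open>The exponent 6 is what Gaussian increments deliver when their variance is of the order
  of the distance. The interpolations then converge uniformly off a null set.\<close>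

theorem Kolmogorov_continuity_unit_square:
  fixes X :: "real \<times> real \<Rightarrow> 'a \<Rightarrow> real"
  assumes Xm [measurable]: "\<And>z. z \<in> {0..1} \<times> {0..1} \<Longrightarrow> X z \<in> borel_measurable M"
    and mom: "\<And>z z'. z \<in> {0..1} \<times> {0..1} \<Longrightarrow> z' \<in> {0..1} \<times> {0..1} \<Longrightarrow>
      (\<integral>\<^sup>+\<omega>. ennreal (\<bar>X z \<omega> - X z' \<omega>\<bar>^12) \<partial>M) \<le> ennreal (C * sup_dist z z' ^ 6)"
    and C: "0 \<le> C"
  obtains g where "\<And>\<omega>. continuous_on ({0..1} \<times> {0..1}) (g \<omega>)"
    "\<And>z. z \<in> {0..1} \<times> {0..1} \<Longrightarrow> (\<lambda>\<omega>. g \<omega> z) \<in> borel_measurable M"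
    "\<And>z. z \<in> {0..1} \<times> {0..1} \<Longrightarrow> AE \<omega> in M. g \<omega> z = X z \<omega>"
proof -
  let ?Q = "{0..1::real} \<times> {0..1::real}"
  \<comment> \<open>The base must be below 1 for \<open>?r\<close> to be summable, yet so close to 1
    that \<open>q\<close>, which is \<open>(10/9)^11 / 4\<close> or about 0.8, stays below
    1.\<close>
  let ?r = "\<lambda>n. (9/10::real)^n"
  define q where "q = 1 / (4 * (9/10::real)^11)"
  have q: "0 \<le> q" "q < 1" by (auto simp: q_def field_simps power_divide eval_nat_numeral)
  define Y where "Y = dyadic_interp X"
  have Ym [measurable]: "(\<lambda>\<omega>. Y n \<omega> z) \<in> borel_measurable M" for n z
    unfolding Y_def dyadic_interp_def by (intro borel_measurable_sum borel_measurable_times borel_measurable_const Xm dyadic_pt_in)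
  define Z where "Z n \<omega> = (\<Sum>(p,q)\<in>near_pairs n. \<bar>X (dyadic_pt (Suc n) p) \<omega> - X (dyadic_pt n q) \<omega>\<bar>^12) / ?r n ^ 11" for n \<omega>
  have Xpair: "(\<lambda>\<omega>. \<bar>X (dyadic_pt (Suc n) p) \<omega> - X (dyadic_pt n q) \<omega>\<bar>^12) \<in> borel_measurable M" if "(p,q) \<in> near_pairs n" for n p q
    using that dyadic_pt_in[of p "Suc n"] dyadic_pt_in[of q n]
    by (intro borel_measurable_power borel_measurable_abs borel_measurable_diff Xm) (auto simp: near_pairs_def)
  have Zm [measurable]: "Z n \<in> borel_measurable M" for n
    unfolding Z_def by (intro borel_measurable_divide borel_measurable_sum borel_measurable_const) (use Xpair in auto)
  have Z0: "0 \<le> Z n \<omega>" for n \<omega> unfolding Z_def by (intro divide_nonneg_pos sum_nonneg) auto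
  have Zb: "(\<integral>\<^sup>+\<omega>. ennreal (Z n \<omega>) \<partial>M) \<le> ennreal (4096 * C * q^n)" for n
  proof -
    have "(\<integral>\<^sup>+\<omega>. ennreal (Z n \<omega>) \<partial>M) \<le> ennreal ((64 * 16^n) * (C * (2 / 2^n)^6) / ?r n ^ 11)"
      unfolding Z_def
    proof (rule nn_integral_sum_moment_bound[OF _ finite_near_pairs _ _ _ card_near_pairs])
      fix i assume i: "i \<in> near_pairs n"
      obtain p q where pq: "i = (p,q)" by (cases i)
      have in1: "dyadic_pt (Suc n) p \<in> ?Q" "dyadic_pt n q \<in> ?Q"
         and d: "sup_dist (dyadic_pt (Suc n) p) (dyadic_pt n q) \<le> 2 / 2^n"
        using i pq dyadic_pt_in[of p "Suc n"] dyadic_pt_in[of q n] by (auto simp: near_pairs_def)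
      have "(\<integral>\<^sup>+\<omega>. ennreal (\<bar>X (dyadic_pt (Suc n) p) \<omega> - X (dyadic_pt n q) \<omega>\<bar>^12) \<partial>M) \<le> ennreal (C * sup_dist (dyadic_pt (Suc n) p) (dyadic_pt n q) ^ 6)"
        by (rule mom[OF in1])
      also have "\<dots> \<le> ennreal (C * (2 / 2^n)^6)"
        using d C by (intro ennreal_leI mult_left_mono power_mono) (auto simp: sup_dist_def)
      finally show "(\<integral>\<^sup>+\<omega>. ennreal (case i of (p, q) \<Rightarrow> \<bar>X (dyadic_pt (Suc n) p) \<omega> - X (dyadic_pt n q) \<omega>\<bar>^12) \<partial>M) \<le> ennreal (C * (2 / 2^n)^6)"
        by (simp add: pq)
    qed (use C Xpair in auto)
    also have "(64 * 16^n) * (C * (2 / 2^n)^6) / ?r n ^ 11 = 4096 * C * q^n"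
      by (subst moment_sum_ratio) (auto simp: q_def)
    finally show ?thesis .
  qed
  define G where "G = {\<omega>\<in>space M. summable (\<lambda>n. Z n \<omega>)}"
  \<comment> \<open>Written with a series of extended nonnegative numbers, the event of convergence
    is visibly measurable.\<close>
  have "G = {\<omega>\<in>space M. (\<Sum>n. ennreal (Z n \<omega>)) \<noteq> \<top>}"
    unfolding G_def by (auto simp: suminf_ennreal2 Z0 intro: summable_suminf_not_top)
  then have Gm [measurable]: "G \<in> sets M" by simp
  have AEG: "AE \<omega> in M. \<omega> \<in> G"
    using AE_summable_of_geometric[OF Zm Z0 Zb q] C AE_space unfolding G_def by (auto elim: eventually_mono)
  \<comment> \<open>A telescoping series. The value 0 off \<open>G\<close> makes every path
    continuous, not only almost every one.\<close>
  define g where "g \<omega> z = (if \<omega> \<in> G then Y 0 \<omega> z + (\<Sum>n. Y (Suc n) \<omega> z - Y n \<omega> z) else 0)" for \<omega> z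
  have ul: "uniform_limit ?Q (\<lambda>n. Y n \<omega>) (g \<omega>) sequentially" if w: "\<omega> \<in> G" for \<omega>
  proof -
    have "uniform_limit ?Q (\<lambda>n z. \<Sum>i<n. Y (Suc i) \<omega> z - Y i \<omega> z) (\<lambda>z. \<Sum>i. Y (Suc i) \<omega> z - Y i \<omega> z) sequentially"
    proof (rule Weierstrass_m_test)
      show "norm (Y (Suc n) \<omega> z - Y n \<omega> z) \<le> ?r n + Z n \<omega>" if "z \<in> ?Q" for n z
        using dyadic_interp_increment[OF that, of "?r n" X n \<omega>] by (simp add: Y_def Z_def)
      show "summable (\<lambda>n. ?r n + Z n \<omega>)" using w by (intro summable_add summable_geometric) (auto simp: G_def)
    qed
    then have "uniform_limit ?Q (\<lambda>n z. Y 0 \<omega> z + (\<Sum>i<n. Y (Suc i) \<omega> z - Y i \<omega> z)) (\<lambda>z. Y 0 \<omega> z + (\<Sum>i. Y (Suc i) \<omega> z - Y i \<omega> z)) sequentially"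
      by (intro uniform_limit_intros)
    moreover have "g \<omega> = (\<lambda>z. Y 0 \<omega> z + (\<Sum>i. Y (Suc i) \<omega> z - Y i \<omega> z))" using w by (auto simp: g_def)
    moreover have "Y 0 \<omega> z + (\<Sum>i<n. Y (Suc i) \<omega> z - Y i \<omega> z) = Y n \<omega> z" for n z
      using sum_lessThan_telescope[of "\<lambda>n. Y n \<omega> z" n] by simp
    ultimately show ?thesis by simp
  qed
  show ?thesis
  proof
    show "continuous_on ?Q (g \<omega>)" for \<omega>
    proof (cases "\<omega> \<in> G")
      case True
      show ?thesis by (rule uniform_limit_theorem[OF _ ul[OF True]]) (auto simp: Y_def continuous_dyadic_interp)
    next
      case False then show ?thesis by (simp add: g_def)
    qed
  next
    show "(\<lambda>\<omega>. g \<omega> z) \<in> borel_measurable M" for z unfolding g_def by measurable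
  next
    fix z assume z: "z \<in> ?Q"
    \<comment> \<open>The same moment estimate at a fixed \<open>z\<close> identifies the limit with
      \<open>X z\<close> almost surely.\<close>
    define I where "I n = {p\<in>dyadic_grid n. sup_dist (dyadic_pt n p) z \<le> 1 / 2^n}" for n
    define Z' where "Z' n \<omega> = (\<Sum>p\<in>I n. \<bar>X (dyadic_pt n p) \<omega> - X z \<omega>\<bar>^12) / ?r n ^ 11" for n \<omega>
    have Xp: "(\<lambda>\<omega>. \<bar>X (dyadic_pt n p) \<omega> - X z \<omega>\<bar>^12) \<in> borel_measurable M" if "p \<in> I n" for n p
      using that dyadic_pt_in[of p n] z
      by (intro borel_measurable_power borel_measurable_abs borel_measurable_diff Xm) (auto simp: I_def)
    have Z'm [measurable]: "Z' n \<in> borel_measurable M" for n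
      unfolding Z'_def by (intro borel_measurable_divide borel_measurable_sum borel_measurable_const) (use Xp in auto)
    have Z'0: "0 \<le> Z' n \<omega>" for n \<omega> unfolding Z'_def by (intro divide_nonneg_pos sum_nonneg) auto
    have card: "card (I n) \<le> card (dyadic_grid n)" for n by (intro card_mono finite_dyadic_grid) (auto simp: I_def)
    \<comment> \<open>The bound is weakened from \<open>4^n\<close> to \<open>16^n\<close> so that
      \<open>moment_sum_ratio\<close> can be used again.\<close>
    then have cI: "real (card (I n)) \<le> 4 * 16^n" for n
    proof -
      have "real (card (I n)) \<le> real (card (dyadic_grid n))" using card of_nat_le_iff by blast
      also have "\<dots> \<le> 4 * 4^n" by (rule card_dyadic_grid)
      also have "\<dots> \<le> 4 * 16^n" by (intro mult_left_mono power_mono) auto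
      finally show ?thesis .
    qed
    have Z'b: "(\<integral>\<^sup>+\<omega>. ennreal (Z' n \<omega>) \<partial>M) \<le> ennreal (4 * C * q^n)" for n
    proof -
      have "(\<integral>\<^sup>+\<omega>. ennreal (Z' n \<omega>) \<partial>M) \<le> ennreal ((4 * 16^n) * (C * (1 / 2^n)^6) / ?r n ^ 11)"
        unfolding Z'_def
      proof (rule nn_integral_sum_moment_bound[OF _ _ _ _ _ cI])
        fix p assume i: "p \<in> I n"
        have in1: "dyadic_pt n p \<in> ?Q"
           and d: "sup_dist (dyadic_pt n p) z \<le> 1 / 2^n"
          using i dyadic_pt_in[of p n] by (auto simp: I_def)
        have "(\<integral>\<^sup>+\<omega>. ennreal (\<bar>X (dyadic_pt n p) \<omega> - X z \<omega>\<bar>^12) \<partial>M) \<le> ennreal (C * sup_dist (dyadic_pt n p) z ^ 6)"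
          by (rule mom[OF in1 z])
        also have "\<dots> \<le> ennreal (C * (1 / 2^n)^6)"
          using d C by (intro ennreal_leI mult_left_mono power_mono) (auto simp: sup_dist_def)
        finally show "(\<integral>\<^sup>+\<omega>. ennreal (\<bar>X (dyadic_pt n p) \<omega> - X z \<omega>\<bar>^12) \<partial>M) \<le> ennreal (C * (1 / 2^n)^6)" .
      qed (use C Xp in \<open>auto simp: I_def finite_dyadic_grid\<close>)
      also have "(4 * 16^n) * (C * (1 / 2^n)^6) / ?r n ^ 11 = 4 * C * q^n"
        by (subst moment_sum_ratio) (auto simp: q_def)
      finally show ?thesis .
    qed
    have "AE \<omega> in M. summable (\<lambda>n. Z' n \<omega>)"
      using AE_summable_of_geometric[OF Z'm Z'0 Z'b q] C by simp
    then show "AE \<omega> in M. g \<omega> z = X z \<omega>"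
      using AEG
    proof eventually_elim
      case (elim \<omega>)
      have "(\<lambda>n. Y n \<omega> z) \<longlonglongrightarrow> g \<omega> z" using tendsto_uniform_limitI[OF ul[OF elim(2)] z] .
      moreover have "(\<lambda>n. Y n \<omega> z) \<longlonglongrightarrow> X z \<omega>"
      proof -
        have "(\<lambda>n. ?r n) \<longlonglongrightarrow> 0" by (rule LIMSEQ_power_zero) simp
        from tendsto_add[OF this summable_LIMSEQ_zero[OF elim(1)]]
        have lim: "(\<lambda>n. ?r n + Z' n \<omega>) \<longlonglongrightarrow> 0" by simp
        have "\<bar>Y n \<omega> z - X z \<omega>\<bar> \<le> ?r n + Z' n \<omega>" for n
          using dyadic_interp_error[OF z, of "?r n" X n \<omega>] by (simp add: Y_def Z'_def I_def)
        then have "\<forall>\<^sub>F n in sequentially. norm (Y n \<omega> z - X z \<omega>) \<le> ?r n + Z' n \<omega>" by (intro always_eventually allI) (simp only: real_norm_def)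
        from Lim_null_comparison[OF this lim] have "(\<lambda>n. Y n \<omega> z - X z \<omega>) \<longlonglongrightarrow> 0" .
        then show ?thesis by (simp add: LIM_zero_iff)
      qed
      ultimately show ?case by (rule LIMSEQ_unique)
    qed
  qed
qed

section \<open>Centered Gaussian variables\<close>

lemma centered_gaussian_distr:
  assumes g: "gaussian_rv M Y" and i: "integrable M Y" "expectation Y = 0"
    and v: "expectation (\<lambda>\<omega>. (Y \<omega>)\<^sup>2) = v"
  shows "(v = 0 \<and> (AE \<omega> in M. Y \<omega> = 0)) \<or> (v > 0 \<and> distributed M lborel Y (normal_density 0 (sqrt v)))"
  using g unfolding gaussian_rv_def
proof (elim conjE disjE exE)
  fix \<mu> assume Y [measurable]: "Y \<in> borel_measurable M" and ae: "AE \<omega> in M. Y \<omega> = \<mu>"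
  have "expectation Y = expectation (\<lambda>_. \<mu>)" using ae by (intro integral_cong_AE) auto
  then have "\<mu> = 0" using i by (simp add: prob_space)
  moreover have "expectation (\<lambda>\<omega>. (Y \<omega>)\<^sup>2) = expectation (\<lambda>_. \<mu>\<^sup>2)" using ae by (intro integral_cong_AE) auto
  ultimately show ?thesis using ae v by (simp add: prob_space)
next
  fix \<mu> \<sigma> :: real assume s: "0 < \<sigma>" and D: "distributed M lborel Y (normal_density \<mu> \<sigma>)"
  have "\<mu> = 0" using normal_distributed_expectation[OF s D] i by simp
  moreover have "v = \<sigma>\<^sup>2" using normal_distributed_variance[OF s D] v i by simp
  ultimately show ?thesis using s D by simp
qed

text \<open>The constant is the double factorial \<open>1 * 3 * 5 * 7 * 9 * 11\<close>. In the
  degenerate case both sides are 0.\<close>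

lemma centered_gaussian_moment_12:
  assumes "gaussian_rv M Y" "integrable M Y" "expectation Y = 0" "expectation (\<lambda>\<omega>. (Y \<omega>)\<^sup>2) = v"
  shows "(\<integral>\<^sup>+\<omega>. ennreal (\<bar>Y \<omega>\<bar>^12) \<partial>M) = ennreal (10395 * v^6)"
  using centered_gaussian_distr[OF assms]
proof (elim disjE conjE)
  assume "v = 0" "AE \<omega> in M. Y \<omega> = 0"
  then have "(\<integral>\<^sup>+\<omega>. ennreal (\<bar>Y \<omega>\<bar>^12) \<partial>M) = (\<integral>\<^sup>+\<omega>. 0 \<partial>M)" by (intro nn_integral_cong_AE) auto
  then show ?thesis using \<open>v = 0\<close> by simp
next
  assume v: "v > 0" and D: "distributed M lborel Y (normal_density 0 (sqrt v))"
  have "0 < sqrt v" using v by simp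
  note m = normal_moment_even[OF this, of 0 6]
  have "(\<integral>\<^sup>+\<omega>. ennreal (\<bar>Y \<omega>\<bar>^12) \<partial>M) = (\<integral>\<^sup>+x. ennreal (normal_density 0 (sqrt v) x) * ennreal (\<bar>x\<bar>^12) \<partial>lborel)"
    by (rule distributed_nn_integral[OF D, symmetric]) auto
  also have "\<dots> = (\<integral>\<^sup>+x. ennreal (normal_density 0 (sqrt v) x * (x - 0)^(2 * 6)) \<partial>lborel)"
    by (intro nn_integral_cong) (simp add: ennreal_mult power_even_abs)
  also have "\<dots> = ennreal (fact (2 * 6) / ((2 / (sqrt v)\<^sup>2)^6 * fact 6))"
    using m by (subst nn_integral_eq_integral) (auto simp: has_bochner_integral_iff)
  also have "(fact (2 * 6) / ((2 / (sqrt v)\<^sup>2)^6 * fact 6) :: real) = 10395 * v^6"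
    using v by (simp add: fact_numeral power_divide)
  finally show ?thesis .
qed

text \<open>A centered Gaussian law is determined by its variance, so invariance under reflection
  reduces to the comparison of two variances.\<close>

lemma centered_gaussian_char_cong:
  assumes "gaussian_rv M Y" "integrable M Y" "expectation Y = 0"
    and "gaussian_rv M Y'" "integrable M Y'" "expectation Y' = 0"
    and "expectation (\<lambda>\<omega>. (Y \<omega>)\<^sup>2) = expectation (\<lambda>\<omega>. (Y' \<omega>)\<^sup>2)"
  shows "(CLINT \<omega>|M. iexp (Y \<omega>)) = (CLINT \<omega>|M. iexp (Y' \<omega>))"
proof -
  have [measurable]: "Y \<in> borel_measurable M" "Y' \<in> borel_measurable M" using assms by (auto simp: gaussian_rv_def)
  have "distr M lborel Y = distr M lborel Y'"
  proof (cases "expectation (\<lambda>\<omega>. (Y \<omega>)\<^sup>2) = 0")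
    case True
    then have "AE \<omega> in M. Y \<omega> = 0" "AE \<omega> in M. Y' \<omega> = 0"
      using centered_gaussian_distr[OF assms(1-3) refl] centered_gaussian_distr[OF assms(4-6) refl] assms(7) by auto
    then show ?thesis by (intro distr_cong_AE) auto
  next
    case False
    then show ?thesis
      using centered_gaussian_distr[OF assms(1-3) refl] centered_gaussian_distr[OF assms(4-6) refl] assms(7)
      by (auto simp: distributed_def)
  qed
  then have "(CLINT x|distr M lborel Y. iexp x) = (CLINT x|distr M lborel Y'. iexp x)" by simp
  then show ?thesis by (subst (asm) (1 2) integral_distr) auto
qed

end

section \<open>Regularity of the moment functions\<close>

text \<open>Two rounds of \<open>2 * \<bar>x * y\<bar> \<le> x\<^sup>2 + y\<^sup>2\<close>. This
  serves as Hoelder's inequality for four factors.\<close>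

lemma abs_prod4_le:
  fixes a b c d :: real
  shows "\<bar>a * b * c * d\<bar> \<le> (a^4 + b^4 + c^4 + d^4) / 4"
proof -
  have am: "\<bar>x * y\<bar> \<le> (x\<^sup>2 + y\<^sup>2) / 2" for x y :: real
    using zero_le_power2[of "\<bar>x\<bar> - \<bar>y\<bar>"] by (simp add: power2_diff abs_mult)
  have "\<bar>a * b * c * d\<bar> \<le> ((a * b)\<^sup>2 + (c * d)\<^sup>2) / 2" using am[of "a*b" "c*d"] by (simp add: mult.assoc)
  also have "\<dots> \<le> ((a^4 + b^4) / 2 + (c^4 + d^4) / 2) / 2"
    using am[of "a\<^sup>2" "b\<^sup>2"] am[of "c\<^sup>2" "d\<^sup>2"]
    by (intro divide_right_mono add_mono) (simp_all add: power_mult_distrib)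
  also have "\<dots> = (a^4 + b^4 + c^4 + d^4) / 4" by (simp add: field_simps)
  finally show ?thesis .
qed

context
  fixes N :: "'b measure" and W A B E
  assumes mf: "moment_functions N W A B E"
begin

text \<open>The moments are the same at all times, so the process at time 0 represents them
  all.\<close>

lemma moment_facts:
  shows "prob_space N"
    and "x \<in> {0..1} \<Longrightarrow> (\<lambda>\<omega>. W \<omega> 0 x) \<in> borel_measurable N"
    and "x \<in> {0..1} \<Longrightarrow> integrable N (\<lambda>\<omega>. W \<omega> 0 x ^ 8)"
    and "x1 \<in> {0..1} \<Longrightarrow> x2 \<in> {0..1} \<Longrightarrow> x3 \<in> {0..1} \<Longrightarrow> x4 \<in> {0..1} \<Longrightarrow>
       (LINT \<omega>|N. W \<omega> 0 x1 * W \<omega> 0 x2 * W \<omega> 0 x3 * W \<omega> 0 x4) = B x1 x2 x3 x4"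
  using mf unfolding moment_functions_def by auto

lemma moment_integrable4:
  assumes "x1 \<in> {0..1}" "x2 \<in> {0..1}" "x3 \<in> {0..1}" "x4 \<in> {0..1}"
  shows "integrable N (\<lambda>\<omega>. W \<omega> 0 x1 * W \<omega> 0 x2 * W \<omega> 0 x3 * W \<omega> 0 x4)"
proof -
  interpret N: prob_space N by (rule moment_facts)
  note [measurable] = moment_facts(2)
  have p: "y^4 \<le> 1 + y^8" for y :: real
  proof -
    have "0 \<le> (y^4 - 1)\<^sup>2 + y^8 + 1" by (intro add_nonneg_nonneg) auto
    then show ?thesis by (simp add: power2_diff)
  qed
  have "\<bar>a * b * c * d\<bar> \<le> (1 + a^8) + (1 + b^8) + (1 + c^8) + (1 + d^8)" for a b c d :: real
  proof -
    note abs_prod4_le[of a b c d]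
    also have "(a^4 + b^4 + c^4 + d^4) / 4 \<le> ((1 + a^8) + (1 + b^8) + (1 + c^8) + (1 + d^8)) / 4"
      by (intro divide_right_mono add_mono p) auto
    also have "\<dots> \<le> (1 + a^8) + (1 + b^8) + (1 + c^8) + (1 + d^8)"
    proof -
      have "0 \<le> (1 + a^8) + (1 + b^8) + (1 + c^8) + (1 + d^8)" by (intro add_nonneg_nonneg) auto
      then show ?thesis by simp
    qed
    finally show ?thesis .
  qed
  note bd = order_trans[OF this abs_ge_self]
  show ?thesis
  proof (rule Bochner_Integration.integrable_bound)
    show "integrable N (\<lambda>\<omega>. (1 + W \<omega> 0 x1 ^ 8) + (1 + W \<omega> 0 x2 ^ 8) + (1 + W \<omega> 0 x3 ^ 8) + (1 + W \<omega> 0 x4 ^ 8))"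
      using assms moment_facts(3) by (intro Bochner_Integration.integrable_add) auto
    show "(\<lambda>\<omega>. W \<omega> 0 x1 * W \<omega> 0 x2 * W \<omega> 0 x3 * W \<omega> 0 x4) \<in> borel_measurable N"
      using assms by (intro borel_measurable_times moment_facts(2))
  qed (unfold real_norm_def, rule AE_I2, rule bd)
qed

lemma moment_symmetric:
  assumes "x1 \<in> {0..1}" "x2 \<in> {0..1}" "x3 \<in> {0..1}" "x4 \<in> {0..1}"
  shows "B x1 x2 x3 x4 = B x2 x1 x3 x4" "B x1 x2 x3 x4 = B x3 x4 x1 x2"
  unfolding moment_facts(4)[OF assms, symmetric] moment_facts(4)[OF assms(2,1,3,4), symmetric]
    moment_facts(4)[OF assms(3,4,1,2), symmetric]
  by (rule Bochner_Integration.integral_cong[OF refl], simp only: mult_ac)+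

text \<open>This identifies the five-term combination in the last condition of
  \<open>smooth_B\<close>: it is the expanded fourth moment of an increment of
  \<open>W\<close>.\<close>

lemma fourth_moment_increment:
  assumes "x \<in> {0..1}" "y \<in> {0..1}"
  shows "integrable N (\<lambda>\<omega>. (W \<omega> 0 x - W \<omega> 0 y)^4)"
    and "(LINT \<omega>|N. (W \<omega> 0 x - W \<omega> 0 y)^4) = B x x x x + B y y y y + 6 * B x x y y - 4 * B x x x y - 4 * B x y y y"
proof -
  have e: "(a - b)^4 = a*a*a*a + b*b*b*b + 6 * (a*a*b*b) - 4 * (a*a*a*b) - 4 * (a*b*b*b)" for a b :: real
    by (simp add: power4_eq_xxxx algebra_simps)
  note i = moment_integrable4[OF assms(1,1,1,1)] moment_integrable4[OF assms(2,2,2,2)] moment_integrable4[OF assms(1,1,2,2)]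
    moment_integrable4[OF assms(1,1,1,2)] moment_integrable4[OF assms(1,2,2,2)]
  note m = moment_facts(4)[OF assms(1,1,1,1)] moment_facts(4)[OF assms(2,2,2,2)] moment_facts(4)[OF assms(1,1,2,2)]
    moment_facts(4)[OF assms(1,1,1,2)] moment_facts(4)[OF assms(1,2,2,2)]
  show "integrable N (\<lambda>\<omega>. (W \<omega> 0 x - W \<omega> 0 y)^4)" unfolding e
    by (intro Bochner_Integration.integrable_diff Bochner_Integration.integrable_add integrable_mult_right i)
  show "(LINT \<omega>|N. (W \<omega> 0 x - W \<omega> 0 y)^4) = B x x x x + B y y y y + 6 * B x x y y - 4 * B x x x y - 4 * B x y y y"
    unfolding e m[symmetric]
    by (simp add: Bochner_Integration.integral_diff Bochner_Integration.integral_add i del: mult.assoc)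
qed

text \<open>The increment of \<open>W\<close> is divided by the distance \<open>h\<close> before
  \<open>abs_prod4_le\<close> is applied. Its fourth moment is then at most \<open>C7^4\<close>,
  each other factor contributes at most \<open>C5\<close>, and the \<open>h\<close> in front makes
  the bound linear. Without the division three of the four terms would not shrink with
  \<open>h\<close>.\<close>

lemma moment_Lipschitz1:
  assumes sB: "smooth_B B C5 C6 C7" and x: "x1 \<in> {0..1}" "x1' \<in> {0..1}" "x2 \<in> {0..1}" "x3 \<in> {0..1}" "x4 \<in> {0..1}"
  shows "\<bar>B x1 x2 x3 x4 - B x1' x2 x3 x4\<bar> \<le> (C7^4 + 3 * C5) / 4 * \<bar>x1 - x1'\<bar>"
proof (cases "x1 = x1'")
  case False
  define h where "h = \<bar>x1 - x1'\<bar>"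
  have h: "h > 0" using False by (simp add: h_def)
  have bB: "\<bar>B a b c d\<bar> \<le> C5" if "a \<in> {0..1}" "b \<in> {0..1}" "c \<in> {0..1}" "d \<in> {0..1}" for a b c d
    using sB that unfolding smooth_B_def by auto
  have m4: "(LINT \<omega>|N. (W \<omega> 0 x1 - W \<omega> 0 x1')^4) \<le> C7^4 * h^4"
    unfolding fourth_moment_increment(2)[OF x(1,2)] h_def using sB x(1,2) unfolding smooth_B_def by fastforce
  have i4: "integrable N (\<lambda>\<omega>. W \<omega> 0 y ^ 4)" "(LINT \<omega>|N. W \<omega> 0 y ^ 4) \<le> C5" if "y \<in> {0..1}" for y
    using moment_integrable4[OF that that that that] moment_facts(4)[OF that that that that] bB[OF that that that that]
    by (simp_all add: power4_eq_xxxx)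
  let ?f = "\<lambda>\<omega>. ((W \<omega> 0 x1 - W \<omega> 0 x1') / h)^4 + W \<omega> 0 x2 ^ 4 + W \<omega> 0 x3 ^ 4 + W \<omega> 0 x4 ^ 4"
  have iD: "integrable N (\<lambda>\<omega>. ((W \<omega> 0 x1 - W \<omega> 0 x1') / h)^4)"
    using fourth_moment_increment(1)[OF x(1,2)] by (simp add: power_divide)
  have "B x1 x2 x3 x4 - B x1' x2 x3 x4 = (LINT \<omega>|N. W \<omega> 0 x1 * W \<omega> 0 x2 * W \<omega> 0 x3 * W \<omega> 0 x4 - W \<omega> 0 x1' * W \<omega> 0 x2 * W \<omega> 0 x3 * W \<omega> 0 x4)"
    using x moment_integrable4 by (simp add: moment_facts(4))
  also have "\<dots> = (LINT \<omega>|N. h * (((W \<omega> 0 x1 - W \<omega> 0 x1') / h) * W \<omega> 0 x2 * W \<omega> 0 x3 * W \<omega> 0 x4))"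
  proof (rule Bochner_Integration.integral_cong[OF refl])
    have "h * (((d - d') / h) * a * b * c) = d * a * b * c - d' * a * b * c" for d d' a b c
      using h by (simp add: left_diff_distrib)
    then show "W \<omega> 0 x1 * W \<omega> 0 x2 * W \<omega> 0 x3 * W \<omega> 0 x4 - W \<omega> 0 x1' * W \<omega> 0 x2 * W \<omega> 0 x3 * W \<omega> 0 x4
      = h * (((W \<omega> 0 x1 - W \<omega> 0 x1') / h) * W \<omega> 0 x2 * W \<omega> 0 x3 * W \<omega> 0 x4)" for \<omega> by (rule sym)
  qed
  finally have "\<bar>B x1 x2 x3 x4 - B x1' x2 x3 x4\<bar> \<le> (LINT \<omega>|N. \<bar>h * (((W \<omega> 0 x1 - W \<omega> 0 x1') / h) * W \<omega> 0 x2 * W \<omega> 0 x3 * W \<omega> 0 x4)\<bar>)"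
    by (simp only: integral_abs_bound)
  also have "\<dots> \<le> (LINT \<omega>|N. h / 4 * ?f \<omega>)"
  proof (rule integral_mono')
    show "integrable N (\<lambda>\<omega>. h / 4 * ?f \<omega>)" using iD i4 x by auto
    show "\<bar>h * (((W \<omega> 0 x1 - W \<omega> 0 x1') / h) * W \<omega> 0 x2 * W \<omega> 0 x3 * W \<omega> 0 x4)\<bar> \<le> h / 4 * ?f \<omega>" for \<omega>
      unfolding abs_mult[of h] using mult_left_mono[OF abs_prod4_le[of "(W \<omega> 0 x1 - W \<omega> 0 x1') / h" "W \<omega> 0 x2" "W \<omega> 0 x3" "W \<omega> 0 x4"], of h] h
      by (simp only: abs_of_pos times_divide_eq_left times_divide_eq_right less_imp_le)
    show "0 \<le> h / 4 * ?f \<omega>" for \<omega> using h by (intro mult_nonneg_nonneg add_nonneg_nonneg) auto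
  qed
  also have "\<dots> = h / 4 * ((LINT \<omega>|N. ((W \<omega> 0 x1 - W \<omega> 0 x1') / h)^4) + (LINT \<omega>|N. W \<omega> 0 x2 ^ 4) + (LINT \<omega>|N. W \<omega> 0 x3 ^ 4) + (LINT \<omega>|N. W \<omega> 0 x4 ^ 4))"
    using iD i4 x by simp
  also have "\<dots> \<le> h / 4 * (C7^4 + C5 + C5 + C5)"
  proof -
    have "(LINT \<omega>|N. ((W \<omega> 0 x1 - W \<omega> 0 x1') / h)^4) \<le> C7^4"
      using m4 h by (simp add: power_divide field_simps)
    then show ?thesis using i4(2) x h by (intro mult_left_mono add_mono) auto
  qed
  finally show ?thesis by (simp add: h_def field_simps)
qed simp

lemma Btilde_bound:
  assumes sA: "smooth_A A C2 C3 C4" and sB: "smooth_B B C5 C6 C7"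
    and x: "x1 \<in> {0..1}" "x2 \<in> {0..1}" "x3 \<in> {0..1}" "x4 \<in> {0..1}"
  shows "\<bar>Btilde A B x1 x2 x3 x4\<bar> \<le> C5 + C2\<^sup>2"
proof -
  have a: "\<bar>A x1 x2\<bar> \<le> C2" "\<bar>A x3 x4\<bar> \<le> C2" and b: "\<bar>B x1 x2 x3 x4\<bar> \<le> C5"
    using sA sB x by (auto simp: smooth_A_def smooth_B_def)
  have "\<bar>A x1 x2 * A x3 x4\<bar> \<le> C2 * C2" unfolding abs_mult using a by (intro mult_mono) auto
  then show ?thesis using b unfolding Btilde_def by (simp add: power2_eq_square)
qed

lemma Btilde_Lipschitz1:
  assumes sA: "smooth_A A C2 C3 C4" and sB: "smooth_B B C5 C6 C7"
    and x: "x1 \<in> {0..1}" "x1' \<in> {0..1}" "x2 \<in> {0..1}" "x3 \<in> {0..1}" "x4 \<in> {0..1}"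
  shows "\<bar>Btilde A B x1 x2 x3 x4 - Btilde A B x1' x2 x3 x4\<bar> \<le> ((C7^4 + 3 * C5) / 4 + C3 * C2) * \<bar>x1 - x1'\<bar>"
proof -
  have a: "\<bar>A x1 x2 - A x1' x2\<bar> \<le> C3 * \<bar>x1 - x1'\<bar>" "\<bar>A x3 x4\<bar> \<le> C2"
    using sA x by (auto simp: smooth_A_def)
  have "\<bar>(A x1 x2 - A x1' x2) * A x3 x4\<bar> \<le> (C3 * \<bar>x1 - x1'\<bar>) * C2" unfolding abs_mult using a by (intro mult_mono) auto
  then have "\<bar>B x1 x2 x3 x4 - B x1' x2 x3 x4\<bar> + \<bar>(A x1 x2 - A x1' x2) * A x3 x4\<bar>
      \<le> (C7^4 + 3 * C5) / 4 * \<bar>x1 - x1'\<bar> + C3 * \<bar>x1 - x1'\<bar> * C2"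
    using moment_Lipschitz1[OF sB x] by (intro add_mono)
  moreover have "Btilde A B x1 x2 x3 x4 - Btilde A B x1' x2 x3 x4 = (B x1 x2 x3 x4 - B x1' x2 x3 x4) - (A x1 x2 - A x1' x2) * A x3 x4"
    unfolding Btilde_def by (simp add: algebra_simps)
  moreover have "((C7^4 + 3 * C5) / 4 + C3 * C2) * \<bar>x1 - x1'\<bar> = (C7^4 + 3 * C5) / 4 * \<bar>x1 - x1'\<bar> + C3 * \<bar>x1 - x1'\<bar> * C2"
    by (simp only: distrib_right mult.assoc mult.commute[of C2])
  ultimately show ?thesis
    using abs_triangle_ineq4[of "B x1 x2 x3 x4 - B x1' x2 x3 x4" "(A x1 x2 - A x1' x2) * A x3 x4"] by (simp only:)
qed

text \<open>The subtracted product singles out the pairs (1,2) and (3,4). The symmetries that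
  respect this pairing survive, and they suffice to move any argument into first place.\<close>

lemma Btilde_symmetric:
  assumes A: "symmetric2 A" and x: "x1 \<in> {0..1}" "x2 \<in> {0..1}" "x3 \<in> {0..1}" "x4 \<in> {0..1}"
  shows "Btilde A B x1 x2 x3 x4 = Btilde A B x2 x1 x3 x4" "Btilde A B x1 x2 x3 x4 = Btilde A B x3 x4 x1 x2"
proof -
  have "A x1 x2 = A x2 x1" using A x by (auto simp: symmetric2_def)
  then show "Btilde A B x1 x2 x3 x4 = Btilde A B x2 x1 x3 x4" "Btilde A B x1 x2 x3 x4 = Btilde A B x3 x4 x1 x2"
    using moment_symmetric[OF x] by (simp_all add: Btilde_def)
qed

text \<open>The arguments are changed one at a time; each change becomes, by symmetry, a change of
  the first argument.\<close>

lemma Btilde_continuous: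
  assumes A: "symmetric2 A" and sA: "smooth_A A C2 C3 C4" and sB: "smooth_B B C5 C6 C7"
  shows "continuous_on ({0..1} \<times> {0..1} \<times> {0..1} \<times> {0..1}) (\<lambda>(x1, x2, x3, x4). Btilde A B x1 x2 x3 x4)"
proof -
  define L where "L = \<bar>(C7^4 + 3 * C5) / 4 + C3 * C2\<bar>"
  note Lip1 = order_trans[OF Btilde_Lipschitz1[OF sA sB] mult_right_mono[OF abs_ge_self abs_ge_zero], folded L_def]
  note S = Btilde_symmetric[OF A]
  have L0: "L \<ge> 0" by (simp add: L_def)
  have "\<bar>Btilde A B x1 x2 x3 x4 - Btilde A B y1 y2 y3 y4\<bar> \<le> L * (\<bar>x1 - y1\<bar> + \<bar>x2 - y2\<bar> + \<bar>x3 - y3\<bar> + \<bar>x4 - y4\<bar>)"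
    if x: "x1 \<in> {0..1}" "x2 \<in> {0..1}" "x3 \<in> {0..1}" "x4 \<in> {0..1}"
      and y: "y1 \<in> {0..1}" "y2 \<in> {0..1}" "y3 \<in> {0..1}" "y4 \<in> {0..1}" for x1 x2 x3 x4 y1 y2 y3 y4
  proof -
    have "\<bar>Btilde A B x1 x2 x3 x4 - Btilde A B y1 x2 x3 x4\<bar> \<le> L * \<bar>x1 - y1\<bar>" by (intro Lip1 x y)
    moreover have "\<bar>Btilde A B y1 x2 x3 x4 - Btilde A B y1 y2 x3 x4\<bar> \<le> L * \<bar>x2 - y2\<bar>"
      using Lip1[of x2 y2 y1 x3 x4] S(1)[of y1 x2 x3 x4] S(1)[of y1 y2 x3 x4] x y by simp
    moreover have "\<bar>Btilde A B y1 y2 x3 x4 - Btilde A B y1 y2 y3 x4\<bar> \<le> L * \<bar>x3 - y3\<bar>"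
      using Lip1[of x3 y3 x4 y1 y2] S(2)[of y1 y2 x3 x4] S(2)[of y1 y2 y3 x4] x y by simp
    moreover have "\<bar>Btilde A B y1 y2 y3 x4 - Btilde A B y1 y2 y3 y4\<bar> \<le> L * \<bar>x4 - y4\<bar>"
      using Lip1[of x4 y4 y3 y1 y2] S(2)[of y1 y2 y3 x4] S(2)[of y1 y2 y3 y4]
        S(1)[of y3 x4 y1 y2] S(1)[of y3 y4 y1 y2] x y by simp
    ultimately show ?thesis unfolding distrib_left by linarith
  qed
  note Lip = this
  have "(4 * L)-lipschitz_on ({0..1} \<times> {0..1} \<times> {0..1} \<times> {0..1}) (\<lambda>(x1, x2, x3, x4). Btilde A B x1 x2 x3 x4)"
  proof (rule lipschitz_onI)
    fix p q :: "real \<times> real \<times> real \<times> real"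
    assume pq: "p \<in> {0..1} \<times> {0..1} \<times> {0..1} \<times> {0..1}" "q \<in> {0..1} \<times> {0..1} \<times> {0..1} \<times> {0..1}"
    obtain x1 x2 x3 x4 where p: "p = (x1,x2,x3,x4)" by (cases p)
    obtain y1 y2 y3 y4 where q: "q = (y1,y2,y3,y4)" by (cases q)
    have c1: "\<bar>x1 - y1\<bar> \<le> dist p q" using dist_fst_le[of p q] by (simp add: p q dist_real_def)
    have s1: "dist (x2,x3,x4) (y2,y3,y4) \<le> dist p q" using dist_snd_le[of p q] by (simp add: p q)
    have c2: "\<bar>x2 - y2\<bar> \<le> dist p q" using dist_fst_le[of "(x2,x3,x4)" "(y2,y3,y4)"] s1 by (simp add: dist_real_def)
    have s2: "dist (x3,x4) (y3,y4) \<le> dist p q" using dist_snd_le[of "(x2,x3,x4)" "(y2,y3,y4)"] s1 by simp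
    have c3: "\<bar>x3 - y3\<bar> \<le> dist p q" using dist_fst_le[of "(x3,x4)" "(y3,y4)"] s2 by (simp add: dist_real_def)
    have c4: "\<bar>x4 - y4\<bar> \<le> dist p q" using dist_snd_le[of "(x3,x4)" "(y3,y4)"] s2 by (simp add: dist_real_def)
    have "\<bar>Btilde A B x1 x2 x3 x4 - Btilde A B y1 y2 y3 y4\<bar> \<le> L * (\<bar>x1 - y1\<bar> + \<bar>x2 - y2\<bar> + \<bar>x3 - y3\<bar> + \<bar>x4 - y4\<bar>)"
      using pq by (intro Lip) (auto simp: p q)
    also have "\<dots> \<le> L * (4 * dist p q)" using c1 c2 c3 c4 L0 by (intro mult_left_mono) auto
    finally show "dist (case p of (x1, x2, x3, x4) \<Rightarrow> Btilde A B x1 x2 x3 x4) (case q of (x1, x2, x3, x4) \<Rightarrow> Btilde A B x1 x2 x3 x4) \<le> 4 * L * dist p q"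
      by (simp add: p q dist_real_def)
  qed (use L0 in auto)
  then show ?thesis by (rule lipschitz_on_continuous_on)
qed

end

section \<open>Integrals of continuous functions and their dependence on parameters\<close>

lemma integrable_lebesgue_on_Icc:
  fixes f :: "real \<Rightarrow> real"
  assumes "continuous_on {a..b} f"
  shows "integrable (lebesgue_on {a..b}) f"
  using assms continuous_imp_integrable_real by blast

lemma continuous_on_LINT_param:
  fixes f :: "'x::topological_space \<Rightarrow> real \<Rightarrow> real"
  assumes "continuous_on (U \<times> {a..b}) (\<lambda>(x, y). f x y)"
  shows "continuous_on U (\<lambda>x. LINT y|lebesgue_on {a..b}. f x y)"
proof -
  have c: "continuous_on {a..b} (f x)" if "x \<in> U" for x
    using continuous_on_compose2[OF assms, of "{a..b}" "\<lambda>y. (x, y)"] that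
    by (simp add: continuous_on_Pair image_subset_iff)
  have "continuous_on U (\<lambda>x. integral (cbox a b) (f x))"
    using assms by (intro integral_continuous_on_param) (simp add: cbox_interval)
  moreover have "(LINT y|lebesgue_on {a..b}. f x y) = integral (cbox a b) (f x)" if "x \<in> U" for x
    using integrable_lebesgue_on_Icc[OF c[OF that]] by (simp add: lebesgue_integral_eq_integral cbox_interval)
  ultimately show ?thesis by (simp cong: continuous_on_cong_simp)
qed

section \<open>Gaussian fields with covariance integrated in time\<close>

text \<open>From left to right this is an argument with two halves of epsilon, from right to left it
  is uniform continuity on the compact rectangle. Joint continuity is the form that is stable under
  composition.\<close>

lemma C_C_iff: "u \<in> C_C \<tau> \<longleftrightarrow> continuous_on ({0..\<tau>} \<times> {0..1}) (\<lambda>(s, x). u s x)"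
proof
  assume u: "u \<in> C_C \<tau>"
  show "continuous_on ({0..\<tau>} \<times> {0..1}) (\<lambda>(s, x). u s x)"
    unfolding continuous_on_iff
  proof (intro ballI allI impI)
    fix p :: "real \<times> real" and e :: real assume p: "p \<in> {0..\<tau>} \<times> {0..1}" and e: "0 < e"
    obtain s x where px: "p = (s, x)" by (cases p)
    have s: "s \<in> {0..\<tau>}" and x: "x \<in> {0..1}" using p px by auto
    have "uniform_limit {0..1} u (u s) (at s within {0..\<tau>})" using u s by (simp add: C_C_def)
    from uniform_limitD[OF this, of "e/2"] e
    obtain d1 where d1: "d1 > 0" "\<And>r y. r \<in> {0..\<tau>} \<Longrightarrow> r \<noteq> s \<Longrightarrow> dist r s < d1 \<Longrightarrow> y \<in> {0..1} \<Longrightarrow> dist (u r y) (u s y) < e/2"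
      by (auto simp: eventually_at)
    have "continuous_on {0..1} (u s)" using u s by (simp add: C_C_def)
    then obtain d2 where d2: "d2 > 0" "\<And>y. y \<in> {0..1} \<Longrightarrow> dist y x < d2 \<Longrightarrow> dist (u s y) (u s x) < e/2"
      using x e unfolding continuous_on_iff by (metis half_gt_zero)
    show "\<exists>d>0. \<forall>q\<in>{0..\<tau>} \<times> {0..1}. dist q p < d \<longrightarrow> dist (case q of (s, x) \<Rightarrow> u s x) (case p of (s, x) \<Rightarrow> u s x) < e"
    proof (intro exI[of _ "min d1 d2"] conjI ballI impI)
      fix q assume q: "q \<in> {0..\<tau>} \<times> {0..1::real}" and d: "dist q p < min d1 d2"
      obtain r y where qr: "q = (r, y)" by (cases q)
      have "dist r s < d1" "dist y x < d2" using d dist_fst_le[of q p] dist_snd_le[of q p] by (auto simp: qr px)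
      then have "dist (u r y) (u s y) < e/2" "dist (u s y) (u s x) < e/2"
        using d1(2)[of r y] d2(2)[of y] q qr e by (cases "r = s"; auto)+
      then show "dist (case q of (s, x) \<Rightarrow> u s x) (case p of (s, x) \<Rightarrow> u s x) < e"
        using dist_triangle[of "u r y" "u s x" "u s y"] unfolding qr px prod.case by linarith
    qed (use d1 d2 in auto)
  qed
next
  assume c: "continuous_on ({0..\<tau>} \<times> {0..1}) (\<lambda>(s, x). u s x)"
  have uc: "uniformly_continuous_on ({0..\<tau>} \<times> {0..1}) (\<lambda>(s, x). u s x)"
    using c by (rule compact_uniformly_continuous) (intro compact_Times compact_Icc)
  have "continuous_on {0..1} (u s)" if "s \<in> {0..\<tau>}" for s
    using continuous_on_compose2[OF c, of "{0..1}" "\<lambda>y. (s, y)"] that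
    by (simp add: continuous_on_Pair image_subset_iff)
  moreover have "uniform_limit {0..1} u (u s) (at s within {0..\<tau>})" if s: "s \<in> {0..\<tau>}" for s
  proof (rule uniform_limitI)
    fix e :: real assume "0 < e"
    then obtain d where d: "d > 0" "\<And>p q. p \<in> {0..\<tau>} \<times> {0..1} \<Longrightarrow> q \<in> {0..\<tau>} \<times> {0..1} \<Longrightarrow> dist q p < d \<Longrightarrow>
      dist (case q of (s, x) \<Rightarrow> u s x) (case p of (s, x) \<Rightarrow> u s x) < e"
      using uc unfolding uniformly_continuous_on_def by meson
    show "\<forall>\<^sub>F r in at s within {0..\<tau>}. \<forall>y\<in>{0..1}. dist (u r y) (u s y) < e"
      unfolding eventually_at
    proof (intro exI[of _ d] conjI ballI impI)
      fix r y assume "r \<in> {0..\<tau>}" "r \<noteq> s \<and> dist r s < d" "y \<in> {0..1::real}"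
      then show "dist (u r y) (u s y) < e" using d(2)[of "(s,y)" "(r,y)"] s by (simp add: dist_Pair_Pair)
    qed (rule d)
  qed
  ultimately show "u \<in> C_C \<tau>" by (simp add: C_C_def)
qed

lemma LINT_Icc_split:
  fixes f :: "real \<Rightarrow> real"
  assumes "a \<le> c" "c \<le> b" "continuous_on {a..b} f"
  shows "(LINT r|lebesgue_on {a..b}. f r) = (LINT r|lebesgue_on {a..c}. f r) + (LINT r|lebesgue_on {c..b}. f r)"
proof -
  have c: "continuous_on {a..c} f" "continuous_on {c..b} f"
    using assms continuous_on_subset by (metis atLeastatMost_subset_iff order_refl)+
  show ?thesis
    using integrable_lebesgue_on_Icc[OF assms(3)] integrable_lebesgue_on_Icc[OF c(1)] integrable_lebesgue_on_Icc[OF c(2)]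
      Henstock_Kurzweil_Integration.integral_combine[OF assms(1,2) integrable_continuous_interval[OF assms(3)]]
    by (simp add: lebesgue_integral_eq_integral)
qed

lemma abs_LINT_Icc_le:
  fixes f :: "real \<Rightarrow> real"
  assumes "a \<le> b" "\<And>r. r \<in> {a..b} \<Longrightarrow> \<bar>f r\<bar> \<le> K"
  shows "\<bar>LINT r|lebesgue_on {a..b}. f r\<bar> \<le> K * (b - a)"
proof -
  have K: "0 \<le> K" using assms(2)[of a] assms(1) by auto
  have "\<bar>LINT x|lebesgue_on {a..b}. f x\<bar> \<le> (LINT x|lebesgue_on {a..b}. \<bar>f x\<bar>)" by (rule integral_abs_bound)
  also have "\<dots> \<le> (LINT x|lebesgue_on {a..b}. K)"
    by (rule integral_mono') (use assms K in \<open>auto simp: integrable_lebesgue_on_Icc\<close>)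
  also have "\<dots> = K * (b - a)" using assms(1) by (simp add: measure_restrict_space)
  finally show ?thesis .
qed

text \<open>A common frame for both noises. That the covariance is an integral up to the smaller
  time encodes independent increments in time; the bounds on the kernel \<open>F\<close> control the
  regularity in space and time.\<close>

locale integrated_gaussian_field = prob_space M for M :: "'a measure" +
  fixes \<tau> :: real and \<xi> :: "'a \<Rightarrow> real \<Rightarrow> real \<Rightarrow> real" and F :: "real \<Rightarrow> real \<Rightarrow> real \<Rightarrow> real" and K L :: real
  assumes \<tau>: "0 < \<tau>"
    and gaussian: "gaussian_random_field_process M \<tau> \<xi>"
    and centered: "centered_field M \<tau> \<xi>"
    and covariance: "has_covariance M \<tau> \<xi> (\<lambda>s1 x s2 y. LINT r|lebesgue_on {0..min s1 s2}. F r x y)"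
    and F_cont: "\<And>x y. x \<in> {0..1} \<Longrightarrow> y \<in> {0..1} \<Longrightarrow> continuous_on {0..\<tau>} (\<lambda>r. F r x y)"
    and F_bound: "\<And>r x y. r \<in> {0..\<tau>} \<Longrightarrow> x \<in> {0..1} \<Longrightarrow> y \<in> {0..1} \<Longrightarrow> \<bar>F r x y\<bar> \<le> K"
    and F_Lip1: "\<And>r x x' y. r \<in> {0..\<tau>} \<Longrightarrow> x \<in> {0..1} \<Longrightarrow> x' \<in> {0..1} \<Longrightarrow> y \<in> {0..1} \<Longrightarrow> \<bar>F r x y - F r x' y\<bar> \<le> L * \<bar>x - x'\<bar>"
    and F_Lip2: "\<And>r x y y'. r \<in> {0..\<tau>} \<Longrightarrow> x \<in> {0..1} \<Longrightarrow> y \<in> {0..1} \<Longrightarrow> y' \<in> {0..1} \<Longrightarrow> \<bar>F r x y - F r x y'\<bar> \<le> L * \<bar>y - y'\<bar>"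
    and L0: "0 \<le> L"
begin

lemma K0: "0 \<le> K" using F_bound[of 0 0 0] \<tau> by auto

lemma mean_zero:
  assumes "s \<in> {0..\<tau>}" "x \<in> {0..1}"
  shows "integrable M (\<lambda>\<omega>. \<xi> \<omega> s x)" "expectation (\<lambda>\<omega>. \<xi> \<omega> s x) = 0"
  using centered assms by (auto simp: centered_field_def)

lemma field_measurable: "s \<in> {0..\<tau>} \<Longrightarrow> x \<in> {0..1} \<Longrightarrow> (\<lambda>\<omega>. \<xi> \<omega> s x) \<in> borel_measurable M"
  using mean_zero(1) by (rule borel_measurable_integrable)

lemma second_moment:
  assumes "s \<in> {0..\<tau>}" "x \<in> {0..1}" "t \<in> {0..\<tau>}" "y \<in> {0..1}"
  shows "integrable M (\<lambda>\<omega>. \<xi> \<omega> s x * \<xi> \<omega> t y)"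
    "expectation (\<lambda>\<omega>. \<xi> \<omega> s x * \<xi> \<omega> t y) = (LINT r|lebesgue_on {0..min s t}. F r x y)"
  using covariance assms by (auto simp: has_covariance_def)

lemma gaussian_combination:
  fixes s x c :: "nat \<Rightarrow> real"
  assumes s: "\<And>i. i < m \<Longrightarrow> s i \<in> {0..\<tau>}" and x: "\<And>i. i < m \<Longrightarrow> x i \<in> {0..1}"
  shows "gaussian_rv M (\<lambda>\<omega>. \<Sum>i<m. c i * \<xi> \<omega> (s i) (x i))"
    "integrable M (\<lambda>\<omega>. \<Sum>i<m. c i * \<xi> \<omega> (s i) (x i))"
    "expectation (\<lambda>\<omega>. \<Sum>i<m. c i * \<xi> \<omega> (s i) (x i)) = 0"
proof -
  \<comment> \<open>The definition of Gaussian fields sums over a set of times and all space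
    indices. Zero coefficients select the pairs \<open>(s k, x k)\<close>, and repeated times are
    allowed.\<close>
  have "gaussian_rv M (\<lambda>\<omega>. \<Sum>t\<in>s`{..<m}. \<Sum>k<m. (if t = s k then c k else 0) * \<xi> \<omega> t (x k))"
    using gaussian s x unfolding gaussian_random_field_process_def multivariate_gaussian_process_def
    by (auto simp: image_subset_iff)
  moreover have "(\<Sum>t\<in>s`{..<m}. \<Sum>k<m. (if t = s k then c k else 0) * \<xi> \<omega> t (x k)) = (\<Sum>i<m. c i * \<xi> \<omega> (s i) (x i))" for \<omega>
  proof -
    have "(\<Sum>t\<in>s`{..<m}. \<Sum>k<m. (if t = s k then c k else 0) * \<xi> \<omega> t (x k))
      = (\<Sum>k<m. \<Sum>t\<in>s`{..<m}. if t = s k then c k * \<xi> \<omega> t (x k) else 0)"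
      by (subst sum.swap) (intro sum.cong refl, auto)
    also have "\<dots> = (\<Sum>k<m. c k * \<xi> \<omega> (s k) (x k))"
      by (intro sum.cong refl) (simp add: sum.delta')
    finally show ?thesis .
  qed
  ultimately show "gaussian_rv M (\<lambda>\<omega>. \<Sum>i<m. c i * \<xi> \<omega> (s i) (x i))" by simp
  show "integrable M (\<lambda>\<omega>. \<Sum>i<m. c i * \<xi> \<omega> (s i) (x i))"
    using mean_zero(1)[OF s x] by (intro Bochner_Integration.integrable_sum integrable_mult_right) auto
  show "expectation (\<lambda>\<omega>. \<Sum>i<m. c i * \<xi> \<omega> (s i) (x i)) = 0"
    using mean_zero[OF s x] by (subst Bochner_Integration.integral_sum) (auto intro!: integrable_mult_right sum.neutral)
qed

text \<open>Up to the earlier time the variance integrates two spatial differences of the kernel;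
  after it, only the kernel at the point with the later time contributes.\<close>

lemma increment_variance:
  assumes "s \<in> {0..\<tau>}" "x \<in> {0..1}" "t \<in> {0..\<tau>}" "y \<in> {0..1}"
  shows "expectation (\<lambda>\<omega>. (\<xi> \<omega> s x - \<xi> \<omega> t y)\<^sup>2) \<le> 2 * \<tau> * L * \<bar>x - y\<bar> + K * \<bar>s - t\<bar>"
proof -
  have le: "expectation (\<lambda>\<omega>. (\<xi> \<omega> s x - \<xi> \<omega> t y)\<^sup>2) \<le> 2 * \<tau> * L * \<bar>x - y\<bar> + K * (t - s)"
    if "s \<in> {0..\<tau>}" "x \<in> {0..1}" "t \<in> {0..\<tau>}" "y \<in> {0..1}" "s \<le> t" for s x t y
  proof -
    note cc = continuous_on_subset[OF F_cont]
    have i: "integrable (lebesgue_on {a..b}) (\<lambda>r. F r x' y')" if "0 \<le> a" "b \<le> \<tau>" "x' \<in> {0..1}" "y' \<in> {0..1}" for a b x' y'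
      by (rule integrable_lebesgue_on_Icc) (use that in \<open>auto intro!: cc\<close>)
    have "expectation (\<lambda>\<omega>. (\<xi> \<omega> s x - \<xi> \<omega> t y)\<^sup>2)
      = expectation (\<lambda>\<omega>. \<xi> \<omega> s x * \<xi> \<omega> s x + \<xi> \<omega> t y * \<xi> \<omega> t y - 2 * (\<xi> \<omega> s x * \<xi> \<omega> t y))"
      by (simp add: power2_eq_square algebra_simps)
    also have "\<dots> = (LINT r|lebesgue_on {0..s}. F r x x) + (LINT r|lebesgue_on {0..t}. F r y y) - 2 * (LINT r|lebesgue_on {0..s}. F r x y)"
      using that by (simp add: second_moment min_absorb1)
    also have "(LINT r|lebesgue_on {0..t}. F r y y) = (LINT r|lebesgue_on {0..s}. F r y y) + (LINT r|lebesgue_on {s..t}. F r y y)"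
      using that by (intro LINT_Icc_split cc) auto
    also have "(LINT r|lebesgue_on {0..s}. F r x x) + ((LINT r|lebesgue_on {0..s}. F r y y) + (LINT r|lebesgue_on {s..t}. F r y y)) - 2 * (LINT r|lebesgue_on {0..s}. F r x y)
      = (LINT r|lebesgue_on {0..s}. F r x x - F r x y) + (LINT r|lebesgue_on {0..s}. F r y y - F r x y) + (LINT r|lebesgue_on {s..t}. F r y y)"
      using that by (simp add: i)
    also have "\<dots> \<le> L * \<bar>x - y\<bar> * (s - 0) + L * \<bar>x - y\<bar> * (s - 0) + K * (t - s)"
    proof (intro add_mono)
      show "(LINT r|lebesgue_on {0..s}. F r x x - F r x y) \<le> L * \<bar>x - y\<bar> * (s - 0)"
        by (rule order_trans[OF abs_ge_self abs_LINT_Icc_le]) (use that F_Lip2[of _ x x y] in auto)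
      show "(LINT r|lebesgue_on {0..s}. F r y y - F r x y) \<le> L * \<bar>x - y\<bar> * (s - 0)"
        by (rule order_trans[OF abs_ge_self abs_LINT_Icc_le]) (use that F_Lip1[of _ y x y] in \<open>auto simp: abs_minus_commute\<close>)
      show "(LINT r|lebesgue_on {s..t}. F r y y) \<le> K * (t - s)"
        by (rule order_trans[OF abs_ge_self abs_LINT_Icc_le]) (use that F_bound[of _ y y] in auto)
    qed
    also have "\<dots> = 2 * (L * \<bar>x - y\<bar>) * s + K * (t - s)" by simp
    also have "\<dots> \<le> 2 * (L * \<bar>x - y\<bar>) * \<tau> + K * (t - s)" using that L0 K0 by (intro add_mono mult_left_mono) auto
    finally show ?thesis by (simp add: algebra_simps)
  qed
  show ?thesis
  proof (cases "s \<le> t")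
    case True then show ?thesis using le[OF assms] by simp
  next
    case False
    then show ?thesis using le[OF assms(3,4,1,2)] by (simp add: power2_commute[of "\<xi> _ t y"] abs_minus_commute[of y])
  qed
qed

lemma increment_moment_12:
  assumes "s \<in> {0..\<tau>}" "x \<in> {0..1}" "t \<in> {0..\<tau>}" "y \<in> {0..1}"
  shows "(\<integral>\<^sup>+\<omega>. ennreal (\<bar>\<xi> \<omega> s x - \<xi> \<omega> t y\<bar>^12) \<partial>M) \<le> ennreal (10395 * (2 * \<tau> * L * \<bar>x - y\<bar> + K * \<bar>s - t\<bar>)^6)"
proof -
  define ss where "ss i = (if i = 0 then s else t)" for i :: nat
  define xx where "xx i = (if i = 0 then x else y)" for i :: nat
  define c where "c i = (if i = 0 then 1 else -1 :: real)" for i :: nat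
  have e: "(\<Sum>i<2. c i * \<xi> \<omega> (ss i) (xx i)) = \<xi> \<omega> s x - \<xi> \<omega> t y" for \<omega>
    by (simp add: ss_def xx_def c_def numeral_2_eq_2)
  have "gaussian_rv M (\<lambda>\<omega>. \<xi> \<omega> s x - \<xi> \<omega> t y)" "integrable M (\<lambda>\<omega>. \<xi> \<omega> s x - \<xi> \<omega> t y)" "expectation (\<lambda>\<omega>. \<xi> \<omega> s x - \<xi> \<omega> t y) = 0"
    using gaussian_combination[of 2 ss xx c] assms unfolding e by (auto simp: ss_def xx_def)
  from centered_gaussian_moment_12[OF this refl]
  have "(\<integral>\<^sup>+\<omega>. ennreal (\<bar>\<xi> \<omega> s x - \<xi> \<omega> t y\<bar>^12) \<partial>M) = ennreal (10395 * (expectation (\<lambda>\<omega>. (\<xi> \<omega> s x - \<xi> \<omega> t y)\<^sup>2))^6)" .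
  also have "\<dots> \<le> ennreal (10395 * (2 * \<tau> * L * \<bar>x - y\<bar> + K * \<bar>s - t\<bar>)^6)"
    using increment_variance[OF assms] by (intro ennreal_leI mult_left_mono power_mono integral_nonneg_AE) auto
  finally show ?thesis .
qed

theorem continuous_version_exists: "\<exists>g. continuous_version M \<tau> \<xi> g"
proof -
  \<comment> \<open>Time is rescaled to the unit interval; \<open>D\<close> then dominates the
    variance per unit of \<open>sup_dist\<close>.\<close>
  define X where "X z \<omega> = \<xi> \<omega> (\<tau> * fst z) (snd z)" for z \<omega>
  define D where "D = 2 * \<tau> * L + K * \<tau>"
  have D0: "0 \<le> D" using L0 K0 \<tau> by (simp add: D_def)
  have inT: "\<tau> * s \<in> {0..\<tau>}" if "s \<in> {0..1}" for s using that \<tau> by (auto simp: mult_left_le)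
  obtain g where g: "\<And>\<omega>. continuous_on ({0..1} \<times> {0..1}) (g \<omega>)"
    "\<And>z. z \<in> {0..1} \<times> {0..1} \<Longrightarrow> (\<lambda>\<omega>. g \<omega> z) \<in> borel_measurable M"
    "\<And>z. z \<in> {0..1} \<times> {0..1} \<Longrightarrow> AE \<omega> in M. g \<omega> z = X z \<omega>"
  proof (rule Kolmogorov_continuity_unit_square[of X "10395 * D^6"])
    show "X z \<in> borel_measurable M" if "z \<in> {0..1} \<times> {0..1}" for z
      unfolding X_def using that inT by (intro field_measurable) auto
    show "0 \<le> 10395 * D^6" using D0 by simp
    fix z z' :: "real \<times> real" assume z: "z \<in> {0..1} \<times> {0..1}" "z' \<in> {0..1} \<times> {0..1}"
    have "(\<integral>\<^sup>+\<omega>. ennreal (\<bar>X z \<omega> - X z' \<omega>\<bar>^12) \<partial>M) \<le> ennreal (10395 * (2 * \<tau> * L * \<bar>snd z - snd z'\<bar> + K * \<bar>\<tau> * fst z - \<tau> * fst z'\<bar>)^6)"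
      unfolding X_def using z inT by (intro increment_moment_12) auto
    also have "\<dots> \<le> ennreal (10395 * (D * sup_dist z z')^6)"
    proof (intro ennreal_leI mult_left_mono power_mono)
      have "\<bar>\<tau> * fst z - \<tau> * fst z'\<bar> = \<tau> * \<bar>fst z - fst z'\<bar>" using \<tau> by (simp add: abs_mult_pos' flip: right_diff_distrib)
      then have "2 * \<tau> * L * \<bar>snd z - snd z'\<bar> + K * \<bar>\<tau> * fst z - \<tau> * fst z'\<bar> = 2 * \<tau> * L * \<bar>snd z - snd z'\<bar> + K * \<tau> * \<bar>fst z - fst z'\<bar>" by simp
      also have "\<dots> \<le> 2 * \<tau> * L * sup_dist z z' + K * \<tau> * sup_dist z z'"
        using L0 K0 \<tau> by (intro add_mono mult_left_mono) (auto simp: sup_dist_def)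
      finally show "2 * \<tau> * L * \<bar>snd z - snd z'\<bar> + K * \<bar>\<tau> * fst z - \<tau> * fst z'\<bar> \<le> D * sup_dist z z'"
        by (simp add: D_def distrib_right)
    qed (use L0 K0 \<tau> in auto)
    finally show "(\<integral>\<^sup>+\<omega>. ennreal (\<bar>X z \<omega> - X z' \<omega>\<bar>^12) \<partial>M) \<le> ennreal (10395 * D^6 * sup_dist z z' ^ 6)"
      by (simp add: power_mult_distrib mult.assoc)
  qed blast
  have sc: "s / \<tau> \<in> {0..1}" "\<tau> * (s / \<tau>) = s" if "s \<in> {0..\<tau>}" for s using that \<tau> by auto
  have "continuous_version M \<tau> \<xi> (\<lambda>\<omega> s x. g \<omega> (s / \<tau>, x))"
    unfolding continuous_version_def
  proof (intro conjI ballI)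
    fix \<omega>
    have "continuous_on ({0..\<tau>} \<times> {0..1}) (\<lambda>p. g \<omega> (fst p / \<tau>, snd p))"
      by (rule continuous_on_compose2[OF g(1)]) (use sc \<tau> in \<open>auto intro!: continuous_intros\<close>)
    then show "(\<lambda>s x. g \<omega> (s / \<tau>, x)) \<in> C_C \<tau>" unfolding C_C_iff by (simp add: split_beta)
  next
    fix s x :: real assume "s \<in> {0..\<tau>}" "x \<in> {0..1}"
    then have z: "(s / \<tau>, x) \<in> {0..1} \<times> {0..1}" using sc by simp
    show "(\<lambda>\<omega>. g \<omega> (s / \<tau>, x)) \<in> borel_measurable M" by (rule g(2)[OF z])
    show "AE \<omega> in M. g \<omega> (s / \<tau>, x) = \<xi> \<omega> s x" using g(3)[OF z] sc \<open>s \<in> {0..\<tau>}\<close> by (simp add: X_def)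
  qed
  then show ?thesis by blast
qed

text \<open>Both exponents are centered Gaussian, so equal variances suffice. Covariances depend on
  the smaller time only, hence the end point and its reflection at time \<open>s k\<close> have the
  same covariance with the path up to \<open>s k\<close>, and the same variance.\<close>

lemma reflection_char:
  fixes s t :: "nat \<Rightarrow> real"
  assumes s: "\<And>i. i \<le> n \<Longrightarrow> s i \<in> {0..\<tau>}" and mono: "\<And>i. i \<le> k \<Longrightarrow> s i \<le> s k" and kn: "k \<le> n" "s k \<le> s n" and x: "x \<in> {0..1}"
  shows "(CLINT \<omega>|M. iexp ((\<Sum>i\<le>k. t i * \<xi> \<omega> (s i) x) + b * \<xi> \<omega> (s n) x))
    = (CLINT \<omega>|M. iexp ((\<Sum>i\<le>k. t i * \<xi> \<omega> (s i) x) + b * (2 * \<xi> \<omega> (s k) x - \<xi> \<omega> (s n) x)))"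
proof -
  define ss where "ss i = (if i \<le> k then s i else s n)" for i
  define S where "S \<omega> = (\<Sum>i\<le>k. t i * \<xi> \<omega> (s i) x)" for \<omega>
  define Z where "Z \<omega> = \<xi> \<omega> (s n) x" for \<omega>
  define Z' where "Z' \<omega> = 2 * \<xi> \<omega> (s k) x - \<xi> \<omega> (s n) x" for \<omega>
  define v where "v r = (LINT u|lebesgue_on {0..r}. F u x x)" for r
  have sm: "integrable M (\<lambda>\<omega>. \<xi> \<omega> (s i) x * \<xi> \<omega> (s j) x)"
     "expectation (\<lambda>\<omega>. \<xi> \<omega> (s i) x * \<xi> \<omega> (s j) x) = v (min (s i) (s j))" if "i \<le> n" "j \<le> n" for i j
    using second_moment[OF s[OF that(1)] x s[OF that(2)] x] by (simp_all add: v_def)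
  have iSS: "integrable M (\<lambda>\<omega>. (S \<omega>)\<^sup>2)"
    unfolding S_def power2_eq_square sum_product
    by (intro Bochner_Integration.integrable_sum)
       (use sm(1) kn in \<open>auto simp: mult.commute mult.left_commute intro!: integrable_mult_right\<close>)
  have Sj: "integrable M (\<lambda>\<omega>. S \<omega> * \<xi> \<omega> (s j) x)" "expectation (\<lambda>\<omega>. S \<omega> * \<xi> \<omega> (s j) x) = (\<Sum>i\<le>k. t i * v (min (s i) (s j)))"
    if "j \<le> n" for j
    using sm[OF _ that] kn unfolding S_def sum_distrib_right mult.assoc
    by (auto intro!: Bochner_Integration.integrable_sum integrable_mult_right simp: Bochner_Integration.integral_sum)
  have Smin: "(\<Sum>i\<le>k. t i * v (min (s i) (s n))) = (\<Sum>i\<le>k. t i * v (s i))" "(\<Sum>i\<le>k. t i * v (min (s i) (s k))) = (\<Sum>i\<le>k. t i * v (s i))"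
    using mono kn by (auto intro!: sum.cong simp: min_absorb1 order_trans[OF mono kn(2)])
  have SZ: "integrable M (\<lambda>\<omega>. S \<omega> * Z \<omega>)" "expectation (\<lambda>\<omega>. S \<omega> * Z \<omega>) = (\<Sum>i\<le>k. t i * v (s i))"
    using Sj[of n] Smin by (simp_all add: Z_def)
  have "S \<omega> * Z' \<omega> = 2 * (S \<omega> * \<xi> \<omega> (s k) x) - S \<omega> * \<xi> \<omega> (s n) x" for \<omega> by (simp add: Z'_def algebra_simps)
  then have SZ': "integrable M (\<lambda>\<omega>. S \<omega> * Z' \<omega>)" "expectation (\<lambda>\<omega>. S \<omega> * Z' \<omega>) = (\<Sum>i\<le>k. t i * v (s i))"
    using Sj[of n] Sj[of k] Smin kn by simp_all
  have ZZ: "integrable M (\<lambda>\<omega>. (Z \<omega>)\<^sup>2)" "expectation (\<lambda>\<omega>. (Z \<omega>)\<^sup>2) = v (s n)"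
    using sm[of n n] by (simp_all add: Z_def power2_eq_square)
  have "(Z' \<omega>)\<^sup>2 = 4 * (\<xi> \<omega> (s k) x * \<xi> \<omega> (s k) x) - 4 * (\<xi> \<omega> (s k) x * \<xi> \<omega> (s n) x) + \<xi> \<omega> (s n) x * \<xi> \<omega> (s n) x" for \<omega>
    by (simp add: Z'_def power2_eq_square algebra_simps)
  then have ZZ': "integrable M (\<lambda>\<omega>. (Z' \<omega>)\<^sup>2)" "expectation (\<lambda>\<omega>. (Z' \<omega>)\<^sup>2) = v (s n)"
    using sm[of k k] sm[of k n] sm[of n n] kn by (simp_all add: min_absorb1)
  have ex: "expectation (\<lambda>\<omega>. (S \<omega> + b * Y \<omega>)\<^sup>2) = expectation (\<lambda>\<omega>. (S \<omega>)\<^sup>2) + 2 * b * expectation (\<lambda>\<omega>. S \<omega> * Y \<omega>) + b\<^sup>2 * expectation (\<lambda>\<omega>. (Y \<omega>)\<^sup>2)"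
    if "integrable M (\<lambda>\<omega>. S \<omega> * Y \<omega>)" "integrable M (\<lambda>\<omega>. (Y \<omega>)\<^sup>2)" for Y
  proof -
    have "(S \<omega> + b * Y \<omega>)\<^sup>2 = (S \<omega>)\<^sup>2 + 2 * b * (S \<omega> * Y \<omega>) + b\<^sup>2 * (Y \<omega>)\<^sup>2" for \<omega>
      by (simp add: power2_eq_square algebra_simps)
    then show ?thesis using that iSS by simp
  qed
  have var: "expectation (\<lambda>\<omega>. (S \<omega> + b * Z \<omega>)\<^sup>2) = expectation (\<lambda>\<omega>. (S \<omega> + b * Z' \<omega>)\<^sup>2)"
    unfolding ex[OF SZ(1) ZZ(1)] ex[OF SZ'(1) ZZ'(1)] SZ(2) ZZ(2) SZ'(2) ZZ'(2) ..
  define c where "c i = (if i \<le> k then t i else b)" for i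
  \<comment> \<open>The reflected end point adds \<open>2 * b\<close> to the coefficient at
    \<open>k\<close> and reverses the sign of the last one.\<close>
  define c' where "c' i = (if i < k then t i else if i = k then t k + 2 * b else - b)" for i
  have comb: "(\<Sum>i<Suc (Suc k). a i * \<xi> \<omega> (ss i) x) = (\<Sum>i\<le>k. a i * \<xi> \<omega> (s i) x) + a (Suc k) * \<xi> \<omega> (s n) x" for a \<omega>
    by (simp add: ss_def lessThan_Suc_atMost[symmetric])
  have "(\<Sum>i\<le>k. c i * \<xi> \<omega> (s i) x) = S \<omega>" for \<omega> unfolding S_def by (intro sum.cong) (auto simp: c_def)
  then have c: "(\<Sum>i<Suc (Suc k). c i * \<xi> \<omega> (ss i) x) = S \<omega> + b * Z \<omega>" for \<omega>
    unfolding comb by (simp add: c_def Z_def)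
  have "(\<Sum>i\<le>k. c' i * \<xi> \<omega> (s i) x) = S \<omega> + 2 * b * \<xi> \<omega> (s k) x" for \<omega>
    unfolding S_def lessThan_Suc_atMost[symmetric] by (simp add: c'_def algebra_simps)
  then have c': "(\<Sum>i<Suc (Suc k). c' i * \<xi> \<omega> (ss i) x) = S \<omega> + b * Z' \<omega>" for \<omega>
    unfolding comb by (simp add: c'_def Z'_def algebra_simps)
  have ss: "ss i \<in> {0..\<tau>}" if "i < Suc (Suc k)" for i using s[of i] s[of n] kn by (simp add: ss_def)
  have "(CLINT \<omega>|M. iexp (S \<omega> + b * Z \<omega>)) = (CLINT \<omega>|M. iexp (S \<omega> + b * Z' \<omega>))"
    using gaussian_combination[of "Suc (Suc k)" ss "\<lambda>_. x" c] gaussian_combination[of "Suc (Suc k)" ss "\<lambda>_. x" c'] ss x var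
    unfolding c c' by (intro centered_gaussian_char_cong) auto
  then show ?thesis by (simp add: S_def Z_def Z'_def)
qed

end

section \<open>The Volterra equation in L2\<close>

lemma L2_measurable: "f \<in> L2 \<Longrightarrow> f \<in> borel_measurable (lebesgue_on {0..1})"
  by (simp add: L2_def)

lemma L2_square_integrable: "f \<in> L2 \<Longrightarrow> integrable (lebesgue_on {0..1}) (\<lambda>x. (f x)\<^sup>2)"
  by (simp add: L2_def)

lemma L2_mult_integrable:
  assumes "f \<in> L2" "g \<in> L2"
  shows "integrable (lebesgue_on {0..1}) (\<lambda>x. f x * g x)"
proof (rule Bochner_Integration.integrable_bound)
  show "integrable (lebesgue_on {0..1}) (\<lambda>x. (f x)\<^sup>2 + (g x)\<^sup>2)"
    using assms by (intro Bochner_Integration.integrable_add L2_square_integrable)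
  show "(\<lambda>x. f x * g x) \<in> borel_measurable (lebesgue_on {0..1})"
    using assms by (intro borel_measurable_times L2_measurable)
  have "\<bar>a * b\<bar> \<le> a\<^sup>2 + b\<^sup>2" for a b :: real
  proof -
    have "2 * \<bar>a * b\<bar> \<le> a\<^sup>2 + b\<^sup>2" using zero_le_power2[of "\<bar>a\<bar> - \<bar>b\<bar>"] by (simp add: power2_diff abs_mult)
    then show ?thesis by simp
  qed
  then show "AE x in lebesgue_on {0..1}. norm (f x * g x) \<le> norm ((f x)\<^sup>2 + (g x)\<^sup>2)"
    by (intro AE_I2) (simp add: order_trans[OF _ abs_ge_self])
qed

lemma L2_continuous: "continuous_on {0..1} f \<Longrightarrow> f \<in> L2"
  unfolding L2_def
  by (auto intro!: integrable_lebesgue_on_Icc continuous_intros borel_measurable_integrable[OF integrable_lebesgue_on_Icc])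

lemma L2_const: "(\<lambda>_. c) \<in> L2"
  by (rule L2_continuous) (rule continuous_on_const)

lemma L2_integrable: "f \<in> L2 \<Longrightarrow> integrable (lebesgue_on {0..1}) f"
  using L2_mult_integrable[OF _ L2_const[of 1]] by simp

lemma L2_add: "f \<in> L2 \<Longrightarrow> g \<in> L2 \<Longrightarrow> (\<lambda>x. f x + g x) \<in> L2"
  using L2_mult_integrable[of f g]
  by (auto simp: L2_def power2_sum mult.assoc intro!: Bochner_Integration.integrable_add)

lemma L2_cmult: "f \<in> L2 \<Longrightarrow> (\<lambda>x. c * f x) \<in> L2"
  by (auto simp: L2_def power_mult_distrib)

lemma L2_diff: "f \<in> L2 \<Longrightarrow> g \<in> L2 \<Longrightarrow> (\<lambda>x. f x - g x) \<in> L2"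
  using L2_add[of f "\<lambda>x. -1 * g x"] L2_cmult[of g "-1"] by simp

lemma L2_abs: "f \<in> L2 \<Longrightarrow> (\<lambda>x. \<bar>f x\<bar>) \<in> L2"
  by (auto simp: L2_def)

lemma L2_norm_nonneg: "0 \<le> L2_norm f"
  by (auto simp: L2_norm_def intro!: integral_nonneg_AE)

lemma L2_norm_square: "(L2_norm f)\<^sup>2 = (LINT x|lebesgue_on {0..1}. (f x)\<^sup>2)"
  by (simp add: L2_norm_def integral_nonneg_AE)

lemma L2_norm_cong_AE:
  assumes "f \<in> L2" "g \<in> L2" "AE x in lebesgue_on {0..1}. f x = g x"
  shows "L2_norm f = L2_norm g"
  unfolding L2_norm_def using assms
  by (intro arg_cong[where f=sqrt] integral_cong_AE borel_measurable_power L2_measurable) auto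

lemma nonneg_quadratic_discriminant:
  fixes a b c :: real
  assumes q: "\<And>t. 0 \<le> a - 2 * t * b + t\<^sup>2 * c" and c: "0 \<le> c"
  shows "b\<^sup>2 \<le> a * c"
proof (cases "c = 0")
  case True
  have "b = 0"
  proof (rule ccontr)
    assume "b \<noteq> 0"
    \<comment> \<open>At this argument the affine function would take the value -1.\<close>
    then have "2 * ((a + 1) / (2 * b)) * b = a + 1" by simp
    then show False using q[of "(a + 1) / (2 * b)"] True by simp
  qed
  then show ?thesis using True by simp
next
  case False
  have "a - 2 * (b / c) * b + (b / c)\<^sup>2 * c = a - b\<^sup>2 / c"
    using False by (simp add: power2_eq_square field_simps)
  then have "b\<^sup>2 / c \<le> a" using q[of "b / c"] by simp
  then show ?thesis using False c by (simp add: pos_divide_le_eq)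
qed

lemma L2_Cauchy_Schwarz:
  assumes f: "f \<in> L2" and g: "g \<in> L2"
  shows "\<bar>LINT x|lebesgue_on {0..1}. f x * g x\<bar> \<le> L2_norm f * L2_norm g"
proof -
  let ?a = "(L2_norm f)\<^sup>2" and ?c = "(L2_norm g)\<^sup>2" and ?b = "LINT x|lebesgue_on {0..1}. f x * g x"
  have q: "0 \<le> ?a - 2 * t * ?b + t\<^sup>2 * ?c" for t
  proof -
    have "0 \<le> (LINT x|lebesgue_on {0..1}. (f x - t * g x)\<^sup>2)" by (rule integral_nonneg_AE) simp
    also have "\<dots> = (LINT x|lebesgue_on {0..1}. (f x)\<^sup>2 - 2 * t * (f x * g x) + t\<^sup>2 * (g x)\<^sup>2)"
      by (rule Bochner_Integration.integral_cong[OF refl]) (simp add: power2_eq_square algebra_simps)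
    also have "\<dots> = ?a - 2 * t * ?b + t\<^sup>2 * ?c"
      using L2_square_integrable[OF f] L2_square_integrable[OF g] L2_mult_integrable[OF f g]
      by (simp add: L2_norm_square)
    finally show ?thesis .
  qed
  have "?b\<^sup>2 \<le> ?a * ?c"
    by (rule nonneg_quadratic_discriminant[OF q]) simp
  then have "?b\<^sup>2 \<le> (L2_norm f * L2_norm g)\<^sup>2" by (simp add: power_mult_distrib)
  then show ?thesis using L2_norm_nonneg[of f] L2_norm_nonneg[of g] by (simp add: abs_le_square_iff[symmetric])
qed

lemma L2_norm_const: "L2_norm (\<lambda>_. c) = \<bar>c\<bar>"
  by (simp add: L2_norm_def measure_restrict_space)

lemma L1_le_L2_norm:
  assumes "f \<in> L2"
  shows "(LINT x|lebesgue_on {0..1}. \<bar>f x\<bar>) \<le> L2_norm f"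
proof -
  have "L2_norm (\<lambda>x. \<bar>f x\<bar>) = L2_norm f" by (simp add: L2_norm_def)
  then show ?thesis using L2_Cauchy_Schwarz[OF L2_abs[OF assms] L2_const[of 1]] by (simp add: L2_norm_const)
qed

lemma L2_norm_triangle:
  assumes f: "f \<in> L2" and g: "g \<in> L2"
  shows "L2_norm (\<lambda>x. f x + g x) \<le> L2_norm f + L2_norm g"
proof -
  have "(L2_norm (\<lambda>x. f x + g x))\<^sup>2 = (L2_norm f)\<^sup>2 + (L2_norm g)\<^sup>2 + 2 * (LINT x|lebesgue_on {0..1}. f x * g x)"
    using L2_square_integrable[OF f] L2_square_integrable[OF g] L2_mult_integrable[OF f g]
    by (simp add: L2_norm_square power2_sum mult.assoc)
  also have "\<dots> \<le> (L2_norm f + L2_norm g)\<^sup>2"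
    using L2_Cauchy_Schwarz[OF f g] by (simp add: power2_sum)
  finally show ?thesis using L2_norm_nonneg[of f] L2_norm_nonneg[of g] by (simp add: power2_le_iff_abs_le)
qed

lemma L2_norm_le_bound:
  assumes "f \<in> L2" "AE x in lebesgue_on {0..1}. \<bar>f x\<bar> \<le> c" "0 \<le> c"
  shows "L2_norm f \<le> c"
proof -
  have "(L2_norm f)\<^sup>2 \<le> (LINT x|lebesgue_on {0..1::real}. c\<^sup>2)"
    unfolding L2_norm_square
  proof (rule integral_mono_AE)
    show "AE x in lebesgue_on {0..1}. (f x)\<^sup>2 \<le> c\<^sup>2"
      using assms(2) by eventually_elim (simp add: abs_le_square_iff[symmetric] assms(3))
  qed (use assms L2_square_integrable in \<open>auto simp: integrable_lebesgue_on_Icc\<close>)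
  also have "\<dots> = c\<^sup>2" by (simp add: measure_restrict_space)
  finally show ?thesis using assms(3) L2_norm_nonneg[of f] by (simp add: power2_le_iff_abs_le)
qed

lemma L2_norm_diff_le:
  assumes f: "f \<in> L2" and g: "g \<in> L2"
  shows "\<bar>L2_norm f - L2_norm g\<bar> \<le> L2_norm (\<lambda>x. f x - g x)"
proof -
  have "L2_norm f \<le> L2_norm (\<lambda>x. f x - g x) + L2_norm g"
    using L2_norm_triangle[OF L2_diff[OF f g] g] by simp
  moreover have "L2_norm g \<le> L2_norm (\<lambda>x. g x - f x) + L2_norm f"
    using L2_norm_triangle[OF L2_diff[OF g f] f] by simp
  moreover have "L2_norm (\<lambda>x. g x - f x) = L2_norm (\<lambda>x. f x - g x)" by (simp add: L2_norm_def power2_commute)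
  ultimately show ?thesis by linarith
qed

lemma C_L2_norm_continuous:
  assumes "u \<in> C_L2 \<tau>"
  shows "continuous_on {0..\<tau>} (\<lambda>s. L2_norm (u s))"
  unfolding continuous_on_def
proof
  fix s assume s: "s \<in> {0..\<tau>}"
  have "((\<lambda>r. L2_norm (u r) - L2_norm (u s)) \<longlongrightarrow> 0) (at s within {0..\<tau>})"
  proof (rule Lim_null_comparison)
    show "((\<lambda>r. L2_norm (\<lambda>x. u r x - u s x)) \<longlongrightarrow> 0) (at s within {0..\<tau>})" using assms s by (simp add: C_L2_def)
    have "\<forall>\<^sub>F r in at s within {0..\<tau>}. r \<in> {0..\<tau>}" by (simp add: eventually_at_filter)
    then show "\<forall>\<^sub>F r in at s within {0..\<tau>}. norm (L2_norm (u r) - L2_norm (u s)) \<le> L2_norm (\<lambda>x. u r x - u s x)"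
      by eventually_elim (use assms s in \<open>auto simp: C_L2_def intro!: L2_norm_diff_le\<close>)
  qed
  then show "((\<lambda>r. L2_norm (u r)) \<longlongrightarrow> L2_norm (u s)) (at s within {0..\<tau>})" by (simp add: LIM_zero_iff)
qed

lemma C_L2_norm_bounded:
  assumes u: "u \<in> C_L2 \<tau>"
  shows "\<exists>D. \<forall>s\<in>{0..\<tau>}. L2_norm (u s) \<le> D"
proof -
  have "bounded ((\<lambda>s. L2_norm (u s)) ` {0..\<tau>})"
    by (intro compact_imp_bounded compact_continuous_image C_L2_norm_continuous[OF u] compact_Icc)
  then show ?thesis by (auto simp: bounded_iff L2_norm_nonneg)
qed

lemma C_L2_add:
  assumes u: "u \<in> C_L2 \<tau>" and w: "w \<in> C_L2 \<tau>"
  shows "(\<lambda>s x. u s x + c * w s x) \<in> C_L2 \<tau>"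
  unfolding C_L2_def
proof (intro CollectI conjI ballI)
  show "(\<lambda>x. u s x + c * w s x) \<in> L2" if "s \<in> {0..\<tau>}" for s
    using u w that by (intro L2_add L2_cmult) (auto simp: C_L2_def)
  fix s assume s: "s \<in> {0..\<tau>}"
  show "((\<lambda>r. L2_norm (\<lambda>x. u r x + c * w r x - (u s x + c * w s x))) \<longlongrightarrow> 0) (at s within {0..\<tau>})"
  proof (rule Lim_null_comparison)
    have "((\<lambda>r. L2_norm (\<lambda>x. u r x - u s x) + \<bar>c\<bar> * L2_norm (\<lambda>x. w r x - w s x)) \<longlongrightarrow> 0 + \<bar>c\<bar> * 0) (at s within {0..\<tau>})"
      using u w s by (intro tendsto_intros) (auto simp: C_L2_def)
    then show "((\<lambda>r. L2_norm (\<lambda>x. u r x - u s x) + \<bar>c\<bar> * L2_norm (\<lambda>x. w r x - w s x)) \<longlongrightarrow> 0) (at s within {0..\<tau>})" by simp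
    have "\<forall>\<^sub>F r in at s within {0..\<tau>}. r \<in> {0..\<tau>}" by (simp add: eventually_at_filter)
    then show "\<forall>\<^sub>F r in at s within {0..\<tau>}. norm (L2_norm (\<lambda>x. u r x + c * w r x - (u s x + c * w s x))) \<le> L2_norm (\<lambda>x. u r x - u s x) + \<bar>c\<bar> * L2_norm (\<lambda>x. w r x - w s x)"
    proof eventually_elim
      case (elim r)
      have "L2_norm (\<lambda>x. u r x + c * w r x - (u s x + c * w s x)) = L2_norm (\<lambda>x. (u r x - u s x) + c * (w r x - w s x))"
        by (simp add: algebra_simps)
      also have "\<dots> \<le> L2_norm (\<lambda>x. u r x - u s x) + L2_norm (\<lambda>x. c * (w r x - w s x))"
        using u w s elim by (intro L2_norm_triangle L2_cmult L2_diff) (auto simp: C_L2_def)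
      also have "L2_norm (\<lambda>x. c * (w r x - w s x)) = \<bar>c\<bar> * L2_norm (\<lambda>x. w r x - w s x)"
        by (simp add: L2_norm_def power_mult_distrib real_sqrt_mult)
      finally show ?case using L2_norm_nonneg by simp
    qed
  qed
qed

lemma C_L2_const: "f \<in> L2 \<Longrightarrow> (\<lambda>s. f) \<in> C_L2 \<tau>"
  by (simp add: C_L2_def L2_norm_def)

text \<open>The unit interval has measure 1, so a uniform bound is a bound of the L2 norm.\<close>

lemma C_C_imp_C_L2:
  assumes u: "u \<in> C_C \<tau>"
  shows "u \<in> C_L2 \<tau>"
  unfolding C_L2_def
proof (intro CollectI conjI ballI)
  show L: "u s \<in> L2" if "s \<in> {0..\<tau>}" for s using u that by (intro L2_continuous) (auto simp: C_C_def)
  fix s assume s: "s \<in> {0..\<tau>}"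
  show "((\<lambda>r. L2_norm (\<lambda>x. u r x - u s x)) \<longlongrightarrow> 0) (at s within {0..\<tau>})"
  proof (rule tendstoI)
    fix e :: real assume e: "0 < e"
    have "uniform_limit {0..1} u (u s) (at s within {0..\<tau>})" using u s by (simp add: C_C_def)
    then have "\<forall>\<^sub>F r in at s within {0..\<tau>}. \<forall>x\<in>{0..1}. dist (u r x) (u s x) < e/2" using e by (intro uniform_limitD) auto
    moreover have "\<forall>\<^sub>F r in at s within {0..\<tau>}. r \<in> {0..\<tau>}" by (simp add: eventually_at_filter)
    ultimately show "\<forall>\<^sub>F r in at s within {0..\<tau>}. dist (L2_norm (\<lambda>x. u r x - u s x)) 0 < e"
    proof eventually_elim
      case (elim r)
      have "L2_norm (\<lambda>x. u r x - u s x) \<le> e/2"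
        using elim s e by (intro L2_norm_le_bound L2_diff L AE_I2) (auto simp: dist_real_def less_imp_le)
      then show ?case using e L2_norm_nonneg by simp
    qed
  qed
qed

section \<open>Gronwall's lemma and the drift operator\<close>

lemma Gronwall_integral:
  fixes \<phi> :: "real \<Rightarrow> real"
  assumes c: "continuous_on {0..\<tau>} \<phi>" and b: "0 \<le> b"
    and le: "\<And>s. s \<in> {0..\<tau>} \<Longrightarrow> \<phi> s \<le> a + b * (LINT r|lebesgue_on {0..s}. \<phi> r)"
    and s: "s \<in> {0..\<tau>}"
  shows "\<phi> s \<le> a * exp (b * s)"
proof -
  define G where "G s = integral {0..s} \<phi>" for s
  have LG: "(LINT r|lebesgue_on {0..s}. \<phi> r) = G s" if "s \<in> {0..\<tau>}" for s
    unfolding G_def using that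
    by (intro lebesgue_integral_eq_integral integrable_lebesgue_on_Icc continuous_on_subset[OF c]) auto
  have dG: "(G has_real_derivative \<phi> x) (at x within {0..\<tau>})" if "x \<in> {0..\<tau>}" for x
    unfolding G_def has_real_derivative_iff_has_vector_derivative using integral_has_vector_derivative[OF c that] .
  \<comment> \<open>The integrating factor \<open>exp (- b * s)\<close> makes \<open>H\<close>
    nonincreasing, with value \<open>a\<close> at 0.\<close>
  define H where "H s = exp (- b * s) * (a + b * G s)" for s
  have "H s \<le> H 0"
  proof (rule DERIV_nonpos_imp_decreasing_open[of 0 s H])
    show "0 \<le> s" using s by simp
    show "continuous_on {0..s} H"
    proof (rule continuous_on_subset)
      have "continuous_on {0..\<tau>} G" using dG by (meson DERIV_continuous continuous_on_eq_continuous_within)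
      then show "continuous_on {0..\<tau>} H" unfolding H_def by (intro continuous_intros)
    qed (use s in auto)
    fix x assume x: "0 < x" "x < s"
    have "(G has_real_derivative \<phi> x) (at x)" using dG[of x] x s by (simp add: at_within_Icc_at)
    then have "(H has_real_derivative (exp (- b * x) * (b * \<phi> x) + (exp (- b * x) * (- b)) * (a + b * G x))) (at x)"
      unfolding H_def by (auto intro!: derivative_eq_intros)
    moreover have "exp (- b * x) * (b * \<phi> x) + (exp (- b * x) * (- b)) * (a + b * G x) = - (exp (- b * x) * b * (a + b * G x - \<phi> x))"
      by (simp add: algebra_simps)
    moreover have "0 \<le> exp (- b * x) * b * (a + b * G x - \<phi> x)"
      using le[of x] LG[of x] x s b by simp
    ultimately show "\<exists>y. (H has_real_derivative y) (at x) \<and> y \<le> 0" by force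
  qed
  also have "H 0 = a" by (simp add: H_def G_def)
  finally have "exp (- b * s) * (a + b * G s) \<le> a" by (simp add: H_def)
  then have "a + b * G s \<le> a * exp (b * s)" by (simp add: exp_minus field_simps)
  then show ?thesis by (rule order_trans[OF le[OF s, unfolded LG[OF s]]])
qed

lemma LINT_power:
  fixes s :: real
  assumes "0 \<le> s"
  shows "(LINT r|lebesgue_on {0..s}. r ^ n) = s ^ Suc n / real (Suc n)"
proof -
  have "((\<lambda>r. r ^ n) has_integral s ^ Suc n / real (Suc n) - 0 ^ Suc n / real (Suc n)) {0..s}"
  proof (rule fundamental_theorem_of_calculus)
    fix x :: real
    have "((\<lambda>x. x ^ Suc n / real (Suc n)) has_real_derivative x ^ n) (at x within {0..s})"
      by (rule derivative_eq_intros refl | simp)+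
    then show "((\<lambda>x. x ^ Suc n / real (Suc n)) has_vector_derivative x ^ n) (at x within {0..s})"
      by (simp add: has_real_derivative_iff_has_vector_derivative)
  qed (rule assms)
  then have "integral {0..s} (\<lambda>r. r ^ n) = s ^ Suc n / real (Suc n)" by (simp add: integral_unique)
  then show ?thesis
    by (subst lebesgue_integral_eq_integral) (auto intro!: integrable_lebesgue_on_Icc continuous_intros)
qed

lemma kernel_bound:
  assumes k: "k \<in> L2" "\<And>y. y \<in> {0..1} \<Longrightarrow> \<bar>k y\<bar> \<le> c" and f: "f \<in> L2"
  shows "\<bar>LINT y|lebesgue_on {0..1}. k y * f y\<bar> \<le> c * L2_norm f"
proof -
  have c: "0 \<le> c" using k(2)[of 0] by auto
  have "\<bar>LINT y|lebesgue_on {0..1}. k y * f y\<bar> \<le> L2_norm k * L2_norm f" by (rule L2_Cauchy_Schwarz[OF k(1) f])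
  also have "\<dots> \<le> c * L2_norm f"
    by (intro mult_right_mono L2_norm_nonneg L2_norm_le_bound[OF k(1)] AE_I2 c) (simp add: k(2))
  finally show ?thesis .
qed

locale drift_kernel =
  fixes A :: "real \<Rightarrow> real \<Rightarrow> real" and C2 C3 \<tau> :: real
  assumes A_cont: "\<And>x. x \<in> {0..1} \<Longrightarrow> continuous_on {0..1} (A x)"
    and A_bound: "\<And>x y. x \<in> {0..1} \<Longrightarrow> y \<in> {0..1} \<Longrightarrow> \<bar>A x y\<bar> \<le> C2"
    and A_Lip: "\<And>x y z. x \<in> {0..1} \<Longrightarrow> y \<in> {0..1} \<Longrightarrow> z \<in> {0..1} \<Longrightarrow> \<bar>A x z - A y z\<bar> \<le> C3 * \<bar>x - y\<bar>"
    and \<tau>: "0 < \<tau>"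
begin

definition space_op :: "(real \<Rightarrow> real) \<Rightarrow> real \<Rightarrow> real" where
  "space_op f x = (LINT y|lebesgue_on {0..1}. A x y * f y)"

definition Volterra :: "(real \<Rightarrow> real \<Rightarrow> real) \<Rightarrow> real \<Rightarrow> real \<Rightarrow> real" where
  "Volterra u s x = (LINT r|lebesgue_on {0..s}. space_op (u r) x)"

lemma C2_nonneg: "0 \<le> C2" using A_bound[of 0 0] by auto

lemma C3_nonneg: "0 \<le> C3" using A_Lip[of 0 1 0] by auto

lemma A_L2: "x \<in> {0..1} \<Longrightarrow> A x \<in> L2"
  by (rule L2_continuous[OF A_cont])

lemma space_op_bound: "x \<in> {0..1} \<Longrightarrow> f \<in> L2 \<Longrightarrow> \<bar>space_op f x\<bar> \<le> C2 * L2_norm f"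
  unfolding space_op_def by (rule kernel_bound) (auto simp: A_L2 A_bound)

lemma space_op_add:
  assumes "x \<in> {0..1}" "f \<in> L2" "g \<in> L2"
  shows "space_op (\<lambda>y. f y + c * g y) x = space_op f x + c * space_op g x"
  unfolding space_op_def using L2_mult_integrable[OF A_L2[OF assms(1)] assms(2)] L2_mult_integrable[OF A_L2[OF assms(1)] assms(3)]
  by (simp add: distrib_left mult.left_commute[of _ c])

lemma space_op_Lip:
  assumes "x \<in> {0..1}" "x' \<in> {0..1}" "f \<in> L2"
  shows "\<bar>space_op f x - space_op f x'\<bar> \<le> C3 * \<bar>x - x'\<bar> * L2_norm f"
proof -
  have "space_op f x - space_op f x' = (LINT y|lebesgue_on {0..1}. (A x y - A x' y) * f y)"
    unfolding space_op_def using L2_mult_integrable[OF A_L2[OF assms(1)] assms(3)] L2_mult_integrable[OF A_L2[OF assms(2)] assms(3)]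
    by (simp add: left_diff_distrib)
  moreover have "\<bar>LINT y|lebesgue_on {0..1}. (A x y - A x' y) * f y\<bar> \<le> C3 * \<bar>x - x'\<bar> * L2_norm f"
    by (rule kernel_bound) (use assms in \<open>auto intro!: A_Lip L2_diff A_L2\<close>)
  ultimately show ?thesis by simp
qed

lemma space_op_continuous:
  assumes u: "u \<in> C_L2 \<tau>" and x: "x \<in> {0..1}"
  shows "continuous_on {0..\<tau>} (\<lambda>r. space_op (u r) x)"
  unfolding continuous_on_def
proof
  fix s assume s: "s \<in> {0..\<tau>}"
  have L: "u r \<in> L2" if "r \<in> {0..\<tau>}" for r using u that by (simp add: C_L2_def)
  have "((\<lambda>r. space_op (u r) x - space_op (u s) x) \<longlongrightarrow> 0) (at s within {0..\<tau>})"
  proof (rule Lim_null_comparison)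
    have "((\<lambda>r. L2_norm (\<lambda>x. u r x - u s x)) \<longlongrightarrow> 0) (at s within {0..\<tau>})" using u s by (simp add: C_L2_def)
    from tendsto_mult_left[OF this, of C2] show "((\<lambda>r. C2 * L2_norm (\<lambda>x. u r x - u s x)) \<longlongrightarrow> 0) (at s within {0..\<tau>})" by simp
    have "\<forall>\<^sub>F r in at s within {0..\<tau>}. r \<in> {0..\<tau>}" by (simp add: eventually_at_filter)
    then show "\<forall>\<^sub>F r in at s within {0..\<tau>}. norm (space_op (u r) x - space_op (u s) x) \<le> C2 * L2_norm (\<lambda>x. u r x - u s x)"
    proof eventually_elim
      case (elim r)
      then show ?case using space_op_bound[OF x L2_diff[OF L[OF elim] L[OF s]]] space_op_add[OF x L[OF elim] L[OF s], of "-1"] by simp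
    qed
  qed
  then show "((\<lambda>r. space_op (u r) x) \<longlongrightarrow> space_op (u s) x) (at s within {0..\<tau>})" by (simp add: LIM_zero_iff)
qed

lemma space_op_integrable:
  assumes "u \<in> C_L2 \<tau>" "x \<in> {0..1}" "s \<in> {0..\<tau>}"
  shows "integrable (lebesgue_on {0..s}) (\<lambda>r. space_op (u r) x)"
  by (rule integrable_lebesgue_on_Icc[OF continuous_on_subset[OF space_op_continuous[OF assms(1,2)]]]) (use assms in auto)

lemma Volterra_bound:
  assumes u: "u \<in> C_L2 \<tau>" and x: "x \<in> {0..1}" and s: "s \<in> {0..\<tau>}"
  shows "\<bar>Volterra u s x\<bar> \<le> C2 * (LINT r|lebesgue_on {0..s}. L2_norm (u r))"
proof -
  have "\<bar>Volterra u s x\<bar> \<le> (LINT r|lebesgue_on {0..s}. \<bar>space_op (u r) x\<bar>)" unfolding Volterra_def by (rule integral_abs_bound)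
  also have "\<dots> \<le> (LINT r|lebesgue_on {0..s}. C2 * L2_norm (u r))"
  proof (rule integral_mono)
    show "integrable (lebesgue_on {0..s}) (\<lambda>r. C2 * L2_norm (u r))"
      using s by (intro integrable_lebesgue_on_Icc continuous_intros continuous_on_subset[OF C_L2_norm_continuous[OF u]]) auto
    show "\<bar>space_op (u r) x\<bar> \<le> C2 * L2_norm (u r)" if "r \<in> space (lebesgue_on {0..s})" for r
      using that s x u by (intro space_op_bound) (auto simp: C_L2_def)
  qed (use space_op_integrable[OF u x s] in auto)
  finally show ?thesis by simp
qed

lemma Volterra_add:
  assumes "u \<in> C_L2 \<tau>" "w \<in> C_L2 \<tau>" "x \<in> {0..1}" "s \<in> {0..\<tau>}"
  shows "Volterra (\<lambda>r y. u r y + c * w r y) s x = Volterra u s x + c * Volterra w s x"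
proof -
  have "Volterra (\<lambda>r y. u r y + c * w r y) s x = (LINT r|lebesgue_on {0..s}. space_op (u r) x + c * space_op (w r) x)"
    unfolding Volterra_def using assms
    by (intro Bochner_Integration.integral_cong refl space_op_add) (auto simp: C_L2_def)
  also have "\<dots> = Volterra u s x + c * Volterra w s x"
    unfolding Volterra_def using space_op_integrable assms by simp
  finally show ?thesis .
qed

text \<open>The operator smooths: \<open>A\<close> is Lipschitz in its first argument and the L2
  norm is bounded in time, so even a path in L2 has an image that is Lipschitz in time and space.
  Therefore all roughness of a solution sits in its initial value.\<close>

lemma Volterra_C_C:
  assumes u: "u \<in> C_L2 \<tau>"
  shows "Volterra u \<in> C_C \<tau>"
proof -
  have L: "u r \<in> L2" if "r \<in> {0..\<tau>}" for r using u that by (simp add: C_L2_def)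
  obtain D where D: "\<And>s. s \<in> {0..\<tau>} \<Longrightarrow> L2_norm (u s) \<le> D" using C_L2_norm_bounded[OF u] by blast
  have D0: "0 \<le> D" using D[of 0] L2_norm_nonneg[of "u 0"] \<tau> by auto
  have b: "\<bar>space_op (u r) x\<bar> \<le> C2 * D" if "r \<in> {0..\<tau>}" "x \<in> {0..1}" for r x
    using space_op_bound[OF that(2) L[OF that(1)]] mult_left_mono[OF D[OF that(1)] C2_nonneg] by linarith
  have dx: "\<bar>Volterra u s x - Volterra u s x'\<bar> \<le> C3 * D * \<tau> * \<bar>x - x'\<bar>"
    if "s \<in> {0..\<tau>}" "x \<in> {0..1}" "x' \<in> {0..1}" for s x x'
  proof -
    have "Volterra u s x - Volterra u s x' = (LINT r|lebesgue_on {0..s}. space_op (u r) x - space_op (u r) x')"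
      unfolding Volterra_def using space_op_integrable[OF u] that by simp
    also have "\<bar>\<dots>\<bar> \<le> C3 * \<bar>x - x'\<bar> * D * (s - 0)"
    proof (rule abs_LINT_Icc_le)
      fix r assume r: "r \<in> {0..s}"
      then have "\<bar>space_op (u r) x - space_op (u r) x'\<bar> \<le> C3 * \<bar>x - x'\<bar> * L2_norm (u r)"
        using that by (intro space_op_Lip L) auto
      also have "\<dots> \<le> C3 * \<bar>x - x'\<bar> * D" using r that C3_nonneg by (intro mult_left_mono D) auto
      finally show "\<bar>space_op (u r) x - space_op (u r) x'\<bar> \<le> C3 * \<bar>x - x'\<bar> * D" .
    qed (use that in auto)
    also have "\<dots> \<le> C3 * \<bar>x - x'\<bar> * D * \<tau>" using that C3_nonneg D0 by (intro mult_left_mono) auto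
    finally show ?thesis by (simp add: mult_ac)
  qed
  have ds: "\<bar>Volterra u t x - Volterra u s x\<bar> \<le> C2 * D * \<bar>t - s\<bar>"
    if "s \<in> {0..\<tau>}" "t \<in> {0..\<tau>}" "x \<in> {0..1}" for s t x
  proof -
    have le: "\<bar>Volterra u t x - Volterra u s x\<bar> \<le> C2 * D * \<bar>t - s\<bar>" if "s \<in> {0..\<tau>}" "t \<in> {0..\<tau>}" "s \<le> t" for s t
    proof -
      have "Volterra u t x = Volterra u s x + (LINT r|lebesgue_on {s..t}. space_op (u r) x)"
        unfolding Volterra_def using that
        by (intro LINT_Icc_split continuous_on_subset[OF space_op_continuous[OF u \<open>x \<in> {0..1}\<close>]]) auto
      moreover have "\<bar>LINT r|lebesgue_on {s..t}. space_op (u r) x\<bar> \<le> C2 * D * (t - s)"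
        using that \<open>x \<in> {0..1}\<close> by (intro abs_LINT_Icc_le b) auto
      ultimately show ?thesis using that by simp
    qed
    show ?thesis using le[of s t] le[of t s] that by (cases "s \<le> t") (auto simp: abs_minus_commute)
  qed
  define K where "K = C2 * D + C3 * D * \<tau>"
  have "K-lipschitz_on ({0..\<tau>} \<times> {0..1}) (\<lambda>(s, x). Volterra u s x)"
  proof (rule lipschitz_onI)
    show "0 \<le> K" using C2_nonneg C3_nonneg D0 \<tau> by (simp add: K_def)
    fix p q :: "real \<times> real" assume pq: "p \<in> {0..\<tau>} \<times> {0..1}" "q \<in> {0..\<tau>} \<times> {0..1}"
    obtain s x t y where p: "p = (s, x)" and q: "q = (t, y)" by (cases p, cases q)
    have "\<bar>s - t\<bar> \<le> dist p q" "\<bar>x - y\<bar> \<le> dist p q"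
      using dist_fst_le[of p q] dist_snd_le[of p q] by (auto simp: p q dist_real_def)
    then have "C2 * D * \<bar>s - t\<bar> + C3 * D * \<tau> * \<bar>x - y\<bar> \<le> C2 * D * dist p q + C3 * D * \<tau> * dist p q"
      using C2_nonneg C3_nonneg D0 \<tau> by (intro add_mono mult_left_mono) auto
    moreover have "\<bar>Volterra u s x - Volterra u t x\<bar> \<le> C2 * D * \<bar>s - t\<bar>" "\<bar>Volterra u t x - Volterra u t y\<bar> \<le> C3 * D * \<tau> * \<bar>x - y\<bar>"
      using pq by (auto simp: p q intro!: ds dx)
    ultimately show "dist (case p of (s, x) \<Rightarrow> Volterra u s x) (case q of (s, x) \<Rightarrow> Volterra u s x) \<le> K * dist p q"
      by (simp add: p q dist_real_def K_def distrib_right)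
  qed
  then show ?thesis unfolding C_C_iff by (rule lipschitz_on_continuous_on)
qed

section \<open>The Picard series\<close>

primrec Picard :: "real \<Rightarrow> (real \<Rightarrow> real \<Rightarrow> real) \<Rightarrow> nat \<Rightarrow> real \<Rightarrow> real \<Rightarrow> real" where
  "Picard \<alpha> u 0 = u"
| "Picard \<alpha> u (Suc n) = (\<lambda>s x. - \<alpha> * Volterra (Picard \<alpha> u n) s x)"

lemma C_C_lincomb: "u \<in> C_C \<tau> \<Longrightarrow> w \<in> C_C \<tau> \<Longrightarrow> (\<lambda>s x. a * u s x + b * w s x) \<in> C_C \<tau>"
  unfolding C_C_iff split_beta by (intro continuous_intros)

lemma Picard_C_L2: "u \<in> C_L2 \<tau> \<Longrightarrow> Picard \<alpha> u n \<in> C_L2 \<tau>"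
proof (induction n)
  case (Suc n)
  have "(\<lambda>s x. - \<alpha> * Volterra (Picard \<alpha> u n) s x + 0 * Volterra (Picard \<alpha> u n) s x) \<in> C_C \<tau>"
    by (intro C_C_lincomb Volterra_C_C Suc)
  then show ?case by (intro C_C_imp_C_L2) simp
qed simp

lemma Picard_Suc_C_C: "u \<in> C_L2 \<tau> \<Longrightarrow> Picard \<alpha> u (Suc n) \<in> C_C \<tau>"
  using C_C_lincomb[OF Volterra_C_C Volterra_C_C, OF Picard_C_L2 Picard_C_L2, of u u "-\<alpha>" \<alpha> n 0 \<alpha> n] by simp

text \<open>The L2 norm at one stage controls the values at all points of the next, and the integral
  of \<open>r^n\<close> supplies the new factor of the factorial. The step stands apart from the
  induction because both the L2 bound and the uniform bound come from it.\<close>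

lemma Picard_step:
  assumes u: "u \<in> C_L2 \<tau>" and \<alpha>: "0 \<le> \<alpha>"
    and IH: "\<And>r. r \<in> {0..\<tau>} \<Longrightarrow> L2_norm (Picard \<alpha> u n r) \<le> D * (\<alpha> * C2 * r)^n / fact n"
    and s: "s \<in> {0..\<tau>}" and x: "x \<in> {0..1}"
  shows "\<bar>Picard \<alpha> u (Suc n) s x\<bar> \<le> D * (\<alpha> * C2 * s)^(Suc n) / fact (Suc n)"
proof -
  have "\<bar>Picard \<alpha> u (Suc n) s x\<bar> = \<alpha> * \<bar>Volterra (Picard \<alpha> u n) s x\<bar>" using \<alpha> by (simp add: abs_mult)
  also have "\<dots> \<le> \<alpha> * (C2 * (LINT r|lebesgue_on {0..s}. L2_norm (Picard \<alpha> u n r)))"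
    using \<alpha> by (intro mult_left_mono Volterra_bound Picard_C_L2 u x s)
  also have "\<dots> \<le> \<alpha> * (C2 * (LINT r|lebesgue_on {0..s}. D * (\<alpha> * C2)^n / fact n * r^n))"
  proof (intro mult_left_mono integral_mono)
    show "integrable (lebesgue_on {0..s}) (\<lambda>r. L2_norm (Picard \<alpha> u n r))"
      using s by (intro integrable_lebesgue_on_Icc continuous_on_subset[OF C_L2_norm_continuous[OF Picard_C_L2[OF u]]]) auto
    show "integrable (lebesgue_on {0..s}) (\<lambda>r. D * (\<alpha> * C2)^n / fact n * r^n)"
      by (intro integrable_lebesgue_on_Icc continuous_intros)
    show "L2_norm (Picard \<alpha> u n r) \<le> D * (\<alpha> * C2)^n / fact n * r^n" if "r \<in> space (lebesgue_on {0..s})" for r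
      using IH[of r] that s by (simp add: power_mult_distrib mult.assoc)
  qed (use \<alpha> C2_nonneg in auto)
  also have "(LINT r|lebesgue_on {0..s}. D * (\<alpha> * C2)^n / fact n * r^n) = D * (\<alpha> * C2)^n / fact n * (s^Suc n / real (Suc n))"
    using s LINT_power[of s n] by simp
  also have "\<alpha> * (C2 * (D * (\<alpha> * C2)^n / fact n * (s^Suc n / real (Suc n)))) = D * (\<alpha> * C2 * s)^(Suc n) / fact (Suc n)"
    by (simp add: power_mult_distrib field_simps)
  finally show ?thesis .
qed

lemma Picard_norm_bound:
  assumes u: "u \<in> C_L2 \<tau>" and \<alpha>: "0 \<le> \<alpha>" and D: "\<And>s. s \<in> {0..\<tau>} \<Longrightarrow> L2_norm (u s) \<le> D"
  shows "s \<in> {0..\<tau>} \<Longrightarrow> L2_norm (Picard \<alpha> u n s) \<le> D * (\<alpha> * C2 * s)^n / fact n"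
proof (induction n arbitrary: s)
  case 0
  then show ?case using D by simp
next
  case (Suc n)
  have D0: "0 \<le> D" using D[of 0] L2_norm_nonneg[of "u 0"] \<tau> by auto
  have Pn: "Picard \<alpha> u (Suc n) s \<in> L2" using Picard_C_L2[OF u, of \<alpha> "Suc n"] Suc.prems by (simp add: C_L2_def)
  show ?case
  proof (rule L2_norm_le_bound[OF Pn])
    show "0 \<le> D * (\<alpha> * C2 * s)^(Suc n) / fact (Suc n)"
      using Suc.prems D0 \<alpha> C2_nonneg by (intro divide_nonneg_pos mult_nonneg_nonneg zero_le_power) auto
    show "AE x in lebesgue_on {0..1}. \<bar>Picard \<alpha> u (Suc n) s x\<bar> \<le> D * (\<alpha> * C2 * s)^(Suc n) / fact (Suc n)"
    proof (rule AE_I2)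
      fix x assume "x \<in> space (lebesgue_on {0..1::real})"
      then show "\<bar>Picard \<alpha> u (Suc n) s x\<bar> \<le> D * (\<alpha> * C2 * s)^(Suc n) / fact (Suc n)"
        by (intro Picard_step[OF u \<alpha> Suc.IH Suc.prems]) auto
    qed
  qed
qed

lemma Picard_bound:
  assumes "u \<in> C_L2 \<tau>" "0 \<le> \<alpha>" "\<And>s. s \<in> {0..\<tau>} \<Longrightarrow> L2_norm (u s) \<le> D" "s \<in> {0..\<tau>}" "x \<in> {0..1}"
  shows "\<bar>Picard \<alpha> u (Suc n) s x\<bar> \<le> D * (\<alpha> * C2 * s)^(Suc n) / fact (Suc n)"
  by (rule Picard_step[OF assms(1,2) Picard_norm_bound[OF assms(1,2,3)] assms(4,5)])

text \<open>The series starts with the first iterate: the term \<open>u\<close> may be merely square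
  integrable, while all later terms are continuous.\<close>

definition resolvent :: "real \<Rightarrow> (real \<Rightarrow> real \<Rightarrow> real) \<Rightarrow> real \<Rightarrow> real \<Rightarrow> real" where
  "resolvent \<alpha> u s x = (\<Sum>n. Picard \<alpha> u (Suc n) s x)"

lemma Volterra_sum:
  assumes u: "u \<in> C_L2 \<tau>" and s: "s \<in> {0..\<tau>}" and x: "x \<in> {0..1}"
  shows "(\<lambda>r y. \<Sum>i<n. Picard \<alpha> u (Suc i) r y) \<in> C_L2 \<tau>"
    "Volterra (\<lambda>r y. \<Sum>i<n. Picard \<alpha> u (Suc i) r y) s x = (\<Sum>i<n. Volterra (Picard \<alpha> u (Suc i)) s x)"
proof (induction n)
  case 0
  show "(\<lambda>r y. \<Sum>i<0. Picard \<alpha> u (Suc i) r y) \<in> C_L2 \<tau>" using C_L2_const[OF L2_const[of 0]] by simp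
  show "Volterra (\<lambda>r y. \<Sum>i<0. Picard \<alpha> u (Suc i) r y) s x = (\<Sum>i<0. Volterra (Picard \<alpha> u (Suc i)) s x)"
    by (simp add: Volterra_def space_op_def)
next
  case (Suc n)
  show "(\<lambda>r y. \<Sum>i<Suc n. Picard \<alpha> u (Suc i) r y) \<in> C_L2 \<tau>"
    using C_L2_add[OF Suc(1) Picard_C_L2[OF u, of \<alpha> "Suc n"], of 1] by simp
  show "Volterra (\<lambda>r y. \<Sum>i<Suc n. Picard \<alpha> u (Suc i) r y) s x = (\<Sum>i<Suc n. Volterra (Picard \<alpha> u (Suc i)) s x)"
    using Volterra_add[OF Suc(1) Picard_C_L2[OF u, of \<alpha> "Suc n"] x s, of 1] Suc(2) by simp
qed

text \<open>The exponential series majorises the iterates, so the convergence is uniform on the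
  rectangle. This gives continuity and allows the limit to pass through the integral
  operator.\<close>

lemma resolvent_C_C_eq:
  assumes u: "u \<in> C_L2 \<tau>" and \<alpha>: "0 \<le> \<alpha>"
  shows "resolvent \<alpha> u \<in> C_C \<tau>"
    and "s \<in> {0..\<tau>} \<Longrightarrow> x \<in> {0..1} \<Longrightarrow> resolvent \<alpha> u s x = - \<alpha> * Volterra (\<lambda>r y. u r y + resolvent \<alpha> u r y) s x"
proof -
  obtain D where D: "\<And>s. s \<in> {0..\<tau>} \<Longrightarrow> L2_norm (u s) \<le> D" using C_L2_norm_bounded[OF u] by blast
  have D0: "0 \<le> D" using D[of 0] L2_norm_nonneg[of "u 0"] \<tau> by auto
  define S where "S n p = (\<Sum>i<n. Picard \<alpha> u (Suc i) (fst p) (snd p))" for n p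
  have ul: "uniform_limit ({0..\<tau>} \<times> {0..1}) S (\<lambda>p. resolvent \<alpha> u (fst p) (snd p)) sequentially"
    unfolding S_def resolvent_def
  proof (rule Weierstrass_m_test)
    fix n and p :: "real \<times> real" assume p: "p \<in> {0..\<tau>} \<times> {0..1}"
    have "\<bar>Picard \<alpha> u (Suc n) (fst p) (snd p)\<bar> \<le> D * (\<alpha> * C2 * fst p)^(Suc n) / fact (Suc n)"
      using p by (intro Picard_bound[OF u \<alpha> D]) auto
    also have "\<dots> \<le> D * (\<alpha> * C2 * \<tau>)^(Suc n) / fact (Suc n)"
      using p D0 \<alpha> C2_nonneg by (intro divide_right_mono mult_left_mono power_mono mult_nonneg_nonneg) auto
    finally show "norm (Picard \<alpha> u (Suc n) (fst p) (snd p)) \<le> D * ((\<alpha> * C2 * \<tau>)^(Suc n) / fact (Suc n))" by simp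
  next
    have "summable (\<lambda>n. (\<alpha> * C2 * \<tau>)^n / fact n)" using summable_exp[of "\<alpha> * C2 * \<tau>"] by (simp add: divide_inverse mult.commute)
    then have "summable (\<lambda>n. (\<alpha> * C2 * \<tau>)^(Suc n) / fact (Suc n))" by (subst summable_Suc_iff)
    then show "summable (\<lambda>n. D * ((\<alpha> * C2 * \<tau>)^(Suc n) / fact (Suc n)))" by (rule summable_mult)
  qed
  have Sc: "continuous_on ({0..\<tau>} \<times> {0..1}) (S n)" for n
    unfolding S_def using Picard_Suc_C_C[OF u, of \<alpha>] by (intro continuous_on_sum) (auto simp: C_C_iff split_beta simp del: Picard.simps)
  show rC: "resolvent \<alpha> u \<in> C_C \<tau>"
    unfolding C_C_iff split_beta by (rule uniform_limit_theorem[OF _ ul]) (auto simp: Sc)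
  show "resolvent \<alpha> u s x = - \<alpha> * Volterra (\<lambda>r y. u r y + resolvent \<alpha> u r y) s x" if s: "s \<in> {0..\<tau>}" and x: "x \<in> {0..1}"
  proof -
    define W where "W n = (\<lambda>r y. \<Sum>i<n. Picard \<alpha> u (Suc i) r y)" for n
    have WC: "W n \<in> C_L2 \<tau>" for n unfolding W_def by (rule Volterra_sum[OF u s x])
    have lim1: "(\<lambda>n. W n s x) \<longlonglongrightarrow> resolvent \<alpha> u s x"
      using tendsto_uniform_limitI[OF ul, of "(s,x)"] s x by (simp add: S_def W_def)
    \<comment> \<open>Splitting off the index 0 isolates the image of \<open>u\<close>; the rest is
      the operator applied to the previous partial sum.\<close>
    have W_Suc: "W (Suc n) s x = - \<alpha> * Volterra u s x - \<alpha> * Volterra (W n) s x" for n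
    proof -
      have "W (Suc n) s x = (\<Sum>i<Suc n. - \<alpha> * Volterra (Picard \<alpha> u i) s x)" by (simp add: W_def)
      also have "\<dots> = - \<alpha> * Volterra u s x + (\<Sum>i<n. - \<alpha> * Volterra (Picard \<alpha> u (Suc i)) s x)"
        by (subst sum.lessThan_Suc_shift) simp
      also have "(\<Sum>i<n. - \<alpha> * Volterra (Picard \<alpha> u (Suc i)) s x) = - \<alpha> * Volterra (W n) s x"
        unfolding W_def Volterra_sum(2)[OF u s x] by (simp add: sum_distrib_left sum_negf del: Picard.simps)
      finally show ?thesis by simp
    qed
    have lim2: "(\<lambda>n. Volterra (W n) s x) \<longlonglongrightarrow> Volterra (resolvent \<alpha> u) s x"
    proof (rule tendstoI)
      fix e :: real assume e: "0 < e"
      \<comment> \<open>The summand 1 keeps the denominator positive also for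
        \<open>C2 = 0\<close>.\<close>
      define d where "d = e / (2 * (C2 * \<tau> + 1))"
      have C2t: "0 \<le> C2 * \<tau>" using C2_nonneg \<tau> by simp
      have d: "0 < d" using e C2t by (simp add: d_def)
      have "\<forall>\<^sub>F n in sequentially. \<forall>p\<in>{0..\<tau>} \<times> {0..1}. dist (S n p) (resolvent \<alpha> u (fst p) (snd p)) < d"
        using uniform_limitD[OF ul d] .
      then show "\<forall>\<^sub>F n in sequentially. dist (Volterra (W n) s x) (Volterra (resolvent \<alpha> u) s x) < e"
      proof eventually_elim
        case (elim n)
        let ?w = "\<lambda>r y. W n r y + (-1) * resolvent \<alpha> u r y"
        have wC: "?w \<in> C_L2 \<tau>" by (rule C_L2_add[OF WC C_C_imp_C_L2[OF rC]])
        have wb: "L2_norm (?w r) \<le> d" if r: "r \<in> {0..\<tau>}" for r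
        proof (rule L2_norm_le_bound)
          show "?w r \<in> L2" using wC r by (simp add: C_L2_def)
          show "AE y in lebesgue_on {0..1}. \<bar>?w r y\<bar> \<le> d"
            using elim r by (intro AE_I2) (auto simp: S_def W_def dist_real_def less_imp_le)
        qed (use d in simp)
        have "Volterra (W n) s x - Volterra (resolvent \<alpha> u) s x = Volterra ?w s x"
          using Volterra_add[OF WC C_C_imp_C_L2[OF rC] x s, of n "-1"] by simp
        moreover have "\<bar>Volterra ?w s x\<bar> \<le> C2 * (LINT r|lebesgue_on {0..s}. L2_norm (?w r))" by (rule Volterra_bound[OF wC x s])
        moreover have "C2 * (LINT r|lebesgue_on {0..s}. L2_norm (?w r)) \<le> C2 * (d * (s - 0))"
          using s wb L2_norm_nonneg C2_nonneg by (intro mult_left_mono order_trans[OF abs_ge_self abs_LINT_Icc_le]) auto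
        moreover have "C2 * (d * (s - 0)) \<le> C2 * \<tau> * d" using s C2_nonneg d by (simp add: mult_left_mono mult_ac)
        moreover have "C2 * \<tau> * d < e"
        proof -
          have "C2 * \<tau> * d \<le> (C2 * \<tau> + 1) * d" using d by simp
          also have "\<dots> = e / 2" using C2t by (simp add: d_def field_simps)
          finally show ?thesis using e by simp
        qed
        ultimately show ?case by (simp add: dist_real_def)
      qed
    qed
    have "(\<lambda>n. W (Suc n) s x) \<longlonglongrightarrow> - \<alpha> * Volterra u s x - \<alpha> * Volterra (resolvent \<alpha> u) s x"
      unfolding W_Suc by (intro tendsto_intros lim2)
    then have "resolvent \<alpha> u s x = - \<alpha> * Volterra u s x - \<alpha> * Volterra (resolvent \<alpha> u) s x"
      using LIMSEQ_unique[OF LIMSEQ_Suc[OF lim1]] by blast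
    then show ?thesis using Volterra_add[OF u C_C_imp_C_L2[OF rC] x s, of 1] by (simp add: algebra_simps)
  qed
qed

text \<open>The paths themselves agree only almost everywhere in space, but their images under the
  operator agree at every point. Inserted into the equation, this yields uniqueness pointwise for
  continuous solutions and almost everywhere for those in L2.\<close>

lemma Volterra_unique:
  assumes u: "u \<in> C_L2 \<tau>" and w: "w \<in> C_L2 \<tau>" and \<alpha>: "0 \<le> \<alpha>"
    and eq: "\<And>s. s \<in> {0..\<tau>} \<Longrightarrow> AE x in lebesgue_on {0..1}. u s x - w s x = - \<alpha> * (Volterra u s x - Volterra w s x)"
    and s: "s \<in> {0..\<tau>}" and x: "x \<in> {0..1}"
  shows "Volterra u s x = Volterra w s x"
proof -
  define d where "d = (\<lambda>r y. u r y + (-1) * w r y)"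
  have dC: "d \<in> C_L2 \<tau>" unfolding d_def by (rule C_L2_add[OF u w])
  have Vd: "Volterra d s x = Volterra u s x - Volterra w s x" if "s \<in> {0..\<tau>}" "x \<in> {0..1}" for s x
    unfolding d_def using Volterra_add[OF u w that(2,1), of "-1"] by simp
  \<comment> \<open>The summand 0 is the constant \<open>a\<close> of
    \<open>Gronwall_integral\<close>.\<close>
  have "L2_norm (d s) \<le> 0 + (\<alpha> * C2) * (LINT r|lebesgue_on {0..s}. L2_norm (d r))" if s: "s \<in> {0..\<tau>}" for s
  proof (rule L2_norm_le_bound)
    show "d s \<in> L2" using dC s by (simp add: C_L2_def)
    have I: "0 \<le> (LINT r|lebesgue_on {0..s}. L2_norm (d r))" by (rule integral_nonneg_AE) (simp add: L2_norm_nonneg)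
    then show "0 \<le> 0 + (\<alpha> * C2) * (LINT r|lebesgue_on {0..s}. L2_norm (d r))" using \<alpha> C2_nonneg by simp
    have "AE x in lebesgue_on {0..1}. x \<in> {0..1::real}" by (rule AE_I2) simp
    with eq[OF s] show "AE x in lebesgue_on {0..1}. \<bar>d s x\<bar> \<le> 0 + (\<alpha> * C2) * (LINT r|lebesgue_on {0..s}. L2_norm (d r))"
    proof eventually_elim
      case (elim x)
      have "d s x = - \<alpha> * Volterra d s x" using elim(1) unfolding Vd[OF s elim(2)] by (simp add: d_def)
      then have "\<bar>d s x\<bar> = \<alpha> * \<bar>Volterra d s x\<bar>" using \<alpha> by (simp add: abs_mult)
      also have "\<dots> \<le> \<alpha> * (C2 * (LINT r|lebesgue_on {0..s}. L2_norm (d r)))"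
        using \<alpha> by (intro mult_left_mono Volterra_bound[OF dC elim(2) s])
      finally show ?case by (simp add: mult.assoc)
    qed
  qed
  then have "L2_norm (d r) \<le> 0 * exp (\<alpha> * C2 * r)" if "r \<in> {0..\<tau>}" for r
    using \<alpha> C2_nonneg that by (intro Gronwall_integral[OF C_L2_norm_continuous[OF dC]]) auto
  then have "L2_norm (d r) = 0" if "r \<in> {0..\<tau>}" for r using that L2_norm_nonneg[of "d r"] by (simp add: antisym)
  then have "(LINT r|lebesgue_on {0..s}. L2_norm (d r)) = (LINT r|lebesgue_on {0..s}. 0)"
    using s by (intro Bochner_Integration.integral_cong) auto
  then have "Volterra d s x = 0" using Volterra_bound[OF dC x s] by simp
  then show ?thesis using Vd[OF s x] by simp
qed

text \<open>Minkowski's inequality for the three terms of the equation, then Gronwall's lemma. With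
  one bound \<open>c\<close> for the noise at all times the result is uniform in \<open>s\<close>,
  so it survives the supremum.\<close>

lemma Volterra_growth:
  assumes u: "u \<in> C_L2 \<tau>" and \<alpha>: "0 \<le> \<alpha>" and u0: "u0 \<in> L2" and m: "m \<in> C_L2 \<tau>"
    and mS: "\<And>s. s \<in> {0..\<tau>} \<Longrightarrow> L2_norm (m s) \<le> c"
    and eq: "\<And>s. s \<in> {0..\<tau>} \<Longrightarrow> AE x in lebesgue_on {0..1}. u s x = u0 x - \<alpha> * Volterra u s x + m s x"
    and s: "s \<in> {0..\<tau>}"
  shows "L2_norm (u s) \<le> (L2_norm u0 + c) * exp (\<alpha> * C2 * \<tau>)"
proof -
  have "L2_norm (u s) \<le> (L2_norm u0 + c) + (\<alpha> * C2) * (LINT r|lebesgue_on {0..s}. L2_norm (u r))" if s: "s \<in> {0..\<tau>}" for s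
  proof -
    have us: "u s \<in> L2" "m s \<in> L2" using u m s by (auto simp: C_L2_def)
    have VL: "(\<lambda>x. - \<alpha> * Volterra u s x) \<in> L2"
      using Volterra_C_C[OF u] s by (intro L2_cmult L2_continuous) (simp add: C_C_def)
    have "L2_norm (u s) = L2_norm (\<lambda>x. (u0 x + m s x) + (- \<alpha> * Volterra u s x))"
      using eq[OF s] by (intro L2_norm_cong_AE L2_add us u0 VL) (auto elim: eventually_mono)
    also have "\<dots> \<le> L2_norm (\<lambda>x. u0 x + m s x) + L2_norm (\<lambda>x. - \<alpha> * Volterra u s x)"
      by (intro L2_norm_triangle L2_add u0 us VL)
    also have "L2_norm (\<lambda>x. u0 x + m s x) \<le> L2_norm u0 + L2_norm (m s)" by (intro L2_norm_triangle u0 us)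
    also have "L2_norm (\<lambda>x. - \<alpha> * Volterra u s x) \<le> (\<alpha> * C2) * (LINT r|lebesgue_on {0..s}. L2_norm (u r))"
    proof (rule L2_norm_le_bound[OF VL])
      have "0 \<le> (LINT r|lebesgue_on {0..s}. L2_norm (u r))" by (rule integral_nonneg_AE) (simp add: L2_norm_nonneg)
      then show "0 \<le> (\<alpha> * C2) * (LINT r|lebesgue_on {0..s}. L2_norm (u r))" using \<alpha> C2_nonneg by simp
      show "AE x in lebesgue_on {0..1}. \<bar>- \<alpha> * Volterra u s x\<bar> \<le> (\<alpha> * C2) * (LINT r|lebesgue_on {0..s}. L2_norm (u r))"
        using \<alpha> mult_left_mono[OF Volterra_bound[OF u _ s] \<alpha>] by (intro AE_I2) (auto simp: abs_mult mult.assoc)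
    qed
    finally show ?thesis using mS[OF s] by simp
  qed
  then have "L2_norm (u s) \<le> (L2_norm u0 + c) * exp (\<alpha> * C2 * s)"
    using \<alpha> C2_nonneg s by (intro Gronwall_integral[OF C_L2_norm_continuous[OF u]]) auto
  also have "\<dots> \<le> (L2_norm u0 + c) * exp (\<alpha> * C2 * \<tau>)"
  proof (rule mult_left_mono)
    have "0 \<le> c" using mS[OF s] L2_norm_nonneg[of "m s"] by linarith
    then show "0 \<le> L2_norm u0 + c" using L2_norm_nonneg[of u0] by simp
    show "exp (\<alpha> * C2 * s) \<le> exp (\<alpha> * C2 * \<tau>)" using s \<alpha> C2_nonneg by (simp add: mult_left_mono)
  qed
  finally show ?thesis .
qed

end

section \<open>Measurability\<close>

text \<open>The half-open cell from \<open>k / (n + 1)\<close> to \<open>(k + 1) / (n + 1)\<close>.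
  In terms of the floor function it is evident that the cells partition the line.\<close>

definition floor_cell :: "nat \<Rightarrow> int \<Rightarrow> real set" where
  "floor_cell n k = {r. \<lfloor>real (Suc n) * r\<rfloor> = k}"

lemma floor_cell_borel: "floor_cell n k \<in> sets borel"
  unfolding floor_cell_def by measurable

lemma indicator_lebesgue_on_measurable:
  "J \<in> sets borel \<Longrightarrow> (indicator J :: real \<Rightarrow> real) \<in> borel_measurable (lebesgue_on S)"
  by (intro measurable_restrict_space1 borel_measurable_indicator) simp

lemma integrable_mult_indicator_on:
  fixes w :: "real \<Rightarrow> real"
  assumes "integrable (lebesgue_on S) w" "J \<in> sets borel"
  shows "integrable (lebesgue_on S) (\<lambda>r. w r * indicator J r)"
proof (rule Bochner_Integration.integrable_bound[OF assms(1)])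
  show "(\<lambda>r. w r * indicator J r) \<in> borel_measurable (lebesgue_on S)"
    by (intro borel_measurable_times borel_measurable_integrable[OF assms(1)] indicator_lebesgue_on_measurable[OF assms(2)])
qed (auto simp: indicator_def)

text \<open>Exactly one cell contains \<open>r\<close>. The range of \<open>k\<close> includes the
  last cell, of which only a part may lie in the interval.\<close>

lemma floor_cell_sum:
  fixes F :: "real \<Rightarrow> real"
  assumes r: "r \<in> {0..b}"
  shows "(\<Sum>k\<in>{0..\<lfloor>real (Suc n) * b\<rfloor>}. F (of_int k / real (Suc n)) * (c * indicator (floor_cell n k) r))
    = c * F (of_int \<lfloor>real (Suc n) * r\<rfloor> / real (Suc n))"
proof -
  have "\<lfloor>real (Suc n) * r\<rfloor> \<in> {0..\<lfloor>real (Suc n) * b\<rfloor>}"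
    using r by (auto intro!: floor_mono mult_left_mono simp: zero_le_mult_iff simp del: of_nat_Suc)
  moreover have "F (of_int k / real (Suc n)) * (c * indicator (floor_cell n k) r)
     = (if \<lfloor>real (Suc n) * r\<rfloor> = k then F (of_int k / real (Suc n)) * c else 0)" for k
    by (simp add: floor_cell_def indicator_def)
  ultimately show ?thesis by (simp add: sum.delta' mult.commute del: of_nat_Suc)
qed

lemma floor_approx_in:
  assumes "r \<in> {0..b}"
  shows "of_int \<lfloor>real (Suc n) * r\<rfloor> / real (Suc n) \<in> {0..b}"
proof -
  have "of_int \<lfloor>real (Suc n) * r\<rfloor> / real (Suc n) \<le> r"
    by (simp add: pos_divide_le_eq mult.commute del: of_nat_Suc)
  then show ?thesis using assms by (auto simp: zero_le_mult_iff simp del: of_nat_Suc)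
qed

lemma floor_approx_tendsto: "(\<lambda>n. of_int \<lfloor>real (Suc n) * r\<rfloor> / real (Suc n)) \<longlonglongrightarrow> r"
proof -
  have "(\<lambda>n. of_int \<lfloor>real (Suc n) * r\<rfloor> / real (Suc n) - r) \<longlonglongrightarrow> 0"
  proof (rule Lim_null_comparison[OF _ LIMSEQ_inverse_real_of_nat])
    show "\<forall>\<^sub>F n in sequentially. norm (of_int \<lfloor>real (Suc n) * r\<rfloor> / real (Suc n) - r) \<le> inverse (real (Suc n))"
    proof (intro always_eventually allI)
      fix n
      have "\<bar>of_int \<lfloor>real (Suc n) * r\<rfloor> - real (Suc n) * r\<bar> \<le> 1" by linarith
      then have "\<bar>of_int \<lfloor>real (Suc n) * r\<rfloor> - real (Suc n) * r\<bar> / real (Suc n) \<le> 1 / real (Suc n)"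
        by (rule divide_right_mono) simp
      moreover have "of_int \<lfloor>real (Suc n) * r\<rfloor> / real (Suc n) - r = (of_int \<lfloor>real (Suc n) * r\<rfloor> - real (Suc n) * r) / real (Suc n)"
        by (simp add: diff_divide_distrib)
      ultimately show "norm (of_int \<lfloor>real (Suc n) * r\<rfloor> / real (Suc n) - r) \<le> inverse (real (Suc n))"
        by (simp add: abs_divide inverse_eq_divide del: of_nat_Suc)
    qed
  qed
  then show ?thesis by (simp add: LIM_zero_iff)
qed

text \<open>The continuous factor is sampled at the left end points of the cells and the weight is
  integrated over them, so the weight may be merely integrable. Dominated convergence applies since
  \<open>F\<close> is bounded.\<close>

lemma weighted_Riemann_sum_tendsto:
  fixes w F :: "real \<Rightarrow> real"
  assumes w: "integrable (lebesgue_on {0..b}) w" and F: "continuous_on {0..b} F"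
  shows "(\<lambda>n. \<Sum>k\<in>{0..\<lfloor>real (Suc n) * b\<rfloor>}. F (of_int k / real (Suc n)) * (LINT r|lebesgue_on {0..b}. w r * indicator (floor_cell n k) r))
    \<longlonglongrightarrow> (LINT r|lebesgue_on {0..b}. w r * F r)"
proof -
  let ?s = "\<lambda>n r. \<Sum>k\<in>{0..\<lfloor>real (Suc n) * b\<rfloor>}. F (of_int k / real (Suc n)) * (w r * indicator (floor_cell n k) r)"
  have wi: "integrable (lebesgue_on {0..b}) (\<lambda>r. w r * indicator (floor_cell n k) r)" for n k
    by (rule integrable_mult_indicator_on[OF w floor_cell_borel])
  have "bounded (F ` {0..b})" by (intro compact_imp_bounded compact_continuous_image F compact_Icc)
  then obtain B where "\<forall>r\<in>{0..b}. \<bar>F r\<bar> \<le> B" by (auto simp: bounded_iff)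
  then have B: "\<bar>F r\<bar> \<le> B" if "r \<in> {0..b}" for r using that by blast
  have "(\<lambda>n. LINT r|lebesgue_on {0..b}. ?s n r) \<longlonglongrightarrow> (LINT r|lebesgue_on {0..b}. w r * F r)"
  proof (rule integral_dominated_convergence[where w="\<lambda>r. \<bar>w r\<bar> * B"])
    have "F \<in> borel_measurable (lebesgue_on {0..b})" by (rule borel_measurable_integrable[OF integrable_lebesgue_on_Icc[OF F]])
    then show "(\<lambda>r. w r * F r) \<in> borel_measurable (lebesgue_on {0..b})"
      using borel_measurable_integrable[OF w] by (rule borel_measurable_times[rotated])
    show "?s n \<in> borel_measurable (lebesgue_on {0..b})" for n
      by (intro borel_measurable_sum borel_measurable_times borel_measurable_const borel_measurable_integrable[OF wi] borel_measurable_integrable[OF w]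
          indicator_lebesgue_on_measurable floor_cell_borel)
    show "integrable (lebesgue_on {0..b}) (\<lambda>r. \<bar>w r\<bar> * B)" using w by (intro integrable_mult_left integrable_abs)
    show "AE r in lebesgue_on {0..b}. (\<lambda>n. ?s n r) \<longlonglongrightarrow> w r * F r"
    proof (rule AE_I2)
      fix r assume "r \<in> space (lebesgue_on {0..b})"
      then have r: "r \<in> {0..b}" by simp
      have "(\<lambda>n. F (of_int \<lfloor>real (Suc n) * r\<rfloor> / real (Suc n))) \<longlonglongrightarrow> F r"
        by (rule continuous_on_tendsto_compose[OF F floor_approx_tendsto r]) (use floor_approx_in[OF r] in auto)
      then show "(\<lambda>n. ?s n r) \<longlonglongrightarrow> w r * F r" unfolding floor_cell_sum[OF r] by (rule tendsto_mult_left)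
    qed
    show "AE r in lebesgue_on {0..b}. norm (?s n r) \<le> \<bar>w r\<bar> * B" for n
    proof (rule AE_I2)
      fix r assume "r \<in> space (lebesgue_on {0..b})"
      then have r: "r \<in> {0..b}" by simp
      show "norm (?s n r) \<le> \<bar>w r\<bar> * B"
        unfolding floor_cell_sum[OF r] real_norm_def abs_mult by (intro mult_left_mono B floor_approx_in[OF r]) simp
    qed
  qed
  moreover have "(LINT r|lebesgue_on {0..b}. ?s n r) = (\<Sum>k\<in>{0..\<lfloor>real (Suc n) * b\<rfloor>}. F (of_int k / real (Suc n)) * (LINT r|lebesgue_on {0..b}. w r * indicator (floor_cell n k) r))" for n
    using wi by (subst Bochner_Integration.integral_sum) auto
  ultimately show ?thesis by simp
qed

text \<open>The Riemann sums involve finitely many values of \<open>F\<close> and integrals of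
  \<open>w\<close> over Borel sets. Thus joint measurability in the random and the real variable
  never enters, and \<open>w\<close> may be a random element of L2.\<close>

lemma pairing_measurable:
  fixes w F :: "'a \<Rightarrow> real \<Rightarrow> real"
  assumes w: "\<And>\<omega>. \<omega> \<in> space M \<Longrightarrow> integrable (lebesgue_on {0..b}) (w \<omega>)"
    and wm: "\<And>J. J \<in> sets borel \<Longrightarrow> (\<lambda>\<omega>. LINT r|lebesgue_on {0..b}. w \<omega> r * indicator J r) \<in> borel_measurable M"
    and F: "\<And>\<omega>. \<omega> \<in> space M \<Longrightarrow> continuous_on {0..b} (F \<omega>)"
    and Fm: "\<And>r. r \<in> {0..b} \<Longrightarrow> (\<lambda>\<omega>. F \<omega> r) \<in> borel_measurable M"
  shows "(\<lambda>\<omega>. LINT r|lebesgue_on {0..b}. w \<omega> r * F \<omega> r) \<in> borel_measurable M"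
proof (rule borel_measurable_LIMSEQ_real)
  show "(\<lambda>n. \<Sum>k\<in>{0..\<lfloor>real (Suc n) * b\<rfloor>}. F \<omega> (of_int k / real (Suc n)) * (LINT r|lebesgue_on {0..b}. w \<omega> r * indicator (floor_cell n k) r))
    \<longlonglongrightarrow> (LINT r|lebesgue_on {0..b}. w \<omega> r * F \<omega> r)" if "\<omega> \<in> space M" for \<omega>
    by (rule weighted_Riemann_sum_tendsto[OF w[OF that] F[OF that]])
  show "(\<lambda>\<omega>. \<Sum>k\<in>{0..\<lfloor>real (Suc n) * b\<rfloor>}. F \<omega> (of_int k / real (Suc n)) * (LINT r|lebesgue_on {0..b}. w \<omega> r * indicator (floor_cell n k) r)) \<in> borel_measurable M" for n
  proof (intro borel_measurable_sum borel_measurable_times wm floor_cell_borel Fm)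
    fix k assume k: "k \<in> {0..\<lfloor>real (Suc n) * b\<rfloor>}"
    then have "of_int k \<le> real (Suc n) * b" by (simp add: le_floor_iff del: of_nat_Suc)
    then show "of_int k / real (Suc n) \<in> {0..b}" using k by (simp add: pos_divide_le_eq mult.commute del: of_nat_Suc)
  qed
qed

lemma deterministic_pairing_measurable:
  fixes w :: "real \<Rightarrow> real" and F :: "'a \<Rightarrow> real \<Rightarrow> real"
  assumes "integrable (lebesgue_on {0..b}) w"
    and "\<And>\<omega>. \<omega> \<in> space M \<Longrightarrow> continuous_on {0..b} (F \<omega>)"
    and "\<And>r. r \<in> {0..b} \<Longrightarrow> (\<lambda>\<omega>. F \<omega> r) \<in> borel_measurable M"
  shows "(\<lambda>\<omega>. LINT r|lebesgue_on {0..b}. w r * F \<omega> r) \<in> borel_measurable M"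
  by (rule pairing_measurable) (use assms in auto)

lemma random_L2_norm_measurable:
  assumes "random_L2 M X"
  shows "(\<lambda>\<omega>. L2_norm (X \<omega>)) \<in> borel_measurable M"
  using assms L2_const[of 0] unfolding random_L2_def by fastforce

text \<open>Polarisation: the inner product is a combination of three squared norms, and distances
  are measurable by definition.\<close>

lemma random_L2_inner_measurable:
  assumes X: "random_L2 M X" and h: "h \<in> L2"
  shows "(\<lambda>\<omega>. LINT x|lebesgue_on {0..1}. X \<omega> x * h x) \<in> borel_measurable M"
proof -
  have "(\<lambda>\<omega>. ((L2_norm (X \<omega>))\<^sup>2 + (L2_norm h)\<^sup>2 - (L2_norm (\<lambda>x. X \<omega> x - h x))\<^sup>2) / 2) \<in> borel_measurable M"
    using X h random_L2_norm_measurable[OF X]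
    by (intro borel_measurable_divide borel_measurable_diff borel_measurable_add borel_measurable_power borel_measurable_const)
       (auto simp: random_L2_def)
  moreover have "((L2_norm (X \<omega>))\<^sup>2 + (L2_norm h)\<^sup>2 - (L2_norm (\<lambda>x. X \<omega> x - h x))\<^sup>2) / 2 = (LINT x|lebesgue_on {0..1}. X \<omega> x * h x)"
    if "\<omega> \<in> space M" for \<omega>
  proof -
    have Xw: "X \<omega> \<in> L2" using X that by (simp add: random_L2_def)
    have "(L2_norm (\<lambda>x. X \<omega> x - h x))\<^sup>2 = (L2_norm (X \<omega>))\<^sup>2 + (L2_norm h)\<^sup>2 - 2 * (LINT x|lebesgue_on {0..1}. X \<omega> x * h x)"
      using L2_square_integrable[OF Xw] L2_square_integrable[OF h] L2_mult_integrable[OF Xw h]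
      by (simp add: L2_norm_square power2_diff mult.assoc)
    then show ?thesis by simp
  qed
  ultimately show ?thesis by (rule measurable_cong[THEN iffD1, rotated])
qed

lemma indicator_L2: "J \<in> sets borel \<Longrightarrow> indicator J \<in> L2"
  unfolding L2_def using integrable_mult_indicator_on[OF L2_integrable[OF L2_const[of 1]], of J]
  by (auto intro!: indicator_lebesgue_on_measurable simp: power2_eq_square indicator_inter_arith[symmetric])

text \<open>In the expanded square of the distance to \<open>h\<close>, the cross term pairs an L2
  function with a continuous one, which is the situation of
  \<open>pairing_measurable\<close>.\<close>

lemma random_L2_add_random_C:
  assumes X: "random_L2 M X" and c: "random_C M c"
  shows "random_L2 M (\<lambda>\<omega> x. X \<omega> x + c \<omega> x)"
  unfolding random_L2_def
proof (intro conjI ballI)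
  have cc: "continuous_on {0..1} (c \<omega>)" if "\<omega> \<in> space M" for \<omega> using c that by (simp add: random_C_def)
  have cm: "(\<lambda>\<omega>. c \<omega> x) \<in> borel_measurable M" if "x \<in> {0..1}" for x using c that by (simp add: random_C_def)
  have XL: "X \<omega> \<in> L2" if "\<omega> \<in> space M" for \<omega> using X that by (simp add: random_L2_def)
  show "(\<lambda>x. X \<omega> x + c \<omega> x) \<in> L2" if "\<omega> \<in> space M" for \<omega>
    by (intro L2_add XL L2_continuous cc that)
  fix h assume h: "h \<in> L2"
  have "(\<lambda>\<omega>. LINT x|lebesgue_on {0..1}. (X \<omega> x - h x) * c \<omega> x) \<in> borel_measurable M"
  proof (rule pairing_measurable)
    show "integrable (lebesgue_on {0..1}) (\<lambda>x. X \<omega> x - h x)" if "\<omega> \<in> space M" for \<omega>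
      by (intro L2_integrable L2_diff XL h that)
    fix J :: "real set" assume J: "J \<in> sets borel"
    have "(\<lambda>\<omega>. (LINT x|lebesgue_on {0..1}. X \<omega> x * indicator J x) - (LINT x|lebesgue_on {0..1}. h x * indicator J x)) \<in> borel_measurable M"
      by (intro borel_measurable_diff borel_measurable_const random_L2_inner_measurable[OF X indicator_L2[OF J]])
    moreover have "(LINT x|lebesgue_on {0..1}. X \<omega> x * indicator J x) - (LINT x|lebesgue_on {0..1}. h x * indicator J x)
      = (LINT x|lebesgue_on {0..1}. (X \<omega> x - h x) * indicator J x)" if "\<omega> \<in> space M" for \<omega>
      using L2_mult_integrable[OF XL[OF that] indicator_L2[OF J]] L2_mult_integrable[OF h indicator_L2[OF J]]
      by (simp add: left_diff_distrib)
    ultimately show "(\<lambda>\<omega>. LINT x|lebesgue_on {0..1}. (X \<omega> x - h x) * indicator J x) \<in> borel_measurable M"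
      by (rule measurable_cong[THEN iffD1, rotated])
  qed (use cc cm in auto)
  moreover have "(\<lambda>\<omega>. LINT x|lebesgue_on {0..1}. 1 * (c \<omega> x)\<^sup>2) \<in> borel_measurable M"
    using cc cm by (intro deterministic_pairing_measurable borel_measurable_power continuous_on_power L2_integrable L2_const)
  moreover have "(\<lambda>\<omega>. L2_norm (\<lambda>x. X \<omega> x - h x)) \<in> borel_measurable M" using X h by (simp add: random_L2_def)
  ultimately have "(\<lambda>\<omega>. sqrt ((L2_norm (\<lambda>x. X \<omega> x - h x))\<^sup>2 + 2 * (LINT x|lebesgue_on {0..1}. (X \<omega> x - h x) * c \<omega> x) + (LINT x|lebesgue_on {0..1}. 1 * (c \<omega> x)\<^sup>2))) \<in> borel_measurable M"
    by measurable
  moreover have "sqrt ((L2_norm (\<lambda>x. X \<omega> x - h x))\<^sup>2 + 2 * (LINT x|lebesgue_on {0..1}. (X \<omega> x - h x) * c \<omega> x) + (LINT x|lebesgue_on {0..1}. 1 * (c \<omega> x)\<^sup>2))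
    = L2_norm (\<lambda>x. X \<omega> x + c \<omega> x - h x)" if w: "\<omega> \<in> space M" for \<omega>
  proof -
    have a: "(\<lambda>x. X \<omega> x - h x) \<in> L2" and b: "c \<omega> \<in> L2" by (intro L2_diff XL h w L2_continuous cc)+
    have "(L2_norm (\<lambda>x. X \<omega> x + c \<omega> x - h x))\<^sup>2 = (LINT x|lebesgue_on {0..1}. (X \<omega> x - h x)\<^sup>2 + (c \<omega> x)\<^sup>2 + 2 * ((X \<omega> x - h x) * c \<omega> x))"
      unfolding L2_norm_square by (intro Bochner_Integration.integral_cong refl) (simp add: power2_eq_square algebra_simps)
    also have "\<dots> = (L2_norm (\<lambda>x. X \<omega> x - h x))\<^sup>2 + 2 * (LINT x|lebesgue_on {0..1}. (X \<omega> x - h x) * c \<omega> x) + (LINT x|lebesgue_on {0..1}. 1 * (c \<omega> x)\<^sup>2)"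
      using L2_square_integrable[OF a] L2_square_integrable[OF b] L2_mult_integrable[OF a b] by (simp add: L2_norm_square)
    finally show ?thesis using L2_norm_nonneg by (metis real_sqrt_abs abs_of_nonneg)
  qed
  ultimately show "(\<lambda>\<omega>. L2_norm (\<lambda>x. X \<omega> x + c \<omega> x - h x)) \<in> borel_measurable M"
    by (rule measurable_cong[THEN iffD1, rotated])
qed

section \<open>Measurability of the Picard series\<close>

context drift_kernel
begin

lemma space_op_measurable:
  assumes "\<And>\<omega>. \<omega> \<in> space M \<Longrightarrow> continuous_on {0..1} (f \<omega>)"
    and "\<And>y. y \<in> {0..1} \<Longrightarrow> (\<lambda>\<omega>. f \<omega> y) \<in> borel_measurable M" and x: "x \<in> {0..1}"
  shows "(\<lambda>\<omega>. space_op (f \<omega>) x) \<in> borel_measurable M"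
  unfolding space_op_def
  by (rule deterministic_pairing_measurable[OF L2_integrable[OF A_L2[OF x]]]) (use assms in auto)

lemma Volterra_measurable:
  assumes u: "\<And>\<omega>. \<omega> \<in> space M \<Longrightarrow> u \<omega> \<in> C_L2 \<tau>"
    and um: "\<And>r. r \<in> {0..\<tau>} \<Longrightarrow> (\<lambda>\<omega>. space_op (u \<omega> r) x) \<in> borel_measurable M"
    and x: "x \<in> {0..1}" and s: "s \<in> {0..\<tau>}"
  shows "(\<lambda>\<omega>. Volterra (u \<omega>) s x) \<in> borel_measurable M"
proof -
  have "(\<lambda>\<omega>. LINT r|lebesgue_on {0..s}. 1 * space_op (u \<omega> r) x) \<in> borel_measurable M"
  proof (rule deterministic_pairing_measurable)
    show "continuous_on {0..s} (\<lambda>r. space_op (u \<omega> r) x)" if "\<omega> \<in> space M" for \<omega>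
      using s by (intro continuous_on_subset[OF space_op_continuous[OF u[OF that] x]]) auto
  qed (use um s in \<open>auto simp: integrable_lebesgue_on_Icc\<close>)
  then show ?thesis by (simp add: Volterra_def)
qed

text \<open>Values at points of an L2 initial condition need not be measurable in \<omega>, hence
  the hypothesis on \<open>space_op\<close>. From the first iterate on the functions are continuous
  with measurable values, and the induction can use these.\<close>

lemma Picard_measurable:
  assumes u: "\<And>\<omega>. \<omega> \<in> space M \<Longrightarrow> u \<omega> \<in> C_L2 \<tau>"
    and um: "\<And>r x. r \<in> {0..\<tau>} \<Longrightarrow> x \<in> {0..1} \<Longrightarrow> (\<lambda>\<omega>. space_op (u \<omega> r) x) \<in> borel_measurable M"
  shows "x \<in> {0..1} \<Longrightarrow> s \<in> {0..\<tau>} \<Longrightarrow> (\<lambda>\<omega>. Picard \<alpha> (u \<omega>) (Suc n) s x) \<in> borel_measurable M"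
proof (induction n arbitrary: s x)
  case 0
  then show ?case using Volterra_measurable[OF u um, of x s] by simp
next
  case (Suc n)
  have "(\<lambda>\<omega>. space_op (Picard \<alpha> (u \<omega>) (Suc n) r) x) \<in> borel_measurable M" if "r \<in> {0..\<tau>}" for r
    using Picard_Suc_C_C[OF u] that Suc by (intro space_op_measurable) (auto simp: C_C_def simp del: Picard.simps)
  then have "(\<lambda>\<omega>. Volterra (Picard \<alpha> (u \<omega>) (Suc n)) s x) \<in> borel_measurable M"
    using Suc.prems by (intro Volterra_measurable Picard_C_L2 u) auto
  then show ?case unfolding Picard.simps(2)[of \<alpha> _ "Suc n"] by (intro borel_measurable_times borel_measurable_const)
qed

lemma resolvent_measurable:
  assumes "\<And>\<omega>. \<omega> \<in> space M \<Longrightarrow> u \<omega> \<in> C_L2 \<tau>"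
    and "\<And>r x. r \<in> {0..\<tau>} \<Longrightarrow> x \<in> {0..1} \<Longrightarrow> (\<lambda>\<omega>. space_op (u \<omega> r) x) \<in> borel_measurable M"
    and "x \<in> {0..1}" "s \<in> {0..\<tau>}"
  shows "(\<lambda>\<omega>. resolvent \<alpha> (u \<omega>) s x) \<in> borel_measurable M"
  unfolding resolvent_def by (intro borel_measurable_suminf Picard_measurable assms)

end

section \<open>Two independent fields\<close>

text \<open>Agreement almost surely at the points of a countable dense set extends by continuity to
  the whole rectangle.\<close>

lemma versions_indistinguishable:
  assumes g: "continuous_version M \<tau> \<xi> g" and g': "continuous_version M \<tau> \<xi> g'"
  shows "AE \<omega> in M. \<forall>s\<in>{0..\<tau>}. \<forall>x\<in>{0..1}. g \<omega> s x = g' \<omega> s x"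
proof -
  let ?S = "{0..\<tau>} \<times> {0..1::real}"
  obtain T where T: "countable T" "T \<subseteq> ?S" "?S \<subseteq> closure T"
    using separable[of ?S] by blast
  have "AE \<omega> in M. \<forall>p\<in>T. g \<omega> (fst p) (snd p) = g' \<omega> (fst p) (snd p)"
  proof (subst AE_ball_countable[OF T(1)], rule ballI)
    fix p assume "p \<in> T"
    then have p: "fst p \<in> {0..\<tau>}" "snd p \<in> {0..1}" using T(2) by auto
    have "AE \<omega> in M. g \<omega> (fst p) (snd p) = \<xi> \<omega> (fst p) (snd p)" "AE \<omega> in M. g' \<omega> (fst p) (snd p) = \<xi> \<omega> (fst p) (snd p)"
      using g g' p by (auto simp: continuous_version_def)
    then show "AE \<omega> in M. g \<omega> (fst p) (snd p) = g' \<omega> (fst p) (snd p)" by eventually_elim simp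
  qed
  with AE_space show ?thesis
  proof eventually_elim
    case (elim \<omega>)
    have c: "continuous_on ?S (\<lambda>(s, x). g \<omega> s x)" "continuous_on ?S (\<lambda>(s, x). g' \<omega> s x)"
      using g g' elim(1) by (auto simp: continuous_version_def C_C_iff[symmetric])
    show ?case
    proof (intro ballI)
      fix s x assume "s \<in> {0..\<tau>}" "x \<in> {0..1::real}"
      then have p: "(s, x) \<in> ?S" by simp
      then have "(s, x) \<in> closure T" using T(3) by blast
      then obtain t where t: "\<And>n. t n \<in> T" "t \<longlonglongrightarrow> (s, x)" unfolding closure_sequential by blast
      have tS: "\<forall>\<^sub>F n in sequentially. t n \<in> ?S" using t(1) T(2) by (intro always_eventually) blast
      have "(\<lambda>n. case t n of (s, x) \<Rightarrow> g \<omega> s x) \<longlonglongrightarrow> (case (s, x) of (s, x) \<Rightarrow> g \<omega> s x)"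
        by (rule continuous_on_tendsto_compose[OF c(1) t(2) p tS])
      moreover have "(\<lambda>n. case t n of (s, x) \<Rightarrow> g' \<omega> s x) \<longlonglongrightarrow> (case (s, x) of (s, x) \<Rightarrow> g' \<omega> s x)"
        by (rule continuous_on_tendsto_compose[OF c(2) t(2) p tS])
      moreover have "(case t n of (s, x) \<Rightarrow> g \<omega> s x) = (case t n of (s, x) \<Rightarrow> g' \<omega> s x)" for n
        using elim(2) t(1) by (simp add: split_beta)
      ultimately show "g \<omega> s x = g' \<omega> s x" by (simp add: LIMSEQ_unique)
    qed
  qed
qed

section \<open>Limits along time grids\<close>

lemma Fatou_bound:
  fixes f :: "nat \<Rightarrow> 'a \<Rightarrow> ennreal"
  assumes "\<And>n. f n \<in> borel_measurable M" "\<And>n. (\<integral>\<^sup>+\<omega>. f n \<omega> \<partial>M) \<le> c"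
  shows "(\<integral>\<^sup>+\<omega>. liminf (\<lambda>n. f n \<omega>) \<partial>M) \<le> c"
proof -
  have "(\<integral>\<^sup>+\<omega>. liminf (\<lambda>n. f n \<omega>) \<partial>M) \<le> liminf (\<lambda>n. \<integral>\<^sup>+\<omega>. f n \<omega> \<partial>M)"
    by (rule nn_integral_liminf) (rule assms)
  also have "\<dots> \<le> limsup (\<lambda>n. \<integral>\<^sup>+\<omega>. f n \<omega> \<partial>M)" by (rule Liminf_le_Limsup) simp
  also have "\<dots> \<le> c" by (rule Limsup_bounded) (simp add: assms)
  finally show ?thesis .
qed

lemma liminf_ge_limit:
  fixes f :: "nat \<Rightarrow> ennreal"
  assumes "y \<longlonglongrightarrow> l" "\<And>n. ennreal (y n) \<le> f n"
  shows "ennreal l \<le> liminf f"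
proof -
  have "ennreal l = liminf (\<lambda>n. ennreal (y n))"
    by (rule lim_imp_Liminf[symmetric]) (auto intro!: tendsto_ennrealI assms)
  also have "\<dots> \<le> liminf f" by (rule Liminf_mono) (simp add: assms)
  finally show ?thesis .
qed

text \<open>Cutting off at 1 keeps the points inside the time interval for every index, because
  \<open>Levy_maximal_square\<close> asks for measurability of the whole sequence.\<close>

definition time_grid :: "real \<Rightarrow> nat \<Rightarrow> nat \<Rightarrow> real" where
  "time_grid \<tau> n j = \<tau> * min 1 (real j / real (Suc n))"

lemma time_grid_in: "0 < \<tau> \<Longrightarrow> time_grid \<tau> n j \<in> {0..\<tau>}"
  unfolding time_grid_def by (auto simp: mult_left_le)

lemma time_grid_mono: "0 < \<tau> \<Longrightarrow> i \<le> j \<Longrightarrow> time_grid \<tau> n i \<le> time_grid \<tau> n j"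
  unfolding time_grid_def by (intro mult_left_mono min.mono divide_right_mono) auto

lemma time_grid_last: "time_grid \<tau> n (Suc n) = \<tau>"
  unfolding time_grid_def by simp

lemma time_grid_approx:
  assumes "0 < \<tau>" "s \<in> {0..\<tau>}"
  obtains j where "\<And>n. j n \<le> Suc n" "(\<lambda>n. time_grid \<tau> n (j n)) \<longlonglongrightarrow> s"
proof
  define r where "r = s / \<tau>"
  have r: "r \<in> {0..1}" and s: "s = \<tau> * r" using assms by (auto simp: r_def)
  define j where "j n = nat \<lfloor>real (Suc n) * r\<rfloor>" for n
  have jr: "real (j n) = of_int \<lfloor>real (Suc n) * r\<rfloor>" for n using r by (simp add: j_def del: of_nat_Suc)
  have le: "real (j n) / real (Suc n) \<le> 1" for n using floor_approx_in[OF r, of n] by (simp add: jr)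
  then show "j n \<le> Suc n" for n by (simp add: pos_divide_le_eq del: of_nat_Suc)
  have "(\<lambda>n. time_grid \<tau> n (j n)) = (\<lambda>n. \<tau> * (of_int \<lfloor>real (Suc n) * r\<rfloor> / real (Suc n)))"
    using le unfolding time_grid_def jr by (simp add: fun_eq_iff min_absorb2)
  then show "(\<lambda>n. time_grid \<tau> n (j n)) \<longlonglongrightarrow> s"
    unfolding s using tendsto_mult_left[OF floor_approx_tendsto] by (simp only:)
qed

lemma C_C_time_continuous:
  assumes "u \<in> C_C \<tau>" "x \<in> {0..1}"
  shows "continuous_on {0..\<tau>} (\<lambda>s. u s x)"
  using continuous_on_compose2[OF assms(1)[unfolded C_C_iff], of "{0..\<tau>}" "\<lambda>s. (s, x)"] assms(2)
  by (simp add: continuous_on_Pair image_subset_iff)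

text \<open>The constants \<open>a\<close> and \<open>b\<close> become
  \<open>\<alpha> * \<beta>\<close> and \<open>\<alpha> * \<zeta>\<close>. Applying the maximal
  inequality to the combination at once keeps its variance a plain sum of two terms.\<close>

locale two_gaussian_fields = prob_space M + f2: integrated_gaussian_field M \<tau> \<xi>2 F2 Ka La + f3: integrated_gaussian_field M \<tau> \<xi>3 F3 Kb Lb
  for M :: "'a measure" and \<tau> \<xi>2 F2 Ka La \<xi>3 F3 Kb Lb +
  fixes a b :: real
  assumes indep: "independent_fields M \<tau> \<xi>2 \<xi>3"
begin

definition combined :: "'a \<Rightarrow> real \<Rightarrow> real \<Rightarrow> real" where
  "combined \<omega> s x = a * \<xi>2 \<omega> s x + b * \<xi>3 \<omega> s x"

abbreviation "field_path g \<omega> \<equiv> (\<lambda>p\<in>{0..\<tau>} \<times> {0..1}. g \<omega> (fst p) (snd p) :: real)"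

lemma combined_measurable: "s \<in> {0..\<tau>} \<Longrightarrow> x \<in> {0..1} \<Longrightarrow> (\<lambda>\<omega>. combined \<omega> s x) \<in> borel_measurable M"
  unfolding combined_def using f2.field_measurable f3.field_measurable by simp

lemma indep_functionals:
  assumes "\<phi> \<in> borel_measurable (PiM ({0..\<tau>} \<times> {0..1}) (\<lambda>_. borel))"
    and "\<psi> \<in> borel_measurable (PiM ({0..\<tau>} \<times> {0..1}) (\<lambda>_. borel))"
  shows "indep_var borel (\<lambda>\<omega>. \<phi> (field_path \<xi>2 \<omega>)) borel (\<lambda>\<omega>. \<psi> (field_path \<xi>3 \<omega>))"
  using indep_var_compose[OF indep[unfolded independent_fields_def] assms] by (simp add: o_def)

lemma char_sum:
  assumes "indep_var borel Y borel Z"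
  shows "(CLINT \<omega>|M. iexp (Y \<omega> + Z \<omega>)) = (CLINT \<omega>|M. iexp (Y \<omega>)) * (CLINT \<omega>|M. iexp (Z \<omega>))"
proof -
  have [measurable]: "Y \<in> borel_measurable M" "Z \<in> borel_measurable M"
    using indep_var_rv1[OF assms] indep_var_rv2[OF assms] by auto
  show ?thesis using char_distr_add[OF assms, of 1] by (simp add: char_def integral_distr)
qed

text \<open>Independence factorises the characteristic functions on both sides into those of the two
  fields, and each factor is invariant by \<open>reflection_char\<close>.\<close>

lemma combined_reflection:
  fixes s t :: "nat \<Rightarrow> real"
  assumes s: "\<And>i. i \<le> n \<Longrightarrow> s i \<in> {0..\<tau>}" and mono: "\<And>i. i \<le> k \<Longrightarrow> s i \<le> s k" and kn: "k \<le> n" "s k \<le> s n" and x: "x \<in> {0..1}"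
  shows "(CLINT \<omega>|M. iexp ((\<Sum>i\<le>k. t i * combined \<omega> (s i) x) + c * combined \<omega> (s n) x))
    = (CLINT \<omega>|M. iexp ((\<Sum>i\<le>k. t i * combined \<omega> (s i) x) + c * (2 * combined \<omega> (s k) x - combined \<omega> (s n) x)))"
proof -
  let ?P = "PiM ({0..\<tau>} \<times> {0..1::real}) (\<lambda>_. borel :: real measure)"
  \<comment> \<open>Independence is stated for whole paths, so the exponents are written as
    measurable functionals of a path \<open>f\<close>.\<close>
  define L where "L d f = (\<Sum>i\<le>k. (d * t i) * f (s i, x)) + (d * c) * f (s n, x)" for d :: real and f :: "real \<times> real \<Rightarrow> real"
  define R where "R d f = (\<Sum>i\<le>k. (d * t i) * f (s i, x)) + (d * c) * (2 * f (s k, x) - f (s n, x))" for d :: real and f :: "real \<times> real \<Rightarrow> real"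
  have in1: "(s i, x) \<in> {0..\<tau>} \<times> {0..1}" if "i \<le> n" for i using s[OF that] x by simp
  have cm: "(\<lambda>f. f (s i, x)) \<in> borel_measurable ?P" if "i \<le> n" for i
    by (rule measurable_component_singleton[OF in1[OF that]])
  have Lm: "L d \<in> borel_measurable ?P" for d unfolding L_def
    using kn by (intro borel_measurable_add borel_measurable_sum borel_measurable_times borel_measurable_const cm) auto
  have Rm: "R d \<in> borel_measurable ?P" for d unfolding R_def
    using kn by (intro borel_measurable_add borel_measurable_diff borel_measurable_sum borel_measurable_times borel_measurable_const cm) auto
  have path: "field_path g \<omega> (s i, x) = g \<omega> (s i) x" if "i \<le> n" for g \<omega> i using in1[OF that] by simp
  have sumP: "(\<Sum>i\<le>k. (d * t i) * field_path g \<omega> (s i, x)) = (\<Sum>i\<le>k. (d * t i) * g \<omega> (s i) x)" for d g \<omega>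
    using kn by (intro sum.cong refl) (simp add: in1[simplified])
  have LX: "(\<Sum>i\<le>k. t i * combined \<omega> (s i) x) + c * combined \<omega> (s n) x = L a (field_path \<xi>2 \<omega>) + L b (field_path \<xi>3 \<omega>)" for \<omega>
    unfolding L_def sumP path[OF order_refl] combined_def by (simp add: algebra_simps sum.distrib sum_distrib_left)
  have RX: "(\<Sum>i\<le>k. t i * combined \<omega> (s i) x) + c * (2 * combined \<omega> (s k) x - combined \<omega> (s n) x) = R a (field_path \<xi>2 \<omega>) + R b (field_path \<xi>3 \<omega>)" for \<omega>
    unfolding R_def sumP path[OF order_refl] path[OF kn(1)] combined_def by (simp add: algebra_simps sum.distrib sum_distrib_left)
  have r2: "(CLINT \<omega>|M. iexp (L d (field_path \<xi>2 \<omega>))) = (CLINT \<omega>|M. iexp (R d (field_path \<xi>2 \<omega>)))" for d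
    unfolding L_def R_def sumP path[OF order_refl] path[OF kn(1)] by (rule f2.reflection_char[OF s mono kn x])
  have r3: "(CLINT \<omega>|M. iexp (L d (field_path \<xi>3 \<omega>))) = (CLINT \<omega>|M. iexp (R d (field_path \<xi>3 \<omega>)))" for d
    unfolding L_def R_def sumP path[OF order_refl] path[OF kn(1)] by (rule f3.reflection_char[OF s mono kn x])
  show ?thesis
    unfolding LX RX char_sum[OF indep_functionals[OF Lm Lm]] char_sum[OF indep_functionals[OF Rm Rm]] r2 r3 ..
qed

lemma combined_second_moment:
  assumes x: "x \<in> {0..1}"
  shows "(\<integral>\<^sup>+\<omega>. ennreal ((combined \<omega> \<tau> x)\<^sup>2) \<partial>M)
    = ennreal (a\<^sup>2 * (LINT r|lebesgue_on {0..\<tau>}. F2 r x x) + b\<^sup>2 * (LINT r|lebesgue_on {0..\<tau>}. F3 r x x))"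
proof -
  have t: "\<tau> \<in> {0..\<tau>}" using f2.\<tau> by simp
  have p: "(\<tau>, x) \<in> {0..\<tau>} \<times> {0..1}" using t x by simp
  have i: "indep_var borel (\<lambda>\<omega>. \<xi>2 \<omega> \<tau> x) borel (\<lambda>\<omega>. \<xi>3 \<omega> \<tau> x)"
    using indep_functionals[OF measurable_component_singleton[OF p] measurable_component_singleton[OF p]] p by simp
  note m2 = f2.mean_zero[OF t x] and m3 = f3.mean_zero[OF t x]
  note s2 = f2.second_moment[OF t x t x] and s3 = f3.second_moment[OF t x t x]
  have c: "integrable M (\<lambda>\<omega>. \<xi>2 \<omega> \<tau> x * \<xi>3 \<omega> \<tau> x)" "expectation (\<lambda>\<omega>. \<xi>2 \<omega> \<tau> x * \<xi>3 \<omega> \<tau> x) = 0"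
    using indep_var_integrable[OF i m2(1) m3(1)] indep_var_lebesgue_integral[OF i m2(1) m3(1)] m2 m3 by simp_all
  have e: "(combined \<omega> \<tau> x)\<^sup>2 = a\<^sup>2 * (\<xi>2 \<omega> \<tau> x * \<xi>2 \<omega> \<tau> x) + 2 * a * b * (\<xi>2 \<omega> \<tau> x * \<xi>3 \<omega> \<tau> x) + b\<^sup>2 * (\<xi>3 \<omega> \<tau> x * \<xi>3 \<omega> \<tau> x)" for \<omega>
    unfolding combined_def by (simp add: power2_eq_square algebra_simps)
  have "integrable M (\<lambda>\<omega>. (combined \<omega> \<tau> x)\<^sup>2)" unfolding e using c s2 s3 by simp
  moreover have "expectation (\<lambda>\<omega>. (combined \<omega> \<tau> x)\<^sup>2) = a\<^sup>2 * (LINT r|lebesgue_on {0..\<tau>}. F2 r x x) + b\<^sup>2 * (LINT r|lebesgue_on {0..\<tau>}. F3 r x x)"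
    unfolding e using c s2 s3 by simp
  ultimately show ?thesis by (simp add: nn_integral_eq_integral)
qed

lemma combined_maximal:
  assumes x: "x \<in> {0..1}"
    and v: "a\<^sup>2 * (LINT r|lebesgue_on {0..\<tau>}. F2 r x x) + b\<^sup>2 * (LINT r|lebesgue_on {0..\<tau>}. F3 r x x) \<le> v"
  shows "(\<integral>\<^sup>+\<omega>. ennreal (MAX j\<in>{..Suc n}. (combined \<omega> (time_grid \<tau> n j) x)\<^sup>2) \<partial>M) \<le> 2 * ennreal v"
proof -
  have "(\<integral>\<^sup>+\<omega>. ennreal (MAX j\<in>{..Suc n}. (combined \<omega> (time_grid \<tau> n j) x)\<^sup>2) \<partial>M) \<le> 2 * (\<integral>\<^sup>+\<omega>. ennreal ((combined \<omega> (time_grid \<tau> n (Suc n)) x)\<^sup>2) \<partial>M)"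
  proof (rule Levy_maximal_square[where X="\<lambda>j \<omega>. combined \<omega> (time_grid \<tau> n j) x"])
    show "(\<lambda>\<omega>. combined \<omega> (time_grid \<tau> n j) x) \<in> borel_measurable M" for j
      by (intro combined_measurable time_grid_in x f2.\<tau>)
    show "(CLINT \<omega>|M. iexp ((\<Sum>i\<le>k. t i * combined \<omega> (time_grid \<tau> n i) x) + c * combined \<omega> (time_grid \<tau> n (Suc n)) x))
    = (CLINT \<omega>|M. iexp ((\<Sum>i\<le>k. t i * combined \<omega> (time_grid \<tau> n i) x) + c * (2 * combined \<omega> (time_grid \<tau> n k) x - combined \<omega> (time_grid \<tau> n (Suc n)) x)))"
      if "k \<le> Suc n" for k t c
      by (rule combined_reflection) (use that x f2.\<tau> in \<open>auto intro: time_grid_in time_grid_mono simp del: atLeastAtMost_iff\<close>)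
  qed
  also have "\<dots> \<le> 2 * ennreal v"
    unfolding time_grid_last combined_second_moment[OF x] by (intro mult_left_mono ennreal_leI v) simp
  finally show ?thesis .
qed

end

section \<open>The continuous noise and its maximal inequality\<close>

locale noise_versions = two_gaussian_fields M \<tau> \<xi>2 F2 Ka La \<xi>3 F3 Kb Lb a b
  for M :: "'a measure" and \<tau> \<xi>2 F2 Ka La \<xi>3 F3 Kb Lb a b +
  fixes g2 g3 :: "'a \<Rightarrow> real \<Rightarrow> real \<Rightarrow> real"
  assumes g2: "continuous_version M \<tau> \<xi>2 g2" and g3: "continuous_version M \<tau> \<xi>3 g3"
begin

text \<open>The noise term of the integral equation. The values at time 0 are subtracted because a
  version vanishes there only almost surely.\<close>

definition noise :: "'a \<Rightarrow> real \<Rightarrow> real \<Rightarrow> real" where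
  "noise \<omega> s x = a * (g2 \<omega> s x - g2 \<omega> 0 x) + b * (g3 \<omega> s x - g3 \<omega> 0 x)"

lemma noise_C_C:
  assumes "\<omega> \<in> space M"
  shows "noise \<omega> \<in> C_C \<tau>"
proof -
  have c: "continuous_on ({0..\<tau>} \<times> {0..1}) (\<lambda>p. g \<omega> (fst p) (snd p))"
    "continuous_on ({0..\<tau>} \<times> {0..1}) (\<lambda>p. g \<omega> 0 (snd p))" if "continuous_version M \<tau> \<xi> g" for \<xi> g
  proof -
    show c: "continuous_on ({0..\<tau>} \<times> {0..1}) (\<lambda>p. g \<omega> (fst p) (snd p))"
      using that assms by (simp add: continuous_version_def C_C_iff split_beta)
    show "continuous_on ({0..\<tau>} \<times> {0..1}) (\<lambda>p. g \<omega> 0 (snd p))"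
    proof -
      have "continuous_on ({0..\<tau>} \<times> {0..1}) (\<lambda>p :: real \<times> real. (0 :: real, snd p))" by (intro continuous_intros)
      from continuous_on_compose2[OF c this] show ?thesis using f2.\<tau> by (simp add: image_subset_iff)
    qed
  qed
  show ?thesis unfolding C_C_iff noise_def split_beta by (intro continuous_intros c[OF g2] c[OF g3])
qed

lemma noise_measurable:
  assumes "s \<in> {0..\<tau>}" "x \<in> {0..1}"
  shows "(\<lambda>\<omega>. noise \<omega> s x) \<in> borel_measurable M"
proof -
  have "(0::real) \<in> {0..\<tau>}" using f2.\<tau> by simp
  then have "(\<lambda>\<omega>. g2 \<omega> 0 x) \<in> borel_measurable M" "(\<lambda>\<omega>. g2 \<omega> s x) \<in> borel_measurable M"
      "(\<lambda>\<omega>. g3 \<omega> 0 x) \<in> borel_measurable M" "(\<lambda>\<omega>. g3 \<omega> s x) \<in> borel_measurable M"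
    using g2 g3 assms by (auto simp: continuous_version_def)
  then show ?thesis unfolding noise_def by simp
qed

text \<open>The variance at time 0 is an integral over a single point, so both fields start at 0
  almost surely.\<close>

lemma noise_eq_combined:
  assumes s: "s \<in> {0..\<tau>}" and x: "x \<in> {0..1}"
  shows "AE \<omega> in M. noise \<omega> s x = combined \<omega> s x"
proof -
  have z: "(0::real) \<in> {0..\<tau>}" using f2.\<tau> by simp
  have v0: "AE \<omega> in M. \<xi> \<omega> 0 x = 0" if "integrable M (\<lambda>\<omega>. \<xi> \<omega> 0 x * \<xi> \<omega> 0 x)"
    "expectation (\<lambda>\<omega>. \<xi> \<omega> 0 x * \<xi> \<omega> 0 x) = (LINT r|lebesgue_on {0..min 0 0}. F r x x)"
    for \<xi> :: "'a \<Rightarrow> real \<Rightarrow> real \<Rightarrow> real" and F :: "real \<Rightarrow> real \<Rightarrow> real \<Rightarrow> real"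
  proof -
    have "(LINT r|lebesgue_on {0..min 0 0}. F r x x) = 0"
      using abs_LINT_Icc_le[of 0 0 "\<lambda>r. F r x x" "\<bar>F 0 x x\<bar>"] by simp
    then have "AE \<omega> in M. \<xi> \<omega> 0 x * \<xi> \<omega> 0 x = 0"
      using integral_nonneg_eq_0_iff_AE[OF that(1)] that(2) by simp
    then show ?thesis by simp
  qed
  have "AE \<omega> in M. g2 \<omega> s x = \<xi>2 \<omega> s x" "AE \<omega> in M. g2 \<omega> 0 x = \<xi>2 \<omega> 0 x"
     "AE \<omega> in M. g3 \<omega> s x = \<xi>3 \<omega> s x" "AE \<omega> in M. g3 \<omega> 0 x = \<xi>3 \<omega> 0 x"
    using g2 g3 s x z by (auto simp: continuous_version_def)
  moreover have "AE \<omega> in M. \<xi>2 \<omega> 0 x = 0" by (rule v0) (rule f2.second_moment[OF z x z x])+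
  moreover have "AE \<omega> in M. \<xi>3 \<omega> 0 x = 0" by (rule v0) (rule f3.second_moment[OF z x z x])+
  ultimately show ?thesis by eventually_elim (simp add: noise_def combined_def)
qed

text \<open>Riemann sums in space and grids in time reduce the supremum to finitely many points, so no joint
  measurability of the noise is needed.\<close>

lemma noise_maximal:
  assumes v: "\<And>x. x \<in> {0..1} \<Longrightarrow> a\<^sup>2 * (LINT r|lebesgue_on {0..\<tau>}. F2 r x x) + b\<^sup>2 * (LINT r|lebesgue_on {0..\<tau>}. F3 r x x) \<le> v"
  obtains S where "S \<in> borel_measurable M" "(\<integral>\<^sup>+\<omega>. S \<omega> \<partial>M) \<le> 2 * ennreal v"
    "\<And>\<omega> s. \<omega> \<in> space M \<Longrightarrow> s \<in> {0..\<tau>} \<Longrightarrow> ennreal ((L2_norm (noise \<omega> s))\<^sup>2) \<le> S \<omega>"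
proof -
  define mx where "mx n \<omega> x = (MAX j\<in>{..Suc n}. (noise \<omega> (time_grid \<tau> n j) x)\<^sup>2)" for n \<omega> x
  \<comment> \<open>At each point of space \<open>R\<close> dominates the squared noise at all
    times, by continuity in time, and Fatou's lemma carries the bound from the grids over to
    it.\<close>
  define R where "R \<omega> x = liminf (\<lambda>n. ennreal (mx n \<omega> x))" for \<omega> x
  note \<tau> = f2.\<tau>
  have mxm: "(\<lambda>\<omega>. ennreal (mx n \<omega> x)) \<in> borel_measurable M" if "x \<in> {0..1}" for n x
    unfolding mx_def using noise_measurable[OF time_grid_in[OF \<tau>] that]
    by (intro measurable_compose[OF _ measurable_ennreal] borel_measurable_Max) auto
  have Rm: "(\<lambda>\<omega>. R \<omega> x) \<in> borel_measurable M" if "x \<in> {0..1}" for x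
    unfolding R_def by (intro borel_measurable_liminf mxm that)
  have Rb: "(\<integral>\<^sup>+\<omega>. R \<omega> x \<partial>M) \<le> 2 * ennreal v" if x: "x \<in> {0..1}" for x
    unfolding R_def
  proof (rule Fatou_bound[OF mxm[OF x]])
    fix n
    have "AE \<omega> in M. \<forall>j\<in>{..Suc n}. noise \<omega> (time_grid \<tau> n j) x = combined \<omega> (time_grid \<tau> n j) x"
      by (subst AE_ball_countable) (auto intro!: noise_eq_combined time_grid_in \<tau> x simp del: atLeastAtMost_iff)
    then have "AE \<omega> in M. ennreal (mx n \<omega> x) = ennreal (MAX j\<in>{..Suc n}. (combined \<omega> (time_grid \<tau> n j) x)\<^sup>2)"
      by eventually_elim (simp add: mx_def)
    then show "(\<integral>\<^sup>+\<omega>. ennreal (mx n \<omega> x) \<partial>M) \<le> 2 * ennreal v"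
      using combined_maximal[OF x v[OF x], of n] by (subst nn_integral_cong_AE) auto
  qed
  have le: "ennreal ((noise \<omega> s x)\<^sup>2) \<le> R \<omega> x" if w: "\<omega> \<in> space M" and s: "s \<in> {0..\<tau>}" and x: "x \<in> {0..1}" for \<omega> s x
  proof -
    obtain j where j: "\<And>n. j n \<le> Suc n" "(\<lambda>n. time_grid \<tau> n (j n)) \<longlonglongrightarrow> s" using time_grid_approx[OF \<tau> s] by blast
    have "(\<lambda>n. noise \<omega> (time_grid \<tau> n (j n)) x) \<longlonglongrightarrow> noise \<omega> s x"
      by (rule continuous_on_tendsto_compose[OF C_C_time_continuous[OF noise_C_C[OF w] x] j(2) s]) (use time_grid_in[OF \<tau>] in auto)
    then have "(\<lambda>n. (noise \<omega> (time_grid \<tau> n (j n)) x)\<^sup>2) \<longlonglongrightarrow> (noise \<omega> s x)\<^sup>2" by (rule tendsto_power)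
    then show ?thesis unfolding R_def
    proof (rule liminf_ge_limit)
      show "ennreal ((noise \<omega> (time_grid \<tau> n (j n)) x)\<^sup>2) \<le> ennreal (mx n \<omega> x)" for n
        unfolding mx_def using j(1)[of n] by (intro ennreal_leI Max_ge) auto
    qed
  qed
  \<comment> \<open>The lengths of the cells inside the unit interval. They sum to 1, so averaging
    over them preserves the bound.\<close>
  define c :: "nat \<Rightarrow> int \<Rightarrow> real" where "c n k = (LINT r|lebesgue_on {0..1}. 1 * indicator (floor_cell n k) r)" for n k
  have c0: "0 \<le> c n k" for n k unfolding c_def by (rule integral_nonneg_AE) simp
  define I where "I n = {0..\<lfloor>real (Suc n) * 1\<rfloor>}" for n
  have csum: "(\<Sum>k\<in>I n. c n k) = 1" for n
  proof -
    have i: "integrable (lebesgue_on {0..1}) (\<lambda>r. 1 * indicator (floor_cell n k) r :: real)" for k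
      by (rule integrable_mult_indicator_on[OF _ floor_cell_borel]) (simp add: integrable_lebesgue_on_Icc)
    have "(\<Sum>k\<in>I n. c n k) = (LINT r|lebesgue_on {0..1}. (\<Sum>k\<in>I n. 1 * indicator (floor_cell n k) r))"
      unfolding c_def using i by (intro Bochner_Integration.integral_sum[symmetric]) auto
    also have "\<dots> = (LINT r|lebesgue_on {0..1::real}. 1)"
      using floor_cell_sum[where b=1 and n=n and F="\<lambda>_. 1" and c=1] by (intro Bochner_Integration.integral_cong) (auto simp: I_def simp del: of_nat_Suc)
    also have "\<dots> = 1" by (simp add: measure_restrict_space)
    finally show ?thesis .
  qed
  have Iin: "of_int k / real (Suc n) \<in> {0..1}" if "k \<in> I n" for k n
    using that by (simp add: I_def pos_divide_le_eq le_floor_iff del: of_nat_Suc)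
  define T where "T n \<omega> = (\<Sum>k\<in>I n. R \<omega> (of_int k / real (Suc n)) * ennreal (c n k))" for n \<omega>
  have Tm: "T n \<in> borel_measurable M" for n
    unfolding T_def by (intro borel_measurable_sum borel_measurable_times_ennreal borel_measurable_const Rm Iin)
  show ?thesis
  proof
    show "(\<lambda>\<omega>. liminf (\<lambda>n. T n \<omega>)) \<in> borel_measurable M" by (intro borel_measurable_liminf Tm)
    show "(\<integral>\<^sup>+\<omega>. liminf (\<lambda>n. T n \<omega>) \<partial>M) \<le> 2 * ennreal v"
    proof (rule Fatou_bound[OF Tm])
      fix n
      have "(\<integral>\<^sup>+\<omega>. T n \<omega> \<partial>M) = (\<Sum>k\<in>I n. (\<integral>\<^sup>+\<omega>. R \<omega> (of_int k / real (Suc n)) \<partial>M) * ennreal (c n k))"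
        unfolding T_def using Rm[OF Iin] by (simp add: nn_integral_sum nn_integral_multc del: of_nat_Suc)
      also have "\<dots> \<le> (\<Sum>k\<in>I n. (2 * ennreal v) * ennreal (c n k))" by (intro sum_mono mult_right_mono Rb Iin) auto
      also have "\<dots> = (2 * ennreal v) * ennreal (\<Sum>k\<in>I n. c n k)" by (simp add: sum_distrib_left[symmetric] sum_ennreal c0)
      finally show "(\<integral>\<^sup>+\<omega>. T n \<omega> \<partial>M) \<le> 2 * ennreal v" by (simp add: csum)
    qed
    fix \<omega> s assume w: "\<omega> \<in> space M" and s: "s \<in> {0..\<tau>}"
    have cn: "continuous_on {0..1} (\<lambda>x. (noise \<omega> s x)\<^sup>2)"
      using noise_C_C[OF w] s by (intro continuous_intros) (simp add: C_C_def)
    \<comment> \<open>Convergence is required only for the continuous function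
      \<open>noise \<omega> s\<close>. The sums \<open>T\<close>, whose \<open>R\<close> may be
      irregular in space, are only compared with it term by term.\<close>
    have "(\<lambda>n. \<Sum>k\<in>I n. (noise \<omega> s (of_int k / real (Suc n)))\<^sup>2 * c n k) \<longlonglongrightarrow> (LINT x|lebesgue_on {0..1}. 1 * (noise \<omega> s x)\<^sup>2)"
      unfolding I_def c_def by (rule weighted_Riemann_sum_tendsto[OF _ cn]) (simp add: integrable_lebesgue_on_Icc)
    moreover have "(LINT x|lebesgue_on {0..1}. 1 * (noise \<omega> s x)\<^sup>2) = (L2_norm (noise \<omega> s))\<^sup>2" by (simp add: L2_norm_square)
    moreover have "ennreal (\<Sum>k\<in>I n. (noise \<omega> s (of_int k / real (Suc n)))\<^sup>2 * c n k) \<le> T n \<omega>" for n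
    proof -
      have "ennreal (\<Sum>k\<in>I n. (noise \<omega> s (of_int k / real (Suc n)))\<^sup>2 * c n k) = (\<Sum>k\<in>I n. ennreal ((noise \<omega> s (of_int k / real (Suc n)))\<^sup>2) * ennreal (c n k))"
        using c0 by (simp add: sum_ennreal[symmetric] ennreal_mult del: of_nat_Suc)
      also have "\<dots> \<le> T n \<omega>" unfolding T_def by (intro sum_mono mult_right_mono le w s Iin) auto
      finally show ?thesis .
    qed
    ultimately show "ennreal ((L2_norm (noise \<omega> s))\<^sup>2) \<le> liminf (\<lambda>n. T n \<omega>)" by (intro liminf_ge_limit) auto
  qed
qed

end

section \<open>The stochastic equation\<close>

text \<open>Gronwall's lemma gives the factor \<open>exp (2 * k)\<close>, which for small \<open>k\<close> exceeds
  \<open>exp (4 * k\<^sup>2)\<close>; the excess is at most \<open>exp (1 / 4) \<le> 4 / 3\<close>.\<close>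

lemma growth_constant:
  fixes p c k :: real
  shows "((p + c) * exp k)\<^sup>2 \<le> 4 * (p\<^sup>2 + c\<^sup>2 / 2) * exp (4 * k\<^sup>2)"
proof -
  \<comment> \<open>The difference of the two sides is half the square of
    \<open>2 * p - c\<close>.\<close>
  have "(p + c)\<^sup>2 \<le> 3 * (p\<^sup>2 + c\<^sup>2 / 2)"
    using zero_le_power2[of "2 * p - c"] by (simp add: power2_eq_square algebra_simps)
  moreover have "(exp k)\<^sup>2 \<le> 4 / 3 * exp (4 * k\<^sup>2)"
  proof -
    have "exp (- (1/4)) \<ge> 1 + - (1/4 :: real)" by (rule exp_ge_add_one_self)
    then have "exp (1/4 :: real) \<le> 4 / 3" by (simp add: exp_minus field_simps)
    have "2 * k \<le> 4 * k\<^sup>2 + 1/4" using zero_le_power2[of "2 * k - 1/2"] by (simp add: power2_eq_square algebra_simps)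
    then have "exp (2 * k) \<le> exp (4 * k\<^sup>2) * exp (1/4)" by (simp add: exp_add[symmetric])
    also have "\<dots> \<le> exp (4 * k\<^sup>2) * (4 / 3)" using \<open>exp (1/4) \<le> 4 / 3\<close> by (intro mult_left_mono) auto
    finally show ?thesis by (simp add: exp_double)
  qed
  ultimately have "(p + c)\<^sup>2 * (exp k)\<^sup>2 \<le> (3 * (p\<^sup>2 + c\<^sup>2 / 2)) * (4 / 3 * exp (4 * k\<^sup>2))"
    by (intro mult_mono) auto
  also have "\<dots> = 4 * (p\<^sup>2 + c\<^sup>2 / 2) * exp (4 * k\<^sup>2)" by simp
  finally show ?thesis by (simp only: power_mult_distrib)
qed

lemma random_C_add:
  assumes "random_C M X" "random_C M Y"
  shows "random_C M (\<lambda>\<omega> x. X \<omega> x + Y \<omega> x)"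
  using assms unfolding random_C_def by (intro conjI ballI continuous_on_add borel_measurable_add) blast+

locale linear_sde = noise_versions M \<tau> \<xi>2 F2 Ka La \<xi>3 F3 Kb Lb "\<alpha> * \<beta>" "\<alpha> * \<zeta>" g2 g3 + drift_kernel A C2 C3 \<tau>
  for M :: "'a measure" and \<tau> \<xi>2 F2 Ka La \<xi>3 F3 Kb Lb \<alpha> \<beta> \<zeta> g2 g3 A C2 C3 +
  assumes \<alpha>: "0 \<le> \<alpha>"
begin

lemma sde_rhs_eq: "sde_rhs \<alpha> \<beta> \<zeta> A u0 u (g2 \<omega>) (g3 \<omega>) s x = u0 x - \<alpha> * Volterra u s x + noise \<omega> s x"
  by (simp add: sde_rhs_def Volterra_def space_op_def noise_def)

definition base :: "('a \<Rightarrow> real \<Rightarrow> real) \<Rightarrow> 'a \<Rightarrow> real \<Rightarrow> real \<Rightarrow> real" where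
  "base U0 \<omega> s x = U0 \<omega> x + noise \<omega> s x"

text \<open>The bracket is a random continuous function even when \<open>U0\<close> is merely square
  integrable; this is the splitting that \<open>random_L2_add_random_C\<close> expects.\<close>

definition sol :: "('a \<Rightarrow> real \<Rightarrow> real) \<Rightarrow> 'a \<Rightarrow> real \<Rightarrow> real \<Rightarrow> real" where
  "sol U0 \<omega> s x = U0 \<omega> x + (noise \<omega> s x + resolvent \<alpha> (base U0 \<omega>) s x)"

lemma noise_L2: "\<omega> \<in> space M \<Longrightarrow> s \<in> {0..\<tau>} \<Longrightarrow> noise \<omega> s \<in> L2"
  using noise_C_C by (intro L2_continuous) (auto simp: C_C_def)

section \<open>Pathwise solutions for continuous and square-integrable initial values\<close>

context
  fixes U0 :: "'a \<Rightarrow> real \<Rightarrow> real"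
  assumes U0: "\<And>\<omega>. \<omega> \<in> space M \<Longrightarrow> U0 \<omega> \<in> L2"
    and U0m: "\<And>x. x \<in> {0..1} \<Longrightarrow> (\<lambda>\<omega>. space_op (U0 \<omega>) x) \<in> borel_measurable M"
begin

lemma base_C_L2:
  assumes "\<omega> \<in> space M"
  shows "base U0 \<omega> \<in> C_L2 \<tau>"
proof -
  have "(\<lambda>s x. U0 \<omega> x + 1 * noise \<omega> s x) \<in> C_L2 \<tau>"
    by (intro C_L2_add C_L2_const U0 C_C_imp_C_L2 noise_C_C assms)
  then show ?thesis by (simp add: base_def[abs_def])
qed

lemma base_measurable:
  assumes r: "r \<in> {0..\<tau>}" and x: "x \<in> {0..1}"
  shows "(\<lambda>\<omega>. space_op (base U0 \<omega> r) x) \<in> borel_measurable M"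
proof -
  have "(\<lambda>\<omega>. space_op (U0 \<omega>) x + 1 * space_op (noise \<omega> r) x) \<in> borel_measurable M"
    using noise_C_C r by (intro borel_measurable_add borel_measurable_times borel_measurable_const U0m x space_op_measurable noise_measurable)
      (auto simp: C_C_def)
  moreover have "space_op (U0 \<omega>) x + 1 * space_op (noise \<omega> r) x = space_op (base U0 \<omega> r) x" if "\<omega> \<in> space M" for \<omega>
    using space_op_add[OF x U0[OF that] noise_L2[OF that r], of 1] by (simp add: base_def[abs_def])
  ultimately show ?thesis by (rule measurable_cong[THEN iffD1, rotated])
qed

lemma correction_random_C:
  assumes s: "s \<in> {0..\<tau>}"
  shows "random_C M (\<lambda>\<omega> x. noise \<omega> s x + resolvent \<alpha> (base U0 \<omega>) s x)"
  unfolding random_C_def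
proof (intro conjI ballI)
  show "continuous_on {0..1} (\<lambda>x. noise \<omega> s x + resolvent \<alpha> (base U0 \<omega>) s x)" if "\<omega> \<in> space M" for \<omega>
    using noise_C_C[OF that] resolvent_C_C_eq(1)[OF base_C_L2[OF that] \<alpha>] s
    by (intro continuous_on_add) (auto simp: C_C_def)
  show "(\<lambda>\<omega>. noise \<omega> s x + resolvent \<alpha> (base U0 \<omega>) s x) \<in> borel_measurable M" if "x \<in> {0..1}" for x
    by (intro borel_measurable_add noise_measurable resolvent_measurable base_C_L2 base_measurable s that)
qed

lemma correction_C_C:
  assumes "\<omega> \<in> space M"
  shows "(\<lambda>s x. noise \<omega> s x + resolvent \<alpha> (base U0 \<omega>) s x) \<in> C_C \<tau>"
  using C_C_lincomb[OF noise_C_C[OF assms] resolvent_C_C_eq(1)[OF base_C_L2[OF assms] \<alpha>], of 1 1] by simp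

lemma sol_C_L2:
  assumes "\<omega> \<in> space M"
  shows "sol U0 \<omega> \<in> C_L2 \<tau>"
  using C_L2_add[OF C_L2_const[OF U0[OF assms]] C_C_imp_C_L2[OF correction_C_C[OF assms]], of 1]
  by (simp add: sol_def[abs_def])

lemma sol_eq:
  assumes w: "\<omega> \<in> space M" and s: "s \<in> {0..\<tau>}" and x: "x \<in> {0..1}"
  shows "sol U0 \<omega> s x = U0 \<omega> x - \<alpha> * Volterra (sol U0 \<omega>) s x + noise \<omega> s x"
proof -
  have "(\<lambda>r y. base U0 \<omega> r y + resolvent \<alpha> (base U0 \<omega>) r y) = sol U0 \<omega>"
    by (auto simp: base_def sol_def fun_eq_iff)
  then have "resolvent \<alpha> (base U0 \<omega>) s x = - \<alpha> * Volterra (sol U0 \<omega>) s x"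
    using resolvent_C_C_eq(2)[OF base_C_L2[OF w] \<alpha> s x] by simp
  then show ?thesis by (simp add: sol_def)
qed

lemma sol_unique:
  assumes w: "\<omega> \<in> space M" and V: "V \<in> C_L2 \<tau>"
    and eq: "\<And>s. s \<in> {0..\<tau>} \<Longrightarrow> AE x in lebesgue_on {0..1}. V s x = U0 \<omega> x - \<alpha> * Volterra V s x + noise \<omega> s x"
    and s: "s \<in> {0..\<tau>}" and x: "x \<in> {0..1}"
  shows "Volterra V s x = Volterra (sol U0 \<omega>) s x"
proof (rule Volterra_unique[OF V sol_C_L2[OF w] \<alpha> _ s x])
  fix s assume s: "s \<in> {0..\<tau>}"
  have "AE x in lebesgue_on {0..1}. x \<in> {0..1::real}" by (rule AE_I2) simp
  with eq[OF s] show "AE x in lebesgue_on {0..1}. V s x - sol U0 \<omega> s x = - \<alpha> * (Volterra V s x - Volterra (sol U0 \<omega>) s x)"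
  proof eventually_elim
    case (elim x)
    then show ?case using sol_eq[OF w s elim(2)] by (simp add: algebra_simps)
  qed
qed

end

text \<open>A competing solution may use other versions of the noises, and its trajectory depends on
  \<omega>. Therefore the exceptional null set must be the same for all \<open>u0\<close> and
  \<open>u\<close>, which indistinguishability provides.\<close>

lemma sde_rhs_versions:
  assumes g: "continuous_version M \<tau> \<xi>2 g2'" "continuous_version M \<tau> \<xi>3 g3'"
  shows "AE \<omega> in M. \<forall>u0 u. \<forall>s\<in>{0..\<tau>}. \<forall>x\<in>{0..1}. sde_rhs \<alpha> \<beta> \<zeta> A u0 u (g2' \<omega>) (g3' \<omega>) s x
    = u0 x - \<alpha> * Volterra u s x + noise \<omega> s x"
  using versions_indistinguishable[OF g(1) g2] versions_indistinguishable[OF g(2) g3]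
proof eventually_elim
  case (elim \<omega>)
  have z: "(0::real) \<in> {0..\<tau>}" using \<tau> by simp
  show ?case
  proof (intro allI ballI)
    fix u0 u s x assume "s \<in> {0..\<tau>}" "x \<in> {0..1::real}"
    then have "g2' \<omega> s x = g2 \<omega> s x" "g2' \<omega> 0 x = g2 \<omega> 0 x" "g3' \<omega> s x = g3 \<omega> s x" "g3' \<omega> 0 x = g3 \<omega> 0 x"
      using elim z by blast+
    then show "sde_rhs \<alpha> \<beta> \<zeta> A u0 u (g2' \<omega>) (g3' \<omega>) s x = u0 x - \<alpha> * Volterra u s x + noise \<omega> s x"
      unfolding sde_rhs_eq[symmetric] by (simp add: sde_rhs_def)
  qed
qed

theorem solution_C_exists_unique:
  assumes U0: "random_C M U0"
  shows "\<exists>U. solution_C M \<tau> \<alpha> \<beta> \<zeta> A \<xi>2 \<xi>3 U0 U \<and>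
    (\<forall>V. solution_C M \<tau> \<alpha> \<beta> \<zeta> A \<xi>2 \<xi>3 U0 V \<longrightarrow> (AE \<omega> in M. \<forall>s\<in>{0..\<tau>}. \<forall>x\<in>{0..1}. V \<omega> s x = U \<omega> s x))"
proof (intro exI[of _ "sol U0"] conjI allI impI)
  have L: "U0 \<omega> \<in> L2" if "\<omega> \<in> space M" for \<omega> using U0 that by (intro L2_continuous) (simp add: random_C_def)
  have m: "(\<lambda>\<omega>. space_op (U0 \<omega>) x) \<in> borel_measurable M" if "x \<in> {0..1}" for x
    using U0 that by (intro space_op_measurable) (auto simp: random_C_def)
  note facts = L m
  have U0c: "continuous_on ({0..\<tau>} \<times> {0..1}) (\<lambda>p. U0 \<omega> (snd p))" if "\<omega> \<in> space M" for \<omega>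
    by (rule continuous_on_compose2[of "{0..1}" "U0 \<omega>"]) (use U0 that in \<open>auto simp: random_C_def intro!: continuous_intros\<close>)
  show "solution_C M \<tau> \<alpha> \<beta> \<zeta> A \<xi>2 \<xi>3 U0 (sol U0)"
    unfolding solution_C_def
  proof (intro conjI ballI)
    show "sol U0 \<omega> \<in> C_C \<tau>" if "\<omega> \<in> space M" for \<omega>
      using correction_C_C[OF facts that] U0c[OF that] unfolding C_C_iff sol_def split_beta by (rule continuous_on_add[rotated])
    show "random_C M (\<lambda>\<omega>. sol U0 \<omega> s)" if "s \<in> {0..\<tau>}" for s
      unfolding sol_def by (rule random_C_add[OF U0 correction_random_C[OF facts that]])
    have eq: "AE \<omega> in M. \<forall>s\<in>{0..\<tau>}. \<forall>x\<in>{0..1}. sol U0 \<omega> s x = sde_rhs \<alpha> \<beta> \<zeta> A (U0 \<omega>) (sol U0 \<omega>) (g2 \<omega>) (g3 \<omega>) s x"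
      unfolding sde_rhs_eq by (intro AE_I2 ballI sol_eq[OF facts])
    show "\<exists>g2 g3. continuous_version M \<tau> \<xi>2 g2 \<and> continuous_version M \<tau> \<xi>3 g3 \<and>
      (AE \<omega> in M. \<forall>s\<in>{0..\<tau>}. \<forall>x\<in>{0..1}. sol U0 \<omega> s x = sde_rhs \<alpha> \<beta> \<zeta> A (U0 \<omega>) (sol U0 \<omega>) (g2 \<omega>) (g3 \<omega>) s x)"
      using g2 g3 eq by blast
  qed
  fix V assume V: "solution_C M \<tau> \<alpha> \<beta> \<zeta> A \<xi>2 \<xi>3 U0 V"
  then obtain g2' g3' where g': "continuous_version M \<tau> \<xi>2 g2'" "continuous_version M \<tau> \<xi>3 g3'"
    and eq: "AE \<omega> in M. \<forall>s\<in>{0..\<tau>}. \<forall>x\<in>{0..1}. V \<omega> s x = sde_rhs \<alpha> \<beta> \<zeta> A (U0 \<omega>) (V \<omega>) (g2' \<omega>) (g3' \<omega>) s x"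
    unfolding solution_C_def by blast
  show "AE \<omega> in M. \<forall>s\<in>{0..\<tau>}. \<forall>x\<in>{0..1}. V \<omega> s x = sol U0 \<omega> s x"
    using AE_space eq sde_rhs_versions[OF g']
  proof eventually_elim
    case (elim \<omega>)
    have V\<omega>: "V \<omega> \<in> C_L2 \<tau>" using V elim(1) by (intro C_C_imp_C_L2) (simp add: solution_C_def)
    have e: "V \<omega> s x = U0 \<omega> x - \<alpha> * Volterra (V \<omega>) s x + noise \<omega> s x" if "s \<in> {0..\<tau>}" "x \<in> {0..1}" for s x
      using elim that by simp
    show ?case
    proof (intro ballI)
      fix s x assume sx: "s \<in> {0..\<tau>}" "x \<in> {0..1::real}"
      have "Volterra (V \<omega>) s x = Volterra (sol U0 \<omega>) s x"
        by (rule sol_unique[OF facts elim(1) V\<omega> AE_I2 sx]) (auto intro: e)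
      then show "V \<omega> s x = sol U0 \<omega> s x" using e[OF sx] sol_eq[OF facts elim(1) sx] by simp
    qed
  qed
qed

text \<open>\<open>Volterra_growth\<close> is used with the square root of \<open>S\<close> as bound
  of the noise; the factor 1/2 from \<open>growth_constant\<close> then cancels the 2 in the
  integral of \<open>S\<close>. The supremum over uncountably many times is majorised by a
  measurable function before that function's integral is computed.\<close>

lemma sol_maximal_bound:
  assumes U0: "random_L2 M U0"
    and L: "\<And>\<omega>. \<omega> \<in> space M \<Longrightarrow> U0 \<omega> \<in> L2"
    and m: "\<And>x. x \<in> {0..1} \<Longrightarrow> (\<lambda>\<omega>. space_op (U0 \<omega>) x) \<in> borel_measurable M"
    and v: "\<And>x. x \<in> {0..1} \<Longrightarrow> (\<alpha> * \<beta>)\<^sup>2 * (LINT r|lebesgue_on {0..\<tau>}. F2 r x x) + (\<alpha> * \<zeta>)\<^sup>2 * (LINT r|lebesgue_on {0..\<tau>}. F3 r x x) \<le> v"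
  shows "(\<integral>\<^sup>+\<omega>. (SUP s\<in>{0..\<tau>}. ennreal ((L2_norm (sol U0 \<omega> s))\<^sup>2)) \<partial>M)
    \<le> 4 * ((\<integral>\<^sup>+\<omega>. ennreal ((L2_norm (U0 \<omega>))\<^sup>2) \<partial>M) + ennreal v) * ennreal (exp (4 * C2\<^sup>2 * \<alpha>\<^sup>2 * \<tau>\<^sup>2))"
proof -
  define e where "e = exp (4 * C2\<^sup>2 * \<alpha>\<^sup>2 * \<tau>\<^sup>2)"
  have e0: "0 < e" by (simp add: e_def)
  obtain S where Sm [measurable]: "S \<in> borel_measurable M" and Si: "(\<integral>\<^sup>+\<omega>. S \<omega> \<partial>M) \<le> 2 * ennreal v"
    and Sle: "\<And>\<omega> s. \<omega> \<in> space M \<Longrightarrow> s \<in> {0..\<tau>} \<Longrightarrow> ennreal ((L2_norm (noise \<omega> s))\<^sup>2) \<le> S \<omega>"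
    using noise_maximal[OF v] by blast
  have [measurable]: "(\<lambda>\<omega>. L2_norm (U0 \<omega>)) \<in> borel_measurable M" by (rule random_L2_norm_measurable[OF U0])
  have pt: "(SUP s\<in>{0..\<tau>}. ennreal ((L2_norm (sol U0 \<omega> s))\<^sup>2)) \<le> 4 * (ennreal ((L2_norm (U0 \<omega>))\<^sup>2) + ennreal (1/2) * S \<omega>) * ennreal e"
    if w: "\<omega> \<in> space M" for \<omega>
  proof (cases "S \<omega> = \<top>")
    case True
    then have "4 * (ennreal ((L2_norm (U0 \<omega>))\<^sup>2) + ennreal (1/2) * S \<omega>) * ennreal e = \<top>"
      using e0 by (simp add: ennreal_mult_top ennreal_top_mult)
    then show ?thesis by simp
  next
    case False
    then obtain q where q: "0 \<le> q" "S \<omega> = ennreal q" by (cases "S \<omega>") auto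
    have nq: "L2_norm (noise \<omega> s) \<le> sqrt q" if "s \<in> {0..\<tau>}" for s
      using Sle[OF w that] q by (intro real_le_rsqrt) simp
    show ?thesis
    proof (rule SUP_least)
      fix s assume s: "s \<in> {0..\<tau>}"
      have "L2_norm (sol U0 \<omega> s) \<le> (L2_norm (U0 \<omega>) + sqrt q) * exp (\<alpha> * C2 * \<tau>)"
        by (rule Volterra_growth[OF sol_C_L2[OF L m w] \<alpha> L[OF w] C_C_imp_C_L2[OF noise_C_C[OF w]] nq _ s])
           (auto intro!: AE_I2 sol_eq[OF L m w])
      then have "(L2_norm (sol U0 \<omega> s))\<^sup>2 \<le> ((L2_norm (U0 \<omega>) + sqrt q) * exp (\<alpha> * C2 * \<tau>))\<^sup>2"
        by (intro power_mono L2_norm_nonneg)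
      also have "\<dots> \<le> 4 * ((L2_norm (U0 \<omega>))\<^sup>2 + (sqrt q)\<^sup>2 / 2) * exp (4 * (\<alpha> * C2 * \<tau>)\<^sup>2)" by (rule growth_constant)
      also have "\<dots> = 4 * ((L2_norm (U0 \<omega>))\<^sup>2 + 1/2 * q) * e" using q by (simp add: e_def power_mult_distrib mult_ac)
      finally have "ennreal ((L2_norm (sol U0 \<omega> s))\<^sup>2) \<le> ennreal (4 * ((L2_norm (U0 \<omega>))\<^sup>2 + 1/2 * q) * e)" by (rule ennreal_leI)
      also have "\<dots> = 4 * (ennreal ((L2_norm (U0 \<omega>))\<^sup>2) + ennreal (1/2) * ennreal q) * ennreal e"
      proof -
        have "ennreal (4 * (p + 1/2 * q) * e) = ennreal 4 * (ennreal p + ennreal (1/2) * ennreal q) * ennreal e" if "0 \<le> p" for p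
          using q e0 that by (simp only: ennreal_mult ennreal_plus mult_nonneg_nonneg add_nonneg_nonneg less_imp_le
              zero_le_numeral zero_le_divide_1_iff)
        from this[of "(L2_norm (U0 \<omega>))\<^sup>2"] show ?thesis by simp
      qed
      finally show "ennreal ((L2_norm (sol U0 \<omega> s))\<^sup>2) \<le> 4 * (ennreal ((L2_norm (U0 \<omega>))\<^sup>2) + ennreal (1/2) * S \<omega>) * ennreal e"
        using q by simp
    qed
  qed
  have "(\<integral>\<^sup>+\<omega>. (SUP s\<in>{0..\<tau>}. ennreal ((L2_norm (sol U0 \<omega> s))\<^sup>2)) \<partial>M)
    \<le> (\<integral>\<^sup>+\<omega>. 4 * (ennreal ((L2_norm (U0 \<omega>))\<^sup>2) + ennreal (1/2) * S \<omega>) * ennreal e \<partial>M)"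
    by (intro nn_integral_mono pt)
  also have "\<dots> = 4 * ((\<integral>\<^sup>+\<omega>. ennreal ((L2_norm (U0 \<omega>))\<^sup>2) \<partial>M) + ennreal (1/2) * (\<integral>\<^sup>+\<omega>. S \<omega> \<partial>M)) * ennreal e"
    by (simp add: nn_integral_multc nn_integral_cmult nn_integral_add del: ennreal_half)
  also have "\<dots> \<le> 4 * ((\<integral>\<^sup>+\<omega>. ennreal ((L2_norm (U0 \<omega>))\<^sup>2) \<partial>M) + ennreal (1/2) * (2 * ennreal v)) * ennreal e"
    by (intro mult_right_mono mult_left_mono add_left_mono Si) auto
  also have "ennreal (1/2) * (2 * ennreal v) = ennreal v"
  proof -
    have "ennreal (1/2) * (2 * ennreal v) = (ennreal (1/2) * ennreal 2) * ennreal v" by (simp add: mult.assoc)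
    also have "ennreal (1/2) * ennreal 2 = 1" by (subst ennreal_mult[symmetric]) auto
    finally show ?thesis by simp
  qed
  finally show ?thesis by (simp add: e_def)
qed

theorem solution_L2_exists_unique:
  assumes U0: "random_L2 M U0"
    and v: "\<And>x. x \<in> {0..1} \<Longrightarrow> (\<alpha> * \<beta>)\<^sup>2 * (LINT r|lebesgue_on {0..\<tau>}. F2 r x x) + (\<alpha> * \<zeta>)\<^sup>2 * (LINT r|lebesgue_on {0..\<tau>}. F3 r x x) \<le> v"
  shows "\<exists>U. solution_L2 M \<tau> \<alpha> \<beta> \<zeta> A \<xi>2 \<xi>3 U0 U \<and>
    (\<forall>V. solution_L2 M \<tau> \<alpha> \<beta> \<zeta> A \<xi>2 \<xi>3 U0 V \<longrightarrow> (AE \<omega> in M. \<forall>s\<in>{0..\<tau>}. AE x in lebesgue_on {0..1}. V \<omega> s x = U \<omega> s x)) \<and>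
    (\<integral>\<^sup>+\<omega>. (SUP s\<in>{0..\<tau>}. ennreal ((L2_norm (U \<omega> s))\<^sup>2)) \<partial>M)
      \<le> 4 * ((\<integral>\<^sup>+\<omega>. ennreal ((L2_norm (U0 \<omega>))\<^sup>2) \<partial>M) + ennreal v) * ennreal (exp (4 * C2\<^sup>2 * \<alpha>\<^sup>2 * \<tau>\<^sup>2))"
proof (intro exI[of _ "sol U0"] conjI allI impI)
  have L: "U0 \<omega> \<in> L2" if "\<omega> \<in> space M" for \<omega> using U0 that by (simp add: random_L2_def)
  have m: "(\<lambda>\<omega>. space_op (U0 \<omega>) x) \<in> borel_measurable M" if "x \<in> {0..1}" for x
    using random_L2_inner_measurable[OF U0 A_L2[OF that]] by (simp add: space_op_def mult.commute)
  note facts = L m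
  show "(\<integral>\<^sup>+\<omega>. (SUP s\<in>{0..\<tau>}. ennreal ((L2_norm (sol U0 \<omega> s))\<^sup>2)) \<partial>M)
      \<le> 4 * ((\<integral>\<^sup>+\<omega>. ennreal ((L2_norm (U0 \<omega>))\<^sup>2) \<partial>M) + ennreal v) * ennreal (exp (4 * C2\<^sup>2 * \<alpha>\<^sup>2 * \<tau>\<^sup>2))"
    by (rule sol_maximal_bound[OF U0 facts v])
  show "solution_L2 M \<tau> \<alpha> \<beta> \<zeta> A \<xi>2 \<xi>3 U0 (sol U0)"
    unfolding solution_L2_def
  proof (intro conjI ballI)
    show "sol U0 \<omega> \<in> C_L2 \<tau>" if "\<omega> \<in> space M" for \<omega> by (rule sol_C_L2[OF facts that])
    show "random_L2 M (\<lambda>\<omega>. sol U0 \<omega> s)" if "s \<in> {0..\<tau>}" for s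
      using random_L2_add_random_C[OF U0 correction_random_C[OF facts that]] by (simp add: sol_def[abs_def])
    have eq: "AE \<omega> in M. \<forall>s\<in>{0..\<tau>}. AE x in lebesgue_on {0..1}. sol U0 \<omega> s x = sde_rhs \<alpha> \<beta> \<zeta> A (U0 \<omega>) (sol U0 \<omega>) (g2 \<omega>) (g3 \<omega>) s x"
      unfolding sde_rhs_eq by (intro AE_I2 ballI sol_eq[OF facts]) auto
    show "\<exists>g2 g3. continuous_version M \<tau> \<xi>2 g2 \<and> continuous_version M \<tau> \<xi>3 g3 \<and>
      (AE \<omega> in M. \<forall>s\<in>{0..\<tau>}. AE x in lebesgue_on {0..1}. sol U0 \<omega> s x = sde_rhs \<alpha> \<beta> \<zeta> A (U0 \<omega>) (sol U0 \<omega>) (g2 \<omega>) (g3 \<omega>) s x)"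
      using g2 g3 eq by blast
  qed
  fix V assume V: "solution_L2 M \<tau> \<alpha> \<beta> \<zeta> A \<xi>2 \<xi>3 U0 V"
  then obtain g2' g3' where g': "continuous_version M \<tau> \<xi>2 g2'" "continuous_version M \<tau> \<xi>3 g3'"
    and eq: "AE \<omega> in M. \<forall>s\<in>{0..\<tau>}. AE x in lebesgue_on {0..1}. V \<omega> s x = sde_rhs \<alpha> \<beta> \<zeta> A (U0 \<omega>) (V \<omega>) (g2' \<omega>) (g3' \<omega>) s x"
    unfolding solution_L2_def by blast
  have in1: "AE x in lebesgue_on {0..1}. x \<in> {0..1::real}" by (rule AE_I2) simp
  show "AE \<omega> in M. \<forall>s\<in>{0..\<tau>}. AE x in lebesgue_on {0..1}. V \<omega> s x = sol U0 \<omega> s x"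
    using AE_space eq sde_rhs_versions[OF g']
  proof eventually_elim
    case (elim \<omega>)
    have V\<omega>: "V \<omega> \<in> C_L2 \<tau>" using V elim(1) by (simp add: solution_L2_def)
    have e: "AE x in lebesgue_on {0..1}. V \<omega> s x = U0 \<omega> x - \<alpha> * Volterra (V \<omega>) s x + noise \<omega> s x" if s: "s \<in> {0..\<tau>}" for s
    proof -
      have "AE x in lebesgue_on {0..1}. V \<omega> s x = sde_rhs \<alpha> \<beta> \<zeta> A (U0 \<omega>) (V \<omega>) (g2' \<omega>) (g3' \<omega>) s x" using elim(2) s by blast
      with in1 show ?thesis by eventually_elim (use elim(3) s in simp)
    qed
    show ?case
    proof (intro ballI)
      fix s assume s: "s \<in> {0..\<tau>}"
      show "AE x in lebesgue_on {0..1}. V \<omega> s x = sol U0 \<omega> s x"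
        using in1 e[OF s]
      proof eventually_elim
        case (elim x)
        have "Volterra (V \<omega>) s x = Volterra (sol U0 \<omega>) s x"
          by (rule sol_unique[OF facts \<open>\<omega> \<in> space M\<close> V\<omega> e s elim(1)])
        then show ?case using elim(2) sol_eq[OF facts \<open>\<omega> \<in> space M\<close> s elim(1)] by simp
      qed
    qed
  qed
qed

end

section \<open>The covariance kernels of the two noises\<close>

lemma continuous_on_pair_compose:
  assumes "continuous_on D (\<lambda>(x, y). k x y)" "continuous_on T f" "continuous_on T h" "\<And>t. t \<in> T \<Longrightarrow> (f t, h t) \<in> D"
  shows "continuous_on T (\<lambda>t. k (f t) (h t))"
  using continuous_on_compose2[OF assms(1) continuous_on_Pair[OF assms(2,3)]] assms(4) by auto

text \<open>The quadratic form of \<theta> with kernel \<open>g\<close>. The order of integration is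
  that of the covariance of \<xi>3, so this covariance folds into it as it stands.\<close>

definition double_form :: "(real \<Rightarrow> real) \<Rightarrow> (real \<Rightarrow> real \<Rightarrow> real) \<Rightarrow> real" where
  "double_form \<theta> g = (LINT z2|lebesgue_on {0..1}. (LINT z1|lebesgue_on {0..1}. \<theta> z1 * \<theta> z2 * g z1 z2))"

lemma double_form_bound:
  assumes \<theta>: "continuous_on {0..1} \<theta>" and g: "continuous_on ({0..1} \<times> {0..1}) (\<lambda>(z1, z2). g z1 z2)"
    and c: "\<And>z1 z2. z1 \<in> {0..1} \<Longrightarrow> z2 \<in> {0..1} \<Longrightarrow> \<bar>g z1 z2\<bar> \<le> c"
  shows "\<bar>double_form \<theta> g\<bar> \<le> c * (L2_norm \<theta>)\<^sup>2"
proof -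
  have \<theta>L: "\<theta> \<in> L2" by (rule L2_continuous[OF \<theta>])
  have c0: "0 \<le> c" using c[of 0 0] by auto
  have "\<bar>double_form \<theta> g\<bar> \<le> (LINT z2|lebesgue_on {0..1}. \<bar>LINT z1|lebesgue_on {0..1}. \<theta> z1 * \<theta> z2 * g z1 z2\<bar>)"
    unfolding double_form_def by (rule integral_abs_bound)
  also have "\<dots> \<le> (LINT z2|lebesgue_on {0..1}. c * L2_norm \<theta> * \<bar>\<theta> z2\<bar>)"
  proof (rule integral_mono')
    show "integrable (lebesgue_on {0..1}) (\<lambda>z2. c * L2_norm \<theta> * \<bar>\<theta> z2\<bar>)"
      by (intro integrable_mult_right L2_integrable L2_abs \<theta>L)
    show "0 \<le> c * L2_norm \<theta> * \<bar>\<theta> z2\<bar>" for z2 using c0 L2_norm_nonneg by simp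
    fix z2 assume "z2 \<in> space (lebesgue_on {0..1::real})"
    then have z2: "z2 \<in> {0..1}" by simp
    have "continuous_on {0..1} (\<lambda>z1. g z1 z2)"
      using continuous_on_compose2[OF g, of "{0..1}" "\<lambda>z1. (z1, z2)"] z2 by (simp add: continuous_on_Pair image_subset_iff)
    then have "(\<lambda>z1. \<theta> z2 * g z1 z2) \<in> L2" by (intro L2_cmult L2_continuous)
    from kernel_bound[OF this _ \<theta>L, of "\<bar>\<theta> z2\<bar> * c"]
    have "\<bar>LINT z1|lebesgue_on {0..1}. (\<theta> z2 * g z1 z2) * \<theta> z1\<bar> \<le> \<bar>\<theta> z2\<bar> * c * L2_norm \<theta>"
      using c z2 by (simp add: abs_mult mult_left_mono)
    then show "\<bar>LINT z1|lebesgue_on {0..1}. \<theta> z1 * \<theta> z2 * g z1 z2\<bar> \<le> c * L2_norm \<theta> * \<bar>\<theta> z2\<bar>" by (simp add: mult_ac)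
  qed
  also have "\<dots> = c * L2_norm \<theta> * (LINT z2|lebesgue_on {0..1}. \<bar>\<theta> z2\<bar>)" by simp
  also have "\<dots> \<le> c * L2_norm \<theta> * L2_norm \<theta>"
    using c0 L2_norm_nonneg by (intro mult_left_mono L1_le_L2_norm[OF \<theta>L]) simp
  finally show ?thesis by (simp add: power2_eq_square mult.assoc)
qed

lemma double_form_diff:
  assumes \<theta>: "continuous_on {0..1} \<theta>"
    and g: "continuous_on ({0..1} \<times> {0..1}) (\<lambda>(z1, z2). g z1 z2)" and h: "continuous_on ({0..1} \<times> {0..1}) (\<lambda>(z1, z2). h z1 z2)"
  shows "double_form \<theta> g - double_form \<theta> h = double_form \<theta> (\<lambda>z1 z2. g z1 z2 - h z1 z2)"
proof -
  have i: "integrable (lebesgue_on {0..1}) (\<lambda>z1. \<theta> z1 * \<theta> z2 * k z1 z2)" if "z2 \<in> {0..1}"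
      and k: "continuous_on ({0..1} \<times> {0..1}) (\<lambda>(z1, z2). k z1 z2)" for k z2
    by (intro integrable_lebesgue_on_Icc continuous_on_mult \<theta> continuous_on_const continuous_on_pair_compose[OF k] continuous_on_id)
       (use that in auto)
  have o: "integrable (lebesgue_on {0..1}) (\<lambda>z2. LINT z1|lebesgue_on {0..1}. \<theta> z1 * \<theta> z2 * k z1 z2)"
      if k: "continuous_on ({0..1} \<times> {0..1}) (\<lambda>(z1, z2). k z1 z2)" for k
  proof (intro integrable_lebesgue_on_Icc continuous_on_LINT_param)
    have "continuous_on ({0..1} \<times> {0..1}) (\<lambda>p. k (snd p) (fst p))"
      by (rule continuous_on_pair_compose[OF k]) (auto intro!: continuous_intros)
    moreover have "continuous_on ({0..1} \<times> {0..1}) (\<lambda>p. \<theta> (snd p))" "continuous_on ({0..1} \<times> {0..1}) (\<lambda>p. \<theta> (fst p))"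
      by (rule continuous_on_compose2[OF \<theta>]; auto intro!: continuous_intros)+
    ultimately show "continuous_on ({0..1} \<times> {0..1}) (\<lambda>(z2, z1). \<theta> z1 * \<theta> z2 * k z1 z2)"
      unfolding split_beta by (intro continuous_intros)
  qed
  have "double_form \<theta> g - double_form \<theta> h
    = (LINT z2|lebesgue_on {0..1}. (LINT z1|lebesgue_on {0..1}. \<theta> z1 * \<theta> z2 * g z1 z2) - (LINT z1|lebesgue_on {0..1}. \<theta> z1 * \<theta> z2 * h z1 z2))"
    unfolding double_form_def using o[OF g] o[OF h] by simp
  also have "\<dots> = double_form \<theta> (\<lambda>z1 z2. g z1 z2 - h z1 z2)"
    unfolding double_form_def
  proof (rule Bochner_Integration.integral_cong[OF refl])
    fix z2 assume "z2 \<in> space (lebesgue_on {0..1::real})"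
    then have z2: "z2 \<in> {0..1}" by simp
    show "(LINT z1|lebesgue_on {0..1}. \<theta> z1 * \<theta> z2 * g z1 z2) - (LINT z1|lebesgue_on {0..1}. \<theta> z1 * \<theta> z2 * h z1 z2)
      = (LINT z1|lebesgue_on {0..1}. \<theta> z1 * \<theta> z2 * (g z1 z2 - h z1 z2))"
      using i[OF z2 g] i[OF z2 h] by (simp add: right_diff_distrib)
  qed
  finally show ?thesis .
qed

lemma double_form_continuous:
  assumes \<Theta>: "\<Theta> \<in> C_C \<tau>" and g: "continuous_on ({0..1} \<times> {0..1}) (\<lambda>(z1, z2). g z1 z2)"
  shows "continuous_on {0..\<tau>} (\<lambda>r. double_form (\<Theta> r) g)"
  unfolding double_form_def
proof (intro continuous_on_LINT_param)
  have "continuous_on ({0..\<tau>} \<times> {0..1}) (\<lambda>p. LINT z1|lebesgue_on {0..1}. \<Theta> (fst p) z1 * \<Theta> (fst p) (snd p) * g z1 (snd p))"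
  proof (rule continuous_on_LINT_param)
    let ?D = "({0..\<tau>} \<times> {0..1}) \<times> {0..1::real}"
    note c\<Theta> = \<Theta>[unfolded C_C_iff]
    have "continuous_on ?D (\<lambda>q. \<Theta> (fst (fst q)) (snd q))"
      by (rule continuous_on_pair_compose[OF c\<Theta>]) (auto intro!: continuous_intros)
    moreover have "continuous_on ?D (\<lambda>q. \<Theta> (fst (fst q)) (snd (fst q)))"
      by (rule continuous_on_pair_compose[OF c\<Theta>]) (auto intro!: continuous_intros)
    moreover have "continuous_on ?D (\<lambda>q. g (snd q) (snd (fst q)))"
      by (rule continuous_on_pair_compose[OF g]) (auto intro!: continuous_intros)
    ultimately show "continuous_on ?D (\<lambda>(p, z1). \<Theta> (fst p) z1 * \<Theta> (fst p) (snd p) * g z1 (snd p))"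
      unfolding split_beta by (intro continuous_intros)
  qed
  then show "continuous_on ({0..\<tau>} \<times> {0..1}) (\<lambda>(r, z2). LINT z1|lebesgue_on {0..1}. \<Theta> r z1 * \<Theta> r z2 * g z1 z2)"
    by (simp add: split_beta)
qed

lemma smooth_A_drift_kernel:
  assumes "smooth_A A C2 C3 C4" "0 < \<tau>"
  shows "drift_kernel A C2 C3 \<tau>"
proof
  show "continuous_on {0..1} (A x)" if "x \<in> {0..1}" for x
  proof -
    obtain f' where "\<forall>y\<in>{0..1}. (A x has_real_derivative f' y) (at y within {0..1})"
      using assms(1) \<open>x \<in> {0..1}\<close> unfolding smooth_A_def C1_on_unit_def by blast
    then show ?thesis by (meson DERIV_continuous continuous_on_eq_continuous_within)
  qed
qed (use assms in \<open>auto simp: smooth_A_def\<close>)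

text \<open>The smaller time is the length of the interval of integration, so the kernel is constant
  in time.\<close>

lemma integrated_gaussian_field_of_kernel:
  assumes "prob_space M" "0 < \<tau>" "symmetric2 A" "smooth_A A C2 C3 C4"
    and "gaussian_random_field_process M \<tau> \<xi>" "centered_field M \<tau> \<xi>"
    and cov: "has_covariance M \<tau> \<xi> (\<lambda>s1 x s2 y. min s1 s2 * A x y)"
  shows "integrated_gaussian_field M \<tau> \<xi> (\<lambda>r x y. A x y) C2 C3"
proof -
  interpret prob_space M by fact
  interpret K: drift_kernel A C2 C3 \<tau> by (rule smooth_A_drift_kernel) fact+
  show ?thesis
  proof
    show "has_covariance M \<tau> \<xi> (\<lambda>s1 x s2 y. LINT r|lebesgue_on {0..min s1 s2}. A x y)"
      using cov by (auto simp: has_covariance_def measure_restrict_space)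
    show "\<bar>A x y - A x y'\<bar> \<le> C3 * \<bar>y - y'\<bar>" if "x \<in> {0..1}" "y \<in> {0..1}" "y' \<in> {0..1}" for x y y'
      using K.A_Lip[OF that(2,3,1)] \<open>symmetric2 A\<close> that by (simp add: symmetric2_def)
  qed (use assms K.A_bound K.A_Lip K.C3_nonneg in auto)
qed

text \<open>The form is linear in its kernel, so the Lipschitz bounds of \<open>Btilde\<close> carry
  over with the factor \<open>D\<^sup>2\<close>, a bound of the squared norms of \<Theta>. The
  sharper estimate with the norm at time \<open>s\<close> is returned separately, for it produces
  the integral over \<Theta> in the theorem.\<close>

lemma integrated_gaussian_field_of_double_form:
  assumes "prob_space M" "0 < \<tau>" "symmetric2 A" "smooth_A A C2 C3 C4" "smooth_B B C5 C6 C7"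
    and mf: "moment_functions N W A B E" and \<Theta>: "\<Theta> \<in> C_C \<tau>"
    and "gaussian_random_field_process M \<tau> \<xi>" "centered_field M \<tau> \<xi>"
    and cov: "has_covariance M \<tau> \<xi> (\<lambda>s1 x s2 y. LINT s|lebesgue_on {0..min s1 s2}.
      double_form (\<Theta> s) (\<lambda>z1 z2. Btilde A B x z1 y z2))"
  obtains K L where "integrated_gaussian_field M \<tau> \<xi> (\<lambda>s x y. double_form (\<Theta> s) (\<lambda>z1 z2. Btilde A B x z1 y z2)) K L"
    "\<And>s x y. s \<in> {0..\<tau>} \<Longrightarrow> x \<in> {0..1} \<Longrightarrow> y \<in> {0..1} \<Longrightarrow>
      \<bar>double_form (\<Theta> s) (\<lambda>z1 z2. Btilde A B x z1 y z2)\<bar> \<le> (C5 + C2\<^sup>2) * (L2_norm (\<Theta> s))\<^sup>2"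
proof -
  interpret prob_space M by fact
  let ?G = "\<lambda>x y z1 z2. Btilde A B x z1 y z2"
  define l where "l = \<bar>(C7^4 + 3 * C5) / 4 + C3 * C2\<bar>"
  obtain D where D: "\<And>s. s \<in> {0..\<tau>} \<Longrightarrow> L2_norm (\<Theta> s) \<le> D"
    using C_L2_norm_bounded[OF C_C_imp_C_L2[OF \<Theta>]] by blast
  have D2: "(L2_norm (\<Theta> s))\<^sup>2 \<le> D\<^sup>2" if "s \<in> {0..\<tau>}" for s by (intro power_mono D that L2_norm_nonneg)
  have \<theta>: "continuous_on {0..1} (\<Theta> s)" if "s \<in> {0..\<tau>}" for s using \<Theta> that by (simp add: C_C_def)
  have Gc: "continuous_on ({0..1} \<times> {0..1}) (\<lambda>(z1, z2). ?G x y z1 z2)" if "x \<in> {0..1}" "y \<in> {0..1}" for x y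
  proof -
    have "continuous_on ({0..1} \<times> {0..1}) (\<lambda>p :: real \<times> real. (x, fst p, y, snd p))" by (intro continuous_intros)
    from continuous_on_compose2[OF Btilde_continuous[OF mf assms(3-5)] this] that
    show ?thesis by (simp add: split_beta image_subset_iff)
  qed
  have Gb: "\<bar>?G x y z1 z2\<bar> \<le> C5 + C2\<^sup>2" if "x \<in> {0..1}" "y \<in> {0..1}" "z1 \<in> {0..1}" "z2 \<in> {0..1}" for x y z1 z2
    by (rule Btilde_bound[OF mf assms(4,5)]) fact+
  have Lip1: "\<bar>?G x y z1 z2 - ?G x' y z1 z2\<bar> \<le> l * \<bar>x - x'\<bar>"
    if "x \<in> {0..1}" "x' \<in> {0..1}" "y \<in> {0..1}" "z1 \<in> {0..1}" "z2 \<in> {0..1}" for x x' y z1 z2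
    unfolding l_def
    by (rule order_trans[OF Btilde_Lipschitz1[OF mf assms(4,5)] mult_right_mono[OF abs_ge_self abs_ge_zero]]) fact+
  have Lip2: "\<bar>?G x y z1 z2 - ?G x y' z1 z2\<bar> \<le> l * \<bar>y - y'\<bar>"
    if "x \<in> {0..1}" "y \<in> {0..1}" "y' \<in> {0..1}" "z1 \<in> {0..1}" "z2 \<in> {0..1}" for x y y' z1 z2
    using Lip1[of y y' x z2 z1] Btilde_symmetric(2)[OF mf assms(3), of x z1 y z2] Btilde_symmetric(2)[OF mf assms(3), of x z1 y' z2] that
    by simp
  have b: "\<bar>double_form (\<Theta> s) (?G x y)\<bar> \<le> (C5 + C2\<^sup>2) * (L2_norm (\<Theta> s))\<^sup>2"
    if "s \<in> {0..\<tau>}" "x \<in> {0..1}" "y \<in> {0..1}" for s x y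
    using that by (intro double_form_bound \<theta> Gc Gb)
  have diff: "\<bar>double_form (\<Theta> s) (?G x y) - double_form (\<Theta> s) (?G x' y')\<bar> \<le> (l * D\<^sup>2) * d"
    if s: "s \<in> {0..\<tau>}" and xy: "x \<in> {0..1}" "y \<in> {0..1}" "x' \<in> {0..1}" "y' \<in> {0..1}" and d: "0 \<le> d"
      and le: "\<And>z1 z2. z1 \<in> {0..1} \<Longrightarrow> z2 \<in> {0..1} \<Longrightarrow> \<bar>?G x y z1 z2 - ?G x' y' z1 z2\<bar> \<le> l * d" for s x y x' y' d
  proof -
    have "continuous_on ({0..1} \<times> {0..1}) (\<lambda>(z1, z2). ?G x y z1 z2 - ?G x' y' z1 z2)"
      using Gc[OF xy(1,2)] Gc[OF xy(3,4)] unfolding split_beta by (rule continuous_on_diff)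
    then have "\<bar>double_form (\<Theta> s) (?G x y) - double_form (\<Theta> s) (?G x' y')\<bar> \<le> (l * d) * (L2_norm (\<Theta> s))\<^sup>2"
      unfolding double_form_diff[OF \<theta>[OF s] Gc[OF xy(1,2)] Gc[OF xy(3,4)]] by (rule double_form_bound[OF \<theta>[OF s]]) (rule le)
    also have "\<dots> \<le> (l * d) * D\<^sup>2" using d by (intro mult_left_mono D2 s) (simp add: l_def)
    finally show ?thesis by (simp add: mult_ac)
  qed
  have "0 \<le> C5 + C2\<^sup>2" using Gb[of 0 0 0 0] by auto
  show ?thesis
  proof
    show "integrated_gaussian_field M \<tau> \<xi> (\<lambda>s x y. double_form (\<Theta> s) (?G x y)) ((C5 + C2\<^sup>2) * D\<^sup>2) (l * D\<^sup>2)"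
    proof
      show "continuous_on {0..\<tau>} (\<lambda>r. double_form (\<Theta> r) (?G x y))" if "x \<in> {0..1}" "y \<in> {0..1}" for x y
        by (rule double_form_continuous[OF \<Theta> Gc[OF that]])
      show "\<bar>double_form (\<Theta> r) (?G x y)\<bar> \<le> (C5 + C2\<^sup>2) * D\<^sup>2" if "r \<in> {0..\<tau>}" "x \<in> {0..1}" "y \<in> {0..1}" for r x y
        using b[OF that] mult_left_mono[OF D2[OF that(1)] \<open>0 \<le> C5 + C2\<^sup>2\<close>] by linarith
      show "\<bar>double_form (\<Theta> r) (?G x y) - double_form (\<Theta> r) (?G x' y)\<bar> \<le> l * D\<^sup>2 * \<bar>x - x'\<bar>"
        if "r \<in> {0..\<tau>}" "x \<in> {0..1}" "x' \<in> {0..1}" "y \<in> {0..1}" for r x x' y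
        using that by (intro diff Lip1) auto
      show "\<bar>double_form (\<Theta> r) (?G x y) - double_form (\<Theta> r) (?G x y')\<bar> \<le> l * D\<^sup>2 * \<bar>y - y'\<bar>"
        if "r \<in> {0..\<tau>}" "x \<in> {0..1}" "y \<in> {0..1}" "y' \<in> {0..1}" for r x y y'
        using that by (intro diff Lip2) auto
    qed (use assms in \<open>auto simp: l_def\<close>)
  qed (rule b)
qed

theorem theorem3p6:
  fixes \<tau> \<alpha> \<beta> \<zeta> C2 C3 C4 C5 C6 C7 C8 C9 :: real
    and A :: "real \<Rightarrow> real \<Rightarrow> real"
    and B :: "real \<Rightarrow> real \<Rightarrow> real \<Rightarrow> real \<Rightarrow> real"
    and E :: "real \<Rightarrow> real \<Rightarrow> real \<Rightarrow> real \<Rightarrow> real \<Rightarrow> real \<Rightarrow> real \<Rightarrow> real \<Rightarrow> real"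
    and N :: "'b measure" and W :: "'b \<Rightarrow> real \<Rightarrow> real \<Rightarrow> real"
    and M :: "'a measure" and \<xi>2 \<xi>3 :: "'a \<Rightarrow> real \<Rightarrow> real \<Rightarrow> real"
    and \<Theta> :: "real \<Rightarrow> real \<Rightarrow> real"
  assumes "\<tau> > 0"
    and "symmetric2 A" and "symmetric4 B" and "symmetric8 E"
    and "moment_functions N W A B E"
    and "smooth_A A C2 C3 C4" and "smooth_B B C5 C6 C7" and "smooth_E E C8 C9"
    and "\<alpha> > 0" and "\<beta> \<ge> 0" and "\<zeta> \<ge> 0"
    and "solves_theta \<tau> \<alpha> A \<Theta>"
    and "prob_space M"
    and "gaussian_random_field_process M \<tau> \<xi>2" and "centered_field M \<tau> \<xi>2"
    and "gaussian_random_field_process M \<tau> \<xi>3" and "centered_field M \<tau> \<xi>3"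
    and "independent_fields M \<tau> \<xi>2 \<xi>3"
    and "has_covariance M \<tau> \<xi>2 (\<lambda>s1 x s2 y. min s1 s2 * A x y)"
    and "has_covariance M \<tau> \<xi>3 (\<lambda>s1 x s2 y.
           LINT s|lebesgue_on {0..min s1 s2}. (LINT z2|lebesgue_on {0..1}.
             (LINT z1|lebesgue_on {0..1}. \<Theta> s z1 * \<Theta> s z2 * Btilde A B x z1 y z2)))"
  shows "(\<forall>U0. random_C M U0 \<longrightarrow>
      (\<exists>U. solution_C M \<tau> \<alpha> \<beta> \<zeta> A \<xi>2 \<xi>3 U0 U \<and>
        (\<forall>V. solution_C M \<tau> \<alpha> \<beta> \<zeta> A \<xi>2 \<xi>3 U0 V \<longrightarrow>
          (AE \<omega> in M. \<forall>s\<in>{0..\<tau>}. \<forall>x\<in>{0..1}. V \<omega> s x = U \<omega> s x)))) \<and>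
    (\<forall>U0. random_L2 M U0 \<longrightarrow>
      (\<exists>U. solution_L2 M \<tau> \<alpha> \<beta> \<zeta> A \<xi>2 \<xi>3 U0 U \<and>
        (\<forall>V. solution_L2 M \<tau> \<alpha> \<beta> \<zeta> A \<xi>2 \<xi>3 U0 V \<longrightarrow>
          (AE \<omega> in M. \<forall>s\<in>{0..\<tau>}. AE x in lebesgue_on {0..1}. V \<omega> s x = U \<omega> s x)) \<and>
        (\<integral>\<^sup>+\<omega>. (SUP s\<in>{0..\<tau>}. ennreal ((L2_norm (U \<omega> s))^2)) \<partial>M)
          \<le> 4 * ((\<integral>\<^sup>+\<omega>. ennreal ((L2_norm (U0 \<omega>))^2) \<partial>M)
                 + ennreal (C2 * \<alpha>^2 * \<beta>^2 * \<tau>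
                     + (C5 + C2^2) * \<alpha>^2 * \<zeta>^2
                       * (LINT s|lebesgue_on {0..\<tau>}. (L2_norm (\<Theta> s))^2)))
              * ennreal (exp (4 * C2^2 * \<alpha>^2 * \<tau>^2))))"
proof -
  note asm = assms
  interpret prob_space M by fact
  have \<Theta>: "\<Theta> \<in> C_C \<tau>" using asm(12) by (simp add: solves_theta_def)
  let ?F3 = "\<lambda>s x y. double_form (\<Theta> s) (\<lambda>z1 z2. Btilde A B x z1 y z2)"
  obtain K L where field3: "integrated_gaussian_field M \<tau> \<xi>3 ?F3 K L"
    and F3: "\<And>s x y. s \<in> {0..\<tau>} \<Longrightarrow> x \<in> {0..1} \<Longrightarrow> y \<in> {0..1} \<Longrightarrow> \<bar>?F3 s x y\<bar> \<le> (C5 + C2\<^sup>2) * (L2_norm (\<Theta> s))\<^sup>2"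
    by (rule integrated_gaussian_field_of_double_form[OF asm(13,1,2,6,7,5) \<Theta> asm(16,17) asm(20)[folded double_form_def]]) blast
  interpret fields: two_gaussian_fields M \<tau> \<xi>2 "\<lambda>r x y. A x y" C2 C3 \<xi>3 ?F3 K L "\<alpha> * \<beta>" "\<alpha> * \<zeta>"
    by (intro two_gaussian_fields.intro two_gaussian_fields_axioms.intro field3 asm(13,18)
        integrated_gaussian_field_of_kernel[OF asm(13,1,2,6,14,15,19)])
  obtain g2 g3 where g: "continuous_version M \<tau> \<xi>2 g2" "continuous_version M \<tau> \<xi>3 g3"
    using fields.f2.continuous_version_exists fields.f3.continuous_version_exists by blast
  interpret linear_sde M \<tau> \<xi>2 "\<lambda>r x y. A x y" C2 C3 \<xi>3 ?F3 K L \<alpha> \<beta> \<zeta> g2 g3 A C2 C3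
    by (intro linear_sde.intro noise_versions.intro noise_versions_axioms.intro linear_sde_axioms.intro
        fields.two_gaussian_fields_axioms g smooth_A_drift_kernel[OF asm(6,1)] less_imp_le[OF asm(9)])
  \<comment> \<open>The left side is the variance of the combined noise at the final time. Its bound
    is uniform in space and is the noise part of the asserted estimate.\<close>
  have v: "(\<alpha> * \<beta>)\<^sup>2 * (LINT r|lebesgue_on {0..\<tau>}. A x x) + (\<alpha> * \<zeta>)\<^sup>2 * (LINT r|lebesgue_on {0..\<tau>}. ?F3 r x x)
    \<le> C2 * \<alpha>\<^sup>2 * \<beta>\<^sup>2 * \<tau> + (C5 + C2\<^sup>2) * \<alpha>\<^sup>2 * \<zeta>\<^sup>2 * (LINT s|lebesgue_on {0..\<tau>}. (L2_norm (\<Theta> s))\<^sup>2)"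
    if x: "x \<in> {0..1}" for x
  proof -
    have "(LINT r|lebesgue_on {0..\<tau>}. A x x) \<le> C2 * \<tau>"
      using abs_LINT_Icc_le[of 0 \<tau> "\<lambda>_. A x x" C2] A_bound[OF x x] asm(1) by simp
    moreover have "(LINT r|lebesgue_on {0..\<tau>}. ?F3 r x x) \<le> (C5 + C2\<^sup>2) * (LINT s|lebesgue_on {0..\<tau>}. (L2_norm (\<Theta> s))\<^sup>2)"
    proof -
      have "(LINT r|lebesgue_on {0..\<tau>}. ?F3 r x x) \<le> (LINT s|lebesgue_on {0..\<tau>}. (C5 + C2\<^sup>2) * (L2_norm (\<Theta> s))\<^sup>2)"
      proof (rule integral_mono)
        show "integrable (lebesgue_on {0..\<tau>}) (\<lambda>r. ?F3 r x x)"
          by (rule integrable_lebesgue_on_Icc[OF fields.f3.F_cont[OF x x]])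
        show "integrable (lebesgue_on {0..\<tau>}) (\<lambda>s. (C5 + C2\<^sup>2) * (L2_norm (\<Theta> s))\<^sup>2)"
          by (intro integrable_lebesgue_on_Icc continuous_intros C_L2_norm_continuous[OF C_C_imp_C_L2[OF \<Theta>]])
        show "?F3 s x x \<le> (C5 + C2\<^sup>2) * (L2_norm (\<Theta> s))\<^sup>2" if "s \<in> space (lebesgue_on {0..\<tau>})" for s
          using F3[of s x x] x that by auto
      qed
      then show ?thesis by simp
    qed
    ultimately have "(\<alpha> * \<beta>)\<^sup>2 * (LINT r|lebesgue_on {0..\<tau>}. A x x) + (\<alpha> * \<zeta>)\<^sup>2 * (LINT r|lebesgue_on {0..\<tau>}. ?F3 r x x)
      \<le> (\<alpha> * \<beta>)\<^sup>2 * (C2 * \<tau>) + (\<alpha> * \<zeta>)\<^sup>2 * ((C5 + C2\<^sup>2) * (LINT s|lebesgue_on {0..\<tau>}. (L2_norm (\<Theta> s))\<^sup>2))"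
      by (intro add_mono mult_left_mono) auto
    then show ?thesis by (simp only: power_mult_distrib mult_ac)
  qed
  show ?thesis
    using solution_C_exists_unique solution_L2_exists_unique[OF _ v] by blast
qed

end
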